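(* Let $\Gamma\in\mathscr G_3(\theta_0,\theta_1,\theta_2)$ be such that $\mathcal W(\Gamma)$ has type $\begin{bmatrix}2&2\\ &3\end{bmatrix}$. Then: (i) $\Gamma$ is biregular with degrees $k_1\neq k_2$ and valency partition $\{V_1,V_2\}$, which is equitable with quotient matrix $\begin{bmatrix}k_{11}&k_{12}\\ k_{21}&k_{22}\end{bmatrix}$, and $|V_i|=n_i$ for $i\in\{1,2\}$; (ii) $A(\Gamma)$ has the form $\begin{bmatrix}\varepsilon(J-I)&M\\ M^\top&A(\Gamma[V_2])\end{bmatrix}$, where $\varepsilon\in\{0,1\}$ and $M$ is the incidence matrix of a QSD $\mathcal Q$ with parameters $(n_1,k_{21},\lambda;n_2,k_{12},\{x,y\})$ and $\Gamma[V_2]=\mathsf B_x(\mathcal Q)$. Suppose that $\mathsf B_x(\mathcal Q)$ has restricted eigenvalues $e_1>e_2$. Then either $\theta_1=e_1=\frac{y-k_{21}}{x-y}$ or $\theta_2=e_2=\frac{y-k_{21}}{x-y}$. Furthermore, $$(x,y)=\bigl(k_{21}+(\theta_1+1)(\theta_2+1)-(e_1+1)(e_2+1),\;k_{21}+\theta_1\theta_2-e_1e_2\bigr);$$ $$\lambda-k_{12}=\begin{cases}\theta_1\theta_2,&\text{if }\Gamma[V_1]\text{ is empty};\\ (\theta_1+1)(\theta_2+1),&\text{if }\Gamma[V_1]\text{ is complete};\end{cases}$$ $$\frac{k_{12}-\lambda+y-k_{21}}{x-y}=\begin{cases}\theta_1+\theta_2,&\text{if }\Gamma[V_1]\text{ is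 empty};\\ \theta_1+\theta_2+1,&\text{if }\Gamma[V_1]\text{ is complete};\end{cases}$$ $$\sqrt{(k_1+\theta_1\theta_2)(k_2+\theta_1\theta_2)}=\begin{cases}\dfrac{\lambda k_{21}-yk_{12}}{x-y},&\text{if }\Gamma[V_1]\text{ is empty};\\[2mm] k_{21}+\dfrac{\lambda k_{21}-yk_{12}}{x-y},&\text{if }\Gamma[V_1]\text{ is complete}.\end{cases}$$
   Context: All graphs are finite, undirected and simple; eigenvalues are those of the adjacency matrix $A(\Gamma)$. $\mathscr G_3$ is the set of connected graphs with precisely three distinct eigenvalues, and $\mathscr G_3(\theta_0,\theta_1,\theta_2)$, for $\theta_0>\theta_1>\theta_2$, is the subset of those whose distinct eigenvalues are $\theta_0,\theta_1,\theta_2$. $I$, $J$ are the identity and all-ones matrices. $\Gamma[U]$ is the subgraph induced on $U$. A graph is biregular if its vertices have exactly two distinct degrees. The valency partition groups the vertices by degree; $V_i$ is the set of vertices of degree $k_i$. A vertex partition $\{V_1,V_2\}$ is equitable with quotient matrix $(k_{ij})$ if each vertex of $V_i$ has exactly $k_{ij}$ neighbours in $V_j$. An eigenvalue of a graph is restricted if it has an eigenvector orthogonal to the all-ones vector. A coherent algebra on a finite set $X$ is a matrix algebra $\mathcal A\subset \operatorname{Mat}_X(\mathbb C)$ containing $I$ and $J$ and closed under transposition, ordinary multiplication and entrywise multiplication. It has a unique linear basis of $\{0,1\}$-matrices summing to $J$. The supports of the diagonal basis matrices are the fibres $X_1,\dots,X_f$, which partition $X$; each basis matrix is supported in a single $X_i\times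 X_j$. The type is the symmetric matrix $(t_{ij})$ with $t_{ij}$ the number of basis matrices supported in $X_i\times X_j$ (up to reordering the fibres; entries below the diagonal omitted). The coherent closure $\mathcal W(\Gamma)$ is the smallest coherent algebra containing $A(\Gamma)$. A $2$-$(v,k,\lambda)$ design is a set $\mathcal P$ of $v$ points with a family $\mathcal B$ of $k$-subsets (blocks; repetitions allowed) such that every pair of distinct points lies in exactly $\lambda$ blocks; $b=|\mathcal B|$ and $r$ is the number of blocks containing any given point. It is quasi-symmetric with intersection numbers $x\neq y$ if every two blocks meet in $x$ or $y$ points and both occur; it is then called a QSD with parameters $(v,k,\lambda;b,r,\{x,y\})$. The incidence matrix has rows indexed by points and columns by blocks, with entry $1$ if the point is in the block and $0$ otherwise. The $x$-block graph $\mathsf B_x(\mathcal Q)$ has the blocks as vertices, two blocks being adjacent when they meet in $x$ points. *)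

theory Defs
  imports Complex_Main "HOL-Library.Disjoint_Sets" "Graph_Theory.Digraph_Component"
begin

text \<open>
  Finite simple graphs are those \<open>G :: 'a pair_pre_digraph\<close> with \<open>pair_graph G\<close>: an undirected
  edge is a pair of opposite arcs, so the degree of a vertex is its \<open>out_degree\<close>.

  A matrix with rows and columns indexed by a set \<open>X\<close> is a function \<open>'a \<Rightarrow> 'a \<Rightarrow> _\<close>
  that is 0 outside \<open>X \<times> X\<close>, so that equality of matrices is equality of functions.
\<close>

subsection \<open>Matrices indexed by a set\<close>

definition fmats :: "'a set \<Rightarrow> ('a \<Rightarrow> 'a \<Rightarrow> 'c::zero) set" where
  "fmats X = {A. \<forall>i j. i \<notin> X \<or> j \<notin> X \<longrightarrow> A i j = 0}"

definition fmat_id :: "'a set \<Rightarrow> 'a \<Rightarrow> 'a \<Rightarrow> 'c::zero_neq_one" where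
  "fmat_id X i j = (if i \<in> X \<and> i = j then 1 else 0)"

definition fmat_ones :: "'a set \<Rightarrow> 'a \<Rightarrow> 'a \<Rightarrow> 'c::zero_neq_one" where
  "fmat_ones X i j = (if i \<in> X \<and> j \<in> X then 1 else 0)"

definition fmat_mult :: "'a set \<Rightarrow> ('a \<Rightarrow> 'a \<Rightarrow> 'c) \<Rightarrow> ('a \<Rightarrow> 'a \<Rightarrow> 'c) \<Rightarrow> 'a \<Rightarrow> 'a \<Rightarrow> 'c::semiring_0" where
  "fmat_mult X A B i j = (\<Sum>k\<in>X. A i k * B k j)"

definition fmat_transpose :: "('a \<Rightarrow> 'b \<Rightarrow> 'c) \<Rightarrow> 'b \<Rightarrow> 'a \<Rightarrow> 'c" where
  "fmat_transpose A i j = A j i"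

text \<open>The matrix with blocks \<open>P, M\<close> in the first and \<open>N, R\<close> in the second row.\<close>

definition block_fmat ::
  "'a set \<Rightarrow> 'a set \<Rightarrow> ('a \<Rightarrow> 'a \<Rightarrow> 'c) \<Rightarrow> ('a \<Rightarrow> 'a \<Rightarrow> 'c) \<Rightarrow> ('a \<Rightarrow> 'a \<Rightarrow> 'c) \<Rightarrow> ('a \<Rightarrow> 'a \<Rightarrow> 'c)
    \<Rightarrow> 'a \<Rightarrow> 'a \<Rightarrow> 'c::zero" where
  "block_fmat V1 V2 P M N R i j =
    (if i \<in> V1 \<and> j \<in> V1 then P i j
     else if i \<in> V1 \<and> j \<in> V2 then M i j
     else if i \<in> V2 \<and> j \<in> V1 then N i j
     else if i \<in> V2 \<and> j \<in> V2 then R i j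
     else 0)"

subsection \<open>Graphs and their eigenvalues\<close>

definition adj_matrix :: "('a, 'b) pre_digraph \<Rightarrow> 'a \<Rightarrow> 'a \<Rightarrow> 'c::zero_neq_one" where
  "adj_matrix G i j = (if i \<in> verts G \<and> j \<in> verts G \<and> i \<rightarrow>\<^bsub>G\<^esub> j then 1 else 0)"

definition graph_eigenvector :: "('a, 'b) pre_digraph \<Rightarrow> real \<Rightarrow> ('a \<Rightarrow> real) \<Rightarrow> bool" where
  "graph_eigenvector G \<theta> u \<longleftrightarrow>
    (\<exists>i\<in>verts G. u i \<noteq> 0) \<and>
    (\<forall>i\<in>verts G. (\<Sum>j\<in>verts G. adj_matrix G i j * u j) = \<theta> * u i)"

definition graph_eigenvalues :: "('a, 'b) pre_digraph \<Rightarrow> real set" where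
  "graph_eigenvalues G = {\<theta>. \<exists>u. graph_eigenvector G \<theta> u}"

definition restricted_eigenvalues :: "('a, 'b) pre_digraph \<Rightarrow> real set" where
  "restricted_eigenvalues G = {\<theta>. \<exists>u. graph_eigenvector G \<theta> u \<and> (\<Sum>i\<in>verts G. u i) = 0}"

definition G3 :: "real \<Rightarrow> real \<Rightarrow> real \<Rightarrow> 'a pair_pre_digraph set" where
  "G3 \<theta>0 \<theta>1 \<theta>2 = {G. pair_graph G \<and> Digraph_Component.connected (with_proj G) \<and>
     \<theta>0 > \<theta>1 \<and> \<theta>1 > \<theta>2 \<and> graph_eigenvalues (with_proj G) = {\<theta>0, \<theta>1, \<theta>2}}"

definition empty_graph :: "('a, 'b) pre_digraph \<Rightarrow> bool" where
  "empty_graph G \<longleftrightarrow> (\<forall>u\<in>verts G. \<forall>v\<in>verts G. \<not> u \<rightarrow>\<^bsub>G\<^esub> v)"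

definition complete_graph :: "('a, 'b) pre_digraph \<Rightarrow> bool" where
  "complete_graph G \<longleftrightarrow> (\<forall>u\<in>verts G. \<forall>v\<in>verts G. u \<noteq> v \<longrightarrow> u \<rightarrow>\<^bsub>G\<^esub> v)"

definition degree_class :: "('a, 'b) pre_digraph \<Rightarrow> nat \<Rightarrow> 'a set" where
  "degree_class G k = {v \<in> verts G. out_degree G v = k}"

definition valency_partition :: "('a, 'b) pre_digraph \<Rightarrow> 'a set set" where
  "valency_partition G = degree_class G ` (out_degree G ` verts G)"

definition biregular :: "('a, 'b) pre_digraph \<Rightarrow> bool" where
  "biregular G \<longleftrightarrow> card (out_degree G ` verts G) = 2"

definition equitable :: "('a, 'b) pre_digraph \<Rightarrow> 'a set list \<Rightarrow> nat list list \<Rightarrow> bool" where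
  "equitable G Vs K \<longleftrightarrow>
    distinct Vs \<and> partition_on (verts G) (set Vs) \<and>
    (\<forall>i<length Vs. \<forall>j<length Vs. \<forall>v\<in>Vs ! i. card {w \<in> Vs ! j. v \<rightarrow>\<^bsub>G\<^esub> w} = K ! i ! j)"

subsection \<open>Coherent algebras\<close>

definition coherent_algebra :: "'a set \<Rightarrow> ('a \<Rightarrow> 'a \<Rightarrow> complex) set \<Rightarrow> bool" where
  "coherent_algebra X \<A> \<longleftrightarrow>
    finite X \<and> \<A> \<subseteq> fmats X \<and> fmat_id X \<in> \<A> \<and> fmat_ones X \<in> \<A> \<and>
    (\<forall>A\<in>\<A>. \<forall>B\<in>\<A>. (\<lambda>i j. A i j + B i j) \<in> \<A>) \<and>
    (\<forall>c. \<forall>A\<in>\<A>. (\<lambda>i j. c * A i j) \<in> \<A>) \<and>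
    (\<forall>A\<in>\<A>. fmat_transpose A \<in> \<A>) \<and>
    (\<forall>A\<in>\<A>. \<forall>B\<in>\<A>. fmat_mult X A B \<in> \<A>) \<and>
    (\<forall>A\<in>\<A>. \<forall>B\<in>\<A>. (\<lambda>i j. A i j * B i j) \<in> \<A>)"

definition coherent_closure :: "'a set \<Rightarrow> ('a \<Rightarrow> 'a \<Rightarrow> complex) \<Rightarrow> ('a \<Rightarrow> 'a \<Rightarrow> complex) set" where
  "coherent_closure X A = \<Inter>{\<A>. coherent_algebra X \<A> \<and> A \<in> \<A>}"

definition standard_basis ::
  "'a set \<Rightarrow> ('a \<Rightarrow> 'a \<Rightarrow> complex) set \<Rightarrow> ('a \<Rightarrow> 'a \<Rightarrow> complex) set \<Rightarrow> bool" where
  "standard_basis X \<A> \<B> \<longleftrightarrow>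
    finite \<B> \<and>
    (\<forall>B\<in>\<B>. \<forall>i j. B i j \<in> {0, 1}) \<and>
    (\<lambda>i j. \<Sum>B\<in>\<B>. B i j) = fmat_ones X \<and>
    (\<forall>c. (\<lambda>i j. \<Sum>B\<in>\<B>. c B * B i j) = (\<lambda>i j. 0) \<longrightarrow> (\<forall>B\<in>\<B>. c B = 0)) \<and>
    \<A> = range (\<lambda>c i j. \<Sum>B\<in>\<B>. c B * B i j)"

definition fmat_support :: "('a \<Rightarrow> 'a \<Rightarrow> 'c::zero) \<Rightarrow> ('a \<times> 'a) set" where
  "fmat_support B = {(i, j). B i j \<noteq> 0}"

definition fibres :: "('a \<Rightarrow> 'a \<Rightarrow> complex) set \<Rightarrow> 'a set set" where
  "fibres \<B> = {fst ` fmat_support B | B. B \<in> \<B> \<and> fmat_support B \<subseteq> Id}"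

text \<open>
  \<open>T\<close> is the full symmetric type matrix, given by its rows. The list \<open>Xs\<close> is an
  enumeration of the fibres, so the type is only determined up to reordering them.
\<close>

definition has_type :: "'a set \<Rightarrow> ('a \<Rightarrow> 'a \<Rightarrow> complex) set \<Rightarrow> nat list list \<Rightarrow> bool" where
  "has_type X \<A> T \<longleftrightarrow>
    (\<exists>\<B> Xs. standard_basis X \<A> \<B> \<and> distinct Xs \<and> set Xs = fibres \<B> \<and>
       length T = length Xs \<and>
       (\<forall>i<length Xs. length (T ! i) = length Xs \<and>
          (\<forall>j<length Xs. T ! i ! j = card {B \<in> \<B>. fmat_support B \<subseteq> Xs ! i \<times> Xs ! j})))"

subsection \<open>Designs\<close>

text \<open>Blocks form a family indexed by \<open>block_ids\<close>, which allows repeated blocks.\<close>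

record ('p, 'b) design =
  points :: "'p set"
  block_ids :: "'b set"
  block :: "'b \<Rightarrow> 'p set"

definition two_design :: "('p, 'b) design \<Rightarrow> nat \<Rightarrow> nat \<Rightarrow> nat \<Rightarrow> bool" where
  "two_design D v k l \<longleftrightarrow>
    finite (points D) \<and> card (points D) = v \<and> finite (block_ids D) \<and>
    (\<forall>j\<in>block_ids D. block D j \<subseteq> points D \<and> card (block D j) = k) \<and>
    (\<forall>p\<in>points D. \<forall>q\<in>points D. p \<noteq> q \<longrightarrow>
       card {j \<in> block_ids D. p \<in> block D j \<and> q \<in> block D j} = l)"

definition quasi_symmetric :: "('p, 'b) design \<Rightarrow> nat \<Rightarrow> nat \<Rightarrow> bool" where
  "quasi_symmetric D x y \<longleftrightarrow>
    x \<noteq> y \<and>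
    {card (block D i \<inter> block D j) | i j. i \<in> block_ids D \<and> j \<in> block_ids D \<and> i \<noteq> j} = {x, y}"

definition QSD ::
  "('p, 'b) design \<Rightarrow> nat \<Rightarrow> nat \<Rightarrow> nat \<Rightarrow> nat \<Rightarrow> nat \<Rightarrow> nat \<Rightarrow> nat \<Rightarrow> bool" where
  "QSD D v k l b r x y \<longleftrightarrow>
    two_design D v k l \<and> card (block_ids D) = b \<and>
    (\<forall>p\<in>points D. card {j \<in> block_ids D. p \<in> block D j} = r) \<and>
    quasi_symmetric D x y"

definition incidence_matrix :: "('p, 'b) design \<Rightarrow> 'p \<Rightarrow> 'b \<Rightarrow> 'c::zero_neq_one" where
  "incidence_matrix D p j = (if p \<in> points D \<and> j \<in> block_ids D \<and> p \<in> block D j then 1 else 0)"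

definition block_graph :: "nat \<Rightarrow> ('p, 'b) design \<Rightarrow> 'b pair_pre_digraph" where
  "block_graph x D = \<lparr> pverts = block_ids D,
     parcs = {(i, j). i \<in> block_ids D \<and> j \<in> block_ids D \<and> i \<noteq> j \<and>
                      card (block D i \<inter> block D j) = x} \<rparr>"

end

theory Submission
  imports Defs "HOL-Analysis.Function_Topology"
begin

text \<open>
  Write \<open>A\<close> for the adjacency matrix. Since the graph is connected, its largest eigenvalue \<open>\<theta>0\<close> is simple
  with a positive eigenvector, and as \<open>(A - \<theta>0)(A - \<theta>1)(A - \<theta>2) = 0\<close> there is a positive vector \<open>\<alpha>\<close> with
  \<open>A\<^sup>2 = (\<theta>1 + \<theta>2) A - \<theta>1 \<theta>2 I + \<alpha> \<alpha>\<^sup>T\<close> (lemma \<open>three_eigenvalues_rank_one\<close>). The diagonal of this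
  equation shows that \<open>\<alpha> i\<close> depends only on the degree of \<open>i\<close>.

  The matrices of the coherent closure are constant on the classes given by its standard basis. For the
  given type (lemma \<open>type_2_2_3_blocks\<close>) this makes degrees and the numbers of neighbours in each fibre
  constant on the fibres, it makes the first fibre empty or complete, and it makes the number of common
  neighbours in one fibre constant on the classes. So the block \<open>M\<close> of \<open>A\<close> between the fibres is the
  incidence matrix of a design, and the numbers of points common to two blocks take at most two values,
  which are governed by the block \<open>N\<close> of \<open>A\<close> on the second fibre. Most degenerate cases contradict the
  minimality of the coherent closure. If the two degrees agree, the closure lies in the span of \<open>I\<close>, \<open>A\<close>
  and \<open>J\<close>. If \<open>M = J\<close>, or if \<open>N\<close> is \<open>0\<close> or \<open>J - I\<close>, it lies in a coherent algebra whose members are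
  constant between the fibres, or off the diagonal of the second fibre. The case \<open>M = 0\<close> contradicts
  \<open>\<alpha> > 0\<close>, and equal intersection numbers would make \<open>N\<close> a combination of \<open>I\<close> and \<open>J\<close>
  (lemma \<open>intersection_numbers_distinct\<close>).

  The numerical statements come from comparing coefficients in the blocks of the equation for \<open>A\<^sup>2\<close> and in
  the two evaluations of \<open>M M\<^sup>T M\<close>. A restricted eigenvector \<open>u\<close> of \<open>N\<close> with eigenvalue \<open>e\<close> either satisfies
  \<open>M u = 0\<close>, so that \<open>e = (y - k21) / (x - y)\<close> is \<open>\<theta>1\<close> or \<open>\<theta>2\<close>, or \<open>e = \<theta>1 + \<theta>2 + \<epsilon>\<close>, where \<open>\<epsilon>\<close> is \<open>1\<close> if
  the first fibre is complete and \<open>0\<close> if it is empty. Which of two such values is the larger one is decided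
  by \<open>(\<theta>1 + \<epsilon>)(\<theta>2 + \<epsilon>) = l - k12 < 0\<close> (lemmas \<open>lambda_less_r\<close> and \<open>restricted_eigenvalues_pair\<close>).
\<close>

section \<open>Coherent algebras and their standard bases\<close>

lemma coherent_algebra_fmats:
  assumes "finite X"
  shows "coherent_algebra X (fmats X)"
  using assms
  by (auto simp: coherent_algebra_def fmats_def fmat_id_def fmat_ones_def fmat_transpose_def
      fmat_mult_def)

lemma coherent_algebra_closure:
  assumes "finite X" "A \<in> fmats X"
  shows "coherent_algebra X (coherent_closure X A)"
proof -
  have "fmats X \<in> {\<A>. coherent_algebra X \<A> \<and> A \<in> \<A>}"
    using assms coherent_algebra_fmats by blast
  then have "coherent_closure X A \<subseteq> fmats X"
    unfolding coherent_closure_def by blast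
  with assms(1) show ?thesis
    unfolding coherent_algebra_def coherent_closure_def by auto
qed

lemma coherent_closure_contains: "A \<in> coherent_closure X A"
  by (auto simp: coherent_closure_def)

lemma coherent_closure_least:
  "coherent_algebra X \<A> \<Longrightarrow> A \<in> \<A> \<Longrightarrow> coherent_closure X A \<subseteq> \<A>"
  by (auto simp: coherent_closure_def)

lemma coherent_algebraD:
  assumes "coherent_algebra X \<A>"
  shows "finite X" "A \<in> \<A> \<Longrightarrow> A \<in> fmats X" "fmat_id X \<in> \<A>" "fmat_ones X \<in> \<A>"
    "A \<in> \<A> \<Longrightarrow> B \<in> \<A> \<Longrightarrow> fmat_mult X A B \<in> \<A>"
  using assms by (auto simp: coherent_algebra_def)

context
  fixes X :: "'a set" and \<A> \<B> :: "('a \<Rightarrow> 'a \<Rightarrow> complex) set"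
  assumes coh: "coherent_algebra X \<A>" and sb: "standard_basis X \<A> \<B>"
begin

lemma standard_basis_finite: "finite \<B>"
  using sb unfolding standard_basis_def by (elim conjE)

lemma standard_basis_01:
  assumes "B \<in> \<B>"
  shows "B i j = 0 \<or> B i j = 1"
proof -
  have "\<forall>B\<in>\<B>. \<forall>i j. B i j \<in> {0, 1}"
    using sb unfolding standard_basis_def by (elim conjE)
  with assms show ?thesis by blast
qed

lemma standard_basis_card:
  "of_nat (card {B \<in> \<B>. B i j = 1}) = (fmat_ones X i j :: complex)"
proof -
  note fin = standard_basis_finite
  have "(\<lambda>i j. \<Sum>B\<in>\<B>. B i j) = fmat_ones X"
    using sb unfolding standard_basis_def by (elim conjE)
  from fun_cong[OF fun_cong[OF this, of i], of j]
  have "fmat_ones X i j = (\<Sum>B\<in>\<B>. B i j)" by (rule sym)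
  also have "\<dots> = (\<Sum>B\<in>\<B>. if B i j = 1 then 1 else 0)"
    by (rule sum.cong) (use standard_basis_01 in auto)
  also have "\<dots> = of_nat (card {B \<in> \<B>. B i j = 1})"
    using fin by (simp add: sum.If_cases Int_def)
  finally show ?thesis by simp
qed

lemma standard_basis_unique:
  assumes "B \<in> \<B>" "B' \<in> \<B>" "B i j = 1" "B' i j = 1"
  shows "B = B'"
proof -
  have "card {B \<in> \<B>. B i j = 1} \<le> 1"
    using standard_basis_card[of i j] by (auto simp: fmat_ones_def split: if_splits)
  moreover have "finite {B \<in> \<B>. B i j = 1}" using standard_basis_finite by simp
  ultimately show ?thesis using assms by (auto simp: card_le_Suc0_iff_eq)
qed

lemma standard_basis_ex:
  assumes "i \<in> X" "j \<in> X"
  obtains B where "B \<in> \<B>" "B i j = 1"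
proof -
  have "card {B \<in> \<B>. B i j = 1} = 1"
    using standard_basis_card[of i j] assms by (simp add: fmat_ones_def)
  then have "{B \<in> \<B>. B i j = 1} \<noteq> {}" by (metis card.empty zero_neq_one)
  then show ?thesis using that by blast
qed

lemma standard_basis_span: "\<A> = range (\<lambda>c i j. \<Sum>B\<in>\<B>. c B * B i j)"
  using sb unfolding standard_basis_def by (elim conjE)

lemma standard_basis_subset:
  assumes B: "B \<in> \<B>"
  shows "B \<in> \<A>"
  unfolding standard_basis_span
proof (rule range_eqI)
  note fin = standard_basis_finite
  show "B = (\<lambda>i j. \<Sum>B'\<in>\<B>. (if B' = B then 1 else 0) * B' i j)"
    using B fin by (auto simp: if_distrib[of "\<lambda>x. x * _"] cong: if_cong)
qed

text \<open>
  The members of the algebra are constant on the support of each basis matrix. All constants that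
  occur below (degrees, numbers of common neighbours) come from this fact.
\<close>

lemma standard_basis_const:
  assumes Y: "Y \<in> \<A>" and B: "B \<in> \<B>" "B i j = 1" "B k l = 1"
  shows "Y i j = Y k l"
proof -
  obtain c where c: "Y = (\<lambda>i j. \<Sum>B\<in>\<B>. c B * B i j)"
    using Y unfolding standard_basis_span by (rule rangeE)
  have "Y p q = c B" if "B p q = 1" for p q
  proof -
    have "(\<Sum>B'\<in>\<B>. c B' * B' p q) = (\<Sum>B'\<in>\<B>. if B' = B then c B else 0)"
    proof (rule sum.cong[OF refl])
      fix B' assume B': "B' \<in> \<B>"
      show "c B' * B' p q = (if B' = B then c B else 0)"
      proof (cases "B' = B")
        case True
        then show ?thesis using that by simp
      next
        case False
        then have "B' p q \<noteq> 1" using standard_basis_unique[OF B' B(1) _ that] by blast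
        then have "B' p q = 0" using standard_basis_01[OF B', of p q] by simp
        then show ?thesis using False by simp
      qed
    qed
    moreover have "finite \<B>" using standard_basis_finite by simp
    ultimately show ?thesis using B(1) unfolding c by simp
  qed
  then show ?thesis using B by simp
qed

lemma standard_basis_nonzero:
  assumes B: "B \<in> \<B>"
  shows "\<exists>i\<in>X. \<exists>j\<in>X. B i j = 1"
proof -
  have "\<exists>i j. B i j \<noteq> 0"
  proof (rule ccontr)
    assume "\<not> ?thesis"
    then have z: "B i j = 0" for i j by auto
    have 0: "(\<lambda>i j. \<Sum>B'\<in>\<B>. (if B' = B then 1 else 0) * B' i j) = (\<lambda>i j. 0)"
    proof (intro ext)
      fix i j
      show "(\<Sum>B'\<in>\<B>. (if B' = B then 1 else 0) * B' i j) = 0"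
        by (rule sum.neutral) (simp add: z)
    qed
    have "\<forall>c. (\<lambda>i j. \<Sum>B\<in>\<B>. c B * B i j) = (\<lambda>i j. 0) \<longrightarrow> (\<forall>B\<in>\<B>. c B = 0)"
      using sb unfolding standard_basis_def by (elim conjE)
    from mp[OF spec[OF this] 0] have "\<forall>B'\<in>\<B>. (if B' = B then 1 else 0 :: complex) = 0" .
    from bspec[OF this B] show False by simp
  qed
  then obtain i j where ij: "B i j \<noteq> 0" by auto
  moreover have "B \<in> fmats X" using standard_basis_subset[OF B] coherent_algebraD(2)[OF coh] by blast
  ultimately show ?thesis using standard_basis_01[OF B, of i j] unfolding fmats_def by blast
qed

text \<open>A basis matrix with diagonal support is the identity matrix of its fibre.\<close>

lemma fibre_fmat_id:
  assumes "F \<in> fibres \<B>"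
  shows "fmat_id F \<in> \<B>" "F \<subseteq> X" "F \<noteq> {}"
proof -
  obtain B where B: "B \<in> \<B>" "fmat_support B \<subseteq> Id" "F = fst ` fmat_support B"
    using assms unfolding fibres_def by blast
  have dg: "i = j \<and> i \<in> F" if "B i j \<noteq> 0" for i j
  proof -
    have ij: "(i, j) \<in> fmat_support B" using that by (simp add: fmat_support_def)
    then have "fst (i, j) \<in> F" unfolding B(3) by (rule imageI)
    moreover have "(i, j) \<in> Id" using ij B(2) by (rule rev_subsetD)
    ultimately show ?thesis by simp
  qed
  have dg': "B i i \<noteq> 0" if "i \<in> F" for i
  proof -
    obtain p where p: "i = fst p" "p \<in> fmat_support B" using \<open>i \<in> F\<close> unfolding B(3) by (rule imageE)
    then have "B i (snd p) \<noteq> 0" by (simp add: fmat_support_def split_beta)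
    then show ?thesis using dg[of i "snd p"] by simp
  qed
  have "B i j = fmat_id F i j" for i j
    using dg[of i j] dg'[of i] standard_basis_01[OF B(1), of i j] by (auto simp: fmat_id_def)
  then have eq: "B = fmat_id F" by (simp add: fun_eq_iff)
  show *: "fmat_id F \<in> \<B>" using B(1) unfolding eq .
  have "(fmat_id F :: 'a \<Rightarrow> 'a \<Rightarrow> complex) \<in> fmats X"
    using standard_basis_subset[OF *] coherent_algebraD(2)[OF coh] by blast
  then have "(fmat_id F i i :: complex) = 0" if "i \<notin> X" for i using that by (simp add: fmats_def)
  then show "F \<subseteq> X" unfolding fmat_id_def by fastforce
  show "F \<noteq> {}" using standard_basis_nonzero[OF *] by (auto simp: fmat_id_def split: if_splits)
qed

lemma fibres_disjoint:
  assumes "F \<in> fibres \<B>" "F' \<in> fibres \<B>" "i \<in> F" "i \<in> F'"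
  shows "F = F'"
proof -
  have "(fmat_id F :: 'a \<Rightarrow> 'a \<Rightarrow> complex) = fmat_id F'"
    using assms by (intro standard_basis_unique[of _ _ i i] fibre_fmat_id) (auto simp: fmat_id_def)
  then have "fmat_id F j j = (fmat_id F' j j :: complex)" for j by simp
  then have "j \<in> F \<longleftrightarrow> j \<in> F'" for j
    by (metis fmat_id_def zero_neq_one)
  then show ?thesis by blast
qed

lemma fibres_cover: "\<Union>(fibres \<B>) = X"
proof
  show "\<Union>(fibres \<B>) \<subseteq> X" by (rule Union_least) (rule fibre_fmat_id(2))
  show "X \<subseteq> \<Union>(fibres \<B>)"
  proof
    fix i assume i: "i \<in> X"
    obtain B where B: "B \<in> \<B>" "B i i = 1" by (rule standard_basis_ex[OF i i])
    have "fmat_support B \<subseteq> Id"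
    proof (clarsimp simp: fmat_support_def)
      fix k l assume "B k l \<noteq> 0"
      then have "B k l = 1" using standard_basis_01[OF B(1)] by blast
      then have "fmat_id X i i = (fmat_id X k l :: complex)"
        using standard_basis_const[OF coherent_algebraD(3)[OF coh] B(1)] B(2) by blast
      then show "k = l" using i by (auto simp: fmat_id_def split: if_splits)
    qed
    moreover have "(i, i) \<in> fmat_support B" using B(2) by (simp add: fmat_support_def)
    then have "i \<in> fst ` fmat_support B" by (rule image_eqI[rotated]) simp
    ultimately show "i \<in> \<Union>(fibres \<B>)" using B(1) unfolding fibres_def by blast
  qed
qed

lemma basis_support_block:
  assumes F: "F \<in> fibres \<B>" "F' \<in> fibres \<B>" and B: "B \<in> \<B>" "B i j = 1" "i \<in> F" "j \<in> F'"
  shows "fmat_support B \<subseteq> F \<times> F'"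
proof (clarsimp simp: fmat_support_def)
  fix k l assume "B k l \<noteq> 0"
  then have kl: "B k l = 1" using standard_basis_01[OF B(1)] by blast
  have FX: "F \<subseteq> X" "F' \<subseteq> X" "finite X"
    using F fibre_fmat_id coherent_algebraD(1)[OF coh] by auto
  \<comment> \<open>The indicators of \<open>F \<times> X\<close> and \<open>X \<times> F'\<close> belong to the algebra, hence are constant on the support.\<close>
  have m1: "fmat_mult X (fmat_id F) (fmat_ones X) \<in> \<A>"
    and m2: "fmat_mult X (fmat_ones X) (fmat_id F') \<in> \<A>"
    using F fibre_fmat_id standard_basis_subset coherent_algebraD(4,5)[OF coh] by auto
  have e1: "fmat_mult X (fmat_id F) (fmat_ones X) p q = (if p \<in> F \<and> q \<in> X then 1 else 0 :: complex)" for p q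
    using FX by (auto simp: fmat_mult_def fmat_id_def fmat_ones_def if_distrib[of "\<lambda>x. x * _"] cong: if_cong)
  have e2: "fmat_mult X (fmat_ones X) (fmat_id F') p q = (if p \<in> X \<and> q \<in> F' then 1 else 0 :: complex)" for p q
  proof -
    have "fmat_mult X (fmat_ones X) (fmat_id F') p q
        = (\<Sum>k\<in>X. if k = q then (if p \<in> X \<and> q \<in> F' then 1 else 0 :: complex) else 0)"
      unfolding fmat_mult_def by (rule sum.cong) (auto simp: fmat_id_def fmat_ones_def)
    then show ?thesis using FX by auto
  qed
  show "k \<in> F \<and> l \<in> F'"
    using standard_basis_const[OF m1 B(1,2) kl] standard_basis_const[OF m2 B(1,2) kl] B(3,4) FX
    unfolding e1 e2 by (auto split: if_splits)
qed

lemma block_basis_const: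
  assumes F: "F \<in> fibres \<B>" "F' \<in> fibres \<B>" and ij: "i \<in> F" "j \<in> F'"
  obtains B where "B \<in> \<B>" "fmat_support B \<subseteq> F \<times> F'" "B i j = 1"
proof -
  have "i \<in> X" "j \<in> X" using F ij fibre_fmat_id(2) by auto
  then obtain B where "B \<in> \<B>" "B i j = 1" by (rule standard_basis_ex)
  then show ?thesis using that[of B] basis_support_block[OF F _ _ ij, of B] by simp
qed

end

lemma card_2_insert:
  assumes "card A = 2" "a \<in> A"
  obtains b where "A = {a, b}" "b \<noteq> a"
proof -
  have "card (A - {a}) = 1" using assms by simp
  then obtain b where "A - {a} = {b}" by (auto simp: card_1_singleton_iff)
  then show thesis using that[of b] assms(2) by blast
qed

lemma card_3_insert:
  assumes "card A = 3" "a \<in> A"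
  obtains b c where "A = {a, b, c}" "b \<noteq> a" "c \<noteq> a" "b \<noteq> c"
proof -
  have "card (A - {a}) = 2" using assms by simp
  then obtain b c where "A - {a} = {b, c}" "b \<noteq> c" by (auto simp: card_2_iff)
  then show thesis using that[of b c] assms(2) by blast
qed

text \<open>
  The only use of the type. Its rows \<open>(2, 2)\<close> and \<open>(2, 3)\<close> say the following. On the first fibre the
  algebra consists of the combinations of \<open>I\<close> and \<open>J\<close>, which differ there. On the second fibre it
  consists of the combinations of \<open>I\<close>, \<open>S\<close> and \<open>J\<close>, with \<open>S\<close> not constant off the diagonal. Some
  member \<open>P\<close> of the algebra is not constant between the fibres. The non-constancy of \<open>P\<close> and \<open>S\<close>
  serves to exclude degenerate graphs, whose adjacency matrix lies in a smaller coherent algebra.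
\<close>

lemma type_2_2_3_blocks:
  fixes \<A> :: "('a \<Rightarrow> 'a \<Rightarrow> complex) set"
  assumes coh: "coherent_algebra X \<A>" and ty: "has_type X \<A> [[2, 2], [2, 3]]"
  obtains X1 X2 P S where
    "X = X1 \<union> X2" "X1 \<inter> X2 = {}" "X1 \<noteq> {}" "X2 \<noteq> {}"
    "fmat_id X1 \<in> \<A>" "fmat_id X2 \<in> \<A>" "P \<in> \<A>" "S \<in> \<A>"
    "\<exists>i\<in>X1. \<exists>j\<in>X1. i \<noteq> j"
    "\<forall>Y\<in>\<A>. \<exists>a b. \<forall>i\<in>X1. \<forall>j\<in>X1. Y i j = (if i = j then a else b)"
    "\<forall>Y\<in>\<A>. \<exists>a b c. \<forall>i\<in>X2. \<forall>j\<in>X2. Y i j = (if i = j then a else if S i j = 1 then b else c)"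
    "\<exists>i\<in>X1. \<exists>j\<in>X2. P i j = 1" "\<exists>i\<in>X1. \<exists>j\<in>X2. P i j \<noteq> 1"
    "\<exists>i\<in>X2. \<exists>j\<in>X2. i \<noteq> j \<and> S i j = 1" "\<exists>i\<in>X2. \<exists>j\<in>X2. i \<noteq> j \<and> S i j \<noteq> 1"
proof -
  obtain \<B> Xs where sb: "standard_basis X \<A> \<B>" and Xs: "distinct Xs" "set Xs = fibres \<B>"
    "length Xs = 2"
    and cards: "\<forall>i<2. \<forall>j<2. [[2, 2], [2, 3]] ! i ! j
        = card {B \<in> \<B>. fmat_support B \<subseteq> Xs ! i \<times> Xs ! j}"
    using ty unfolding has_type_def by fastforce
  define X1 where "X1 = Xs ! 0"
  define X2 where "X2 = Xs ! 1"
  have "Xs = [X1, X2]"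
    unfolding X1_def X2_def by (rule nth_equalityI) (auto simp: Xs(3) less_2_cases_iff)
  then have F: "X1 \<in> fibres \<B>" "X2 \<in> fibres \<B>" "X1 \<noteq> X2" "fibres \<B> = {X1, X2}"
    using Xs(1,2) by auto
  note sub = standard_basis_subset[OF coh sb]
  note const = standard_basis_const[OF coh sb]
  note uniq = standard_basis_unique[OF coh sb]
  have c11: "card {B \<in> \<B>. fmat_support B \<subseteq> X1 \<times> X1} = 2"
    and c12: "card {B \<in> \<B>. fmat_support B \<subseteq> X1 \<times> X2} = 2"
    and c22: "card {B \<in> \<B>. fmat_support B \<subseteq> X2 \<times> X2} = 3"
    using cards[rule_format, of 0 0] cards[rule_format, of 0 1] cards[rule_format, of 1 1]
    unfolding X1_def X2_def by auto
  note id1 = fibre_fmat_id[OF coh sb F(1)] and id2 = fibre_fmat_id[OF coh sb F(2)]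
  have supp_id: "fmat_support (fmat_id F :: 'a \<Rightarrow> 'a \<Rightarrow> complex) \<subseteq> F \<times> F" for F :: "'a set"
    by (auto simp: fmat_support_def fmat_id_def split: if_splits)
  have memb: "i \<in> F \<and> j \<in> F'" if "fmat_support B \<subseteq> F \<times> F'" "B i j = 1" for B :: "'a \<Rightarrow> 'a \<Rightarrow> complex" and F F' i j
  proof -
    have "(i, j) \<in> fmat_support B" using that(2) by (simp add: fmat_support_def)
    with that(1) show ?thesis by blast
  qed
  have "fmat_id X1 \<in> {B \<in> \<B>. fmat_support B \<subseteq> X1 \<times> X1}" using id1(1) supp_id by simp
  with c11 obtain R where R: "{B \<in> \<B>. fmat_support B \<subseteq> X1 \<times> X1} = {fmat_id X1, R}" "R \<noteq> fmat_id X1"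
    by (rule card_2_insert)
  obtain P P' where P: "{B \<in> \<B>. fmat_support B \<subseteq> X1 \<times> X2} = {P, P'}" "P \<noteq> P'"
    using c12 unfolding card_2_iff by (elim exE conjE)
  have "fmat_id X2 \<in> {B \<in> \<B>. fmat_support B \<subseteq> X2 \<times> X2}" using id2(1) supp_id by simp
  with c22 obtain S S' where S: "{B \<in> \<B>. fmat_support B \<subseteq> X2 \<times> X2} = {fmat_id X2, S, S'}"
    "S \<noteq> fmat_id X2" "S' \<noteq> fmat_id X2" "S \<noteq> S'"
    by (rule card_3_insert)
  have RB: "R \<in> \<B>" "fmat_support R \<subseteq> X1 \<times> X1" using R by blast+
  have PB: "P \<in> \<B>" "fmat_support P \<subseteq> X1 \<times> X2" "P' \<in> \<B>" "fmat_support P' \<subseteq> X1 \<times> X2" using P by blast+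
  have SB: "S \<in> \<B>" "fmat_support S \<subseteq> X2 \<times> X2" "S' \<in> \<B>" "fmat_support S' \<subseteq> X2 \<times> X2" using S by blast+
  have offdiag: "i \<noteq> j" if "B \<in> \<B>" "B i j = 1" "B \<noteq> fmat_id F" "i \<in> F" "fmat_id F \<in> \<B>" for B F i j
    using that uniq[of B "fmat_id F" i j] by (auto simp: fmat_id_def)
  have b11: "R i j = 1" if "i \<in> X1" "j \<in> X1" "i \<noteq> j" for i j
  proof -
    obtain B where "B \<in> \<B>" "fmat_support B \<subseteq> X1 \<times> X1" "B i j = 1"
      by (rule block_basis_const[OF coh sb F(1,1) \<open>i \<in> X1\<close> \<open>j \<in> X1\<close>])
    then have "B \<in> {fmat_id X1, R}" "B i j = 1" using R(1) by blast+
    then show ?thesis using that by (auto simp: fmat_id_def)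
  qed
  have b22: "S i j = 1 \<or> S' i j = 1" if "i \<in> X2" "j \<in> X2" "i \<noteq> j" for i j
  proof -
    obtain B where "B \<in> \<B>" "fmat_support B \<subseteq> X2 \<times> X2" "B i j = 1"
      by (rule block_basis_const[OF coh sb F(2,2) \<open>i \<in> X2\<close> \<open>j \<in> X2\<close>])
    then have "B \<in> {fmat_id X2, S, S'}" "B i j = 1" using S(1) by blast+
    then show ?thesis using that by (auto simp: fmat_id_def)
  qed
  have diag: "\<exists>a. \<forall>i\<in>F. Y i i = a" if "Y \<in> \<A>" "fmat_id F \<in> \<B>" for Y F
  proof (cases "F = {}")
    case False
    then obtain i where "i \<in> F" by blast
    then have "\<forall>k\<in>F. Y k k = Y i i"
      by (intro ballI const[OF that(1,2)]) (simp_all add: fmat_id_def)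
    then show ?thesis by (rule exI)
  qed simp
  have on: "\<exists>a. \<forall>i j. B i j = 1 \<longrightarrow> Y i j = a" if YB: "Y \<in> \<A>" "B \<in> \<B>" for Y B
  proof -
    obtain p q where "B p q = 1" using standard_basis_nonzero[OF coh sb YB(2)] by (elim bexE)
    then have "\<forall>i j. B i j = 1 \<longrightarrow> Y i j = Y p q" by (intro allI impI const[OF YB])
    then show ?thesis by (rule exI)
  qed
  show ?thesis
  proof (rule that[of X1 X2 P S])
    show "X = X1 \<union> X2" using fibres_cover[OF coh sb] F(4) by auto
    show "X1 \<inter> X2 = {}" using fibres_disjoint[OF coh sb F(1,2)] F(3) by auto
    show "X1 \<noteq> {}" "X2 \<noteq> {}" using id1 id2 by auto
    show "fmat_id X1 \<in> \<A>" "fmat_id X2 \<in> \<A>" "P \<in> \<A>" "S \<in> \<A>" using id1 id2 PB SB sub by auto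
  next
    obtain i j where ij: "R i j = 1" using standard_basis_nonzero[OF coh sb RB(1)] by (elim bexE)
    have m: "i \<in> X1" "j \<in> X1" using memb[OF RB(2) ij] by simp_all
    show "\<exists>i\<in>X1. \<exists>j\<in>X1. i \<noteq> j"
      using offdiag[OF RB(1) ij R(2) m(1) id1(1)] m by auto
  next
    obtain i j where ij: "P i j = 1" using standard_basis_nonzero[OF coh sb PB(1)] by (elim bexE)
    then show "\<exists>i\<in>X1. \<exists>j\<in>X2. P i j = 1" using memb[OF PB(2) ij] by auto
  next
    obtain i j where ij: "P' i j = 1" using standard_basis_nonzero[OF coh sb PB(3)] by (elim bexE)
    have "P i j \<noteq> 1" using uniq[OF PB(1,3) _ ij] P(2) by (rule contrapos_nn[rotated])
    then show "\<exists>i\<in>X1. \<exists>j\<in>X2. P i j \<noteq> 1" using memb[OF PB(4) ij] by auto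
  next
    obtain i j where ij: "S i j = 1" using standard_basis_nonzero[OF coh sb SB(1)] by (elim bexE)
    have m: "i \<in> X2" "j \<in> X2" using memb[OF SB(2) ij] by simp_all
    then show "\<exists>i\<in>X2. \<exists>j\<in>X2. i \<noteq> j \<and> S i j = 1"
      using offdiag[OF SB(1) ij S(2) m(1) id2(1)] ij by auto
  next
    obtain i j where ij: "S' i j = 1" using standard_basis_nonzero[OF coh sb SB(3)] by (elim bexE)
    have m: "i \<in> X2" "j \<in> X2" using memb[OF SB(4) ij] by simp_all
    have "S i j \<noteq> 1" using uniq[OF SB(1,3) _ ij] S(4) by (rule contrapos_nn[rotated])
    then show "\<exists>i\<in>X2. \<exists>j\<in>X2. i \<noteq> j \<and> S i j \<noteq> 1"
      using offdiag[OF SB(3) ij S(3) m(1) id2(1)] m by auto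
  next
    show "\<forall>Y\<in>\<A>. \<exists>a b. \<forall>i\<in>X1. \<forall>j\<in>X1. Y i j = (if i = j then a else b)"
    proof
      fix Y assume Y: "Y \<in> \<A>"
      obtain a where a: "\<forall>i\<in>X1. Y i i = a" using diag[OF Y id1(1)] ..
      obtain b where b: "\<forall>i j. R i j = 1 \<longrightarrow> Y i j = b" using on[OF Y RB(1)] ..
      have "\<forall>i\<in>X1. \<forall>j\<in>X1. Y i j = (if i = j then a else b)" using a b b11 by simp
      then show "\<exists>a b. \<forall>i\<in>X1. \<forall>j\<in>X1. Y i j = (if i = j then a else b)" by (intro exI)
    qed
  next
    show "\<forall>Y\<in>\<A>. \<exists>a b c. \<forall>i\<in>X2. \<forall>j\<in>X2. Y i j = (if i = j then a else if S i j = 1 then b else c)"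
    proof
      fix Y assume Y: "Y \<in> \<A>"
      obtain a where a: "\<forall>i\<in>X2. Y i i = a" using diag[OF Y id2(1)] ..
      obtain b where b: "\<forall>i j. S i j = 1 \<longrightarrow> Y i j = b" using on[OF Y SB(1)] ..
      obtain c where c: "\<forall>i j. S' i j = 1 \<longrightarrow> Y i j = c" using on[OF Y SB(3)] ..
      have "\<forall>i\<in>X2. \<forall>j\<in>X2. Y i j = (if i = j then a else if S i j = 1 then b else c)"
      proof (intro ballI)
        fix i j assume ij: "i \<in> X2" "j \<in> X2"
        show "Y i j = (if i = j then a else if S i j = 1 then b else c)"
        proof (cases "i = j")
          case False
          with ij have "S i j = 1 \<or> S' i j = 1" by (rule b22)
          then show ?thesis using False b c by (cases "S i j = 1") simp_all
        qed (use ij a in simp)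
      qed
      then show "\<exists>a b c. \<forall>i\<in>X2. \<forall>j\<in>X2. Y i j = (if i = j then a else if S i j = 1 then b else c)"
        by (intro exI)
    qed
  qed
qed

section \<open>Coherent algebras from the walks of length two\<close>

text \<open>
  The vertices are partitioned into the classes of \<open>\<kappa>\<close>. A matrix has block form if on each block,
  given by a pair of classes, it is a linear combination of \<open>J\<close>, \<open>A\<close> and \<open>I\<close>; the coefficients are
  functions of the two classes. Nothing is required outside \<open>X\<close>.
\<close>

definition block_form ::
  "'a set \<Rightarrow> ('a \<Rightarrow> 'k) \<Rightarrow> ('a \<Rightarrow> 'a \<Rightarrow> complex) \<Rightarrow> ('a \<Rightarrow> 'a \<Rightarrow> complex) \<Rightarrow> bool" where
  "block_form X \<kappa> A P \<longleftrightarrow> (\<exists>a b c. \<forall>i\<in>X. \<forall>j\<in>X.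
     P i j = a (\<kappa> i) (\<kappa> j) + b (\<kappa> i) (\<kappa> j) * A i j + (if i = j then c (\<kappa> i) (\<kappa> j) else 0))"

lemma block_formI:
  assumes "\<And>i j. i \<in> X \<Longrightarrow> j \<in> X \<Longrightarrow>
     P i j = a (\<kappa> i) (\<kappa> j) + b (\<kappa> i) (\<kappa> j) * A i j + (if i = j then c (\<kappa> i) (\<kappa> j) else 0)"
  shows "block_form X \<kappa> A P"
  unfolding block_form_def using assms by (intro exI ballI)

lemma block_formE:
  assumes "block_form X \<kappa> A P"
  obtains a b c where "\<forall>i\<in>X. \<forall>j\<in>X.
     P i j = a (\<kappa> i) (\<kappa> j) + b (\<kappa> i) (\<kappa> j) * A i j + (if i = j then c (\<kappa> i) (\<kappa> j) else 0)"
  using assms unfolding block_form_def by (elim exE)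

lemma block_form_cong:
  assumes "\<And>i j. i \<in> X \<Longrightarrow> j \<in> X \<Longrightarrow> P i j = Q i j"
  shows "block_form X \<kappa> A P \<longleftrightarrow> block_form X \<kappa> A Q"
  unfolding block_form_def using assms by simp

lemma block_form_const: "block_form X \<kappa> A (\<lambda>i j. f (\<kappa> i) (\<kappa> j))"
  by (rule block_formI[where a = f and b = "\<lambda>_ _. 0" and c = "\<lambda>_ _. 0"]) simp

lemma block_form_add:
  assumes "block_form X \<kappa> A P" "block_form X \<kappa> A Q"
  shows "block_form X \<kappa> A (\<lambda>i j. P i j + Q i j)"
proof -
  obtain a b c where P: "\<forall>i\<in>X. \<forall>j\<in>X.
     P i j = a (\<kappa> i) (\<kappa> j) + b (\<kappa> i) (\<kappa> j) * A i j + (if i = j then c (\<kappa> i) (\<kappa> j) else 0)"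
    using assms(1) by (rule block_formE)
  note P = P[rule_format]
  obtain a' b' c' where Q: "\<forall>i\<in>X. \<forall>j\<in>X.
     Q i j = a' (\<kappa> i) (\<kappa> j) + b' (\<kappa> i) (\<kappa> j) * A i j + (if i = j then c' (\<kappa> i) (\<kappa> j) else 0)"
    using assms(2) by (rule block_formE)
  note Q = Q[rule_format]
  show ?thesis
    by (rule block_formI[where a = "\<lambda>f g. a f g + a' f g" and b = "\<lambda>f g. b f g + b' f g"
          and c = "\<lambda>f g. c f g + c' f g"]) (simp add: P Q algebra_simps)
qed

lemma block_form_scale:
  assumes "block_form X \<kappa> A P"
  shows "block_form X \<kappa> A (\<lambda>i j. f (\<kappa> i) (\<kappa> j) * P i j)"
proof -
  obtain a b c where P: "\<forall>i\<in>X. \<forall>j\<in>X.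
     P i j = a (\<kappa> i) (\<kappa> j) + b (\<kappa> i) (\<kappa> j) * A i j + (if i = j then c (\<kappa> i) (\<kappa> j) else 0)"
    using assms(1) by (rule block_formE)
  note P = P[rule_format]
  show ?thesis
    by (rule block_formI[where a = "\<lambda>h g. f h g * a h g" and b = "\<lambda>h g. f h g * b h g"
          and c = "\<lambda>h g. f h g * c h g"]) (simp add: P algebra_simps)
qed

lemma block_form_sum:
  assumes "finite H" "\<And>h. h \<in> H \<Longrightarrow> block_form X \<kappa> A (P h)"
  shows "block_form X \<kappa> A (\<lambda>i j. \<Sum>h\<in>H. P h i j)"
  using assms
proof (induction H rule: finite_induct)
  case empty
  show ?case using block_form_const[of X \<kappa> A "\<lambda>_ _. 0"] by simp
next
  case (insert h H)
  then show ?case using block_form_add[of X \<kappa> A "P h" "\<lambda>i j. \<Sum>h\<in>H. P h i j"] by simp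
qed

lemma sum_over_classes:
  fixes F :: "'k \<Rightarrow> complex"
  assumes "finite X"
  shows "(\<Sum>k\<in>X. F (\<kappa> k) * f k) = (\<Sum>h\<in>\<kappa> ` X. F h * (\<Sum>k\<in>{k\<in>X. \<kappa> k = h}. f k))"
proof -
  have "(\<Sum>k\<in>X. F (\<kappa> k) * f k) = (\<Sum>h\<in>\<kappa> ` X. \<Sum>k\<in>{k\<in>X. \<kappa> k = h}. F (\<kappa> k) * f k)"
    using assms by (rule sum.image_gen)
  also have "\<dots> = (\<Sum>h\<in>\<kappa> ` X. F h * (\<Sum>k\<in>{k\<in>X. \<kappa> k = h}. f k))"
    by (rule sum.cong) (auto simp: sum_distrib_left)
  finally show ?thesis .
qed

text \<open>
  If the partition is equitable and, for each class, the number of walks of length two with middle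
  vertex in that class has block form, then the matrices of block form are closed under
  multiplication and so make up a coherent algebra.
\<close>

context
  fixes X :: "'a set" and \<kappa> :: "'a \<Rightarrow> 'k" and A :: "'a \<Rightarrow> 'a \<Rightarrow> complex"
  assumes fin: "finite X"
    and A01: "\<And>i j. i \<in> X \<Longrightarrow> j \<in> X \<Longrightarrow> A i j = 0 \<or> A i j = 1"
    and sym: "\<And>i j. i \<in> X \<Longrightarrow> j \<in> X \<Longrightarrow> A i j = A j i"
    and diag: "\<And>i. i \<in> X \<Longrightarrow> A i i = 0"
    and rows: "\<And>h i i'. i \<in> X \<Longrightarrow> i' \<in> X \<Longrightarrow> \<kappa> i = \<kappa> i' \<Longrightarrow>
       (\<Sum>k\<in>{k\<in>X. \<kappa> k = h}. A i k) = (\<Sum>k\<in>{k\<in>X. \<kappa> k = h}. A i' k)"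
    and walks: "\<And>h. h \<in> \<kappa> ` X \<Longrightarrow> block_form X \<kappa> A (\<lambda>i j. \<Sum>k\<in>{k\<in>X. \<kappa> k = h}. A i k * A k j)"
begin

lemma class_row_sum: "\<exists>R. \<forall>i\<in>X. \<forall>h. (\<Sum>k\<in>{k\<in>X. \<kappa> k = h}. A i k) = R (\<kappa> i) h"
proof (intro exI ballI allI)
  fix i h assume i: "i \<in> X"
  define i' where "i' = (SOME i'. i' \<in> X \<and> \<kappa> i' = \<kappa> i)"
  have "i' \<in> X \<and> \<kappa> i' = \<kappa> i" unfolding i'_def by (rule someI[of _ i]) (use i in simp)
  then have "(\<Sum>k\<in>{k\<in>X. \<kappa> k = h}. A i k) = (\<Sum>k\<in>{k\<in>X. \<kappa> k = h}. A i' k)"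
    using i by (intro rows) auto
  then show "(\<Sum>k\<in>{k\<in>X. \<kappa> k = h}. A i k)
      = (\<lambda>f h. \<Sum>k\<in>{k\<in>X. \<kappa> k = h}. A (SOME i'. i' \<in> X \<and> \<kappa> i' = f) k) (\<kappa> i) h"
    by (simp add: i'_def)
qed

lemma block_form_mult:
  assumes "block_form X \<kappa> A P" "block_form X \<kappa> A Q"
  shows "block_form X \<kappa> A (fmat_mult X P Q)"
proof -
  obtain a b c where P: "\<forall>i\<in>X. \<forall>j\<in>X.
     P i j = a (\<kappa> i) (\<kappa> j) + b (\<kappa> i) (\<kappa> j) * A i j + (if i = j then c (\<kappa> i) (\<kappa> j) else 0)"
    using assms(1) by (rule block_formE)
  note P = P[rule_format]
  obtain a' b' c' where Q: "\<forall>i\<in>X. \<forall>j\<in>X.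
     Q i j = a' (\<kappa> i) (\<kappa> j) + b' (\<kappa> i) (\<kappa> j) * A i j + (if i = j then c' (\<kappa> i) (\<kappa> j) else 0)"
    using assms(2) by (rule block_formE)
  note Q = Q[rule_format]
  obtain R where "\<forall>i\<in>X. \<forall>h. (\<Sum>k\<in>{k\<in>X. \<kappa> k = h}. A i k) = R (\<kappa> i) h"
    using class_row_sum ..
  note R = this[rule_format]
  define T1 where "T1 f g = (\<Sum>k\<in>X. a f (\<kappa> k) * a' (\<kappa> k) g)
      + (\<Sum>h\<in>\<kappa> ` X. (a f h * b' h g) * R g h) + (\<Sum>h\<in>\<kappa> ` X. (b f h * a' h g) * R f h)
      + a f g * c' g g + c f f * a' f g" for f g
  define T2 where "T2 f g = b f g * c' g g + c f f * b' f g" for f g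
  define T3 where "T3 f g = c f f * c' f g" for f g
  define W where "W i j = (\<Sum>h\<in>\<kappa> ` X. (b (\<kappa> i) h * b' h (\<kappa> j)) *
      (\<Sum>k\<in>{k\<in>X. \<kappa> k = h}. A i k * A k j))" for i j
  have eq: "fmat_mult X P Q i j = (T1 (\<kappa> i) (\<kappa> j) + T2 (\<kappa> i) (\<kappa> j) * A i j
      + (if i = j then T3 (\<kappa> i) (\<kappa> j) else 0)) + W i j" if i: "i \<in> X" and j: "j \<in> X" for i j
  proof -
    let ?f = "\<kappa> i" and ?g = "\<kappa> j"
    \<comment> \<open>The nine products of terms; only \<open>A i k * A k j\<close> is not settled by the row sums.\<close>
    have "fmat_mult X P Q i j = (\<Sum>k\<in>X. a ?f (\<kappa> k) * a' (\<kappa> k) ?g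
        + (a ?f (\<kappa> k) * b' (\<kappa> k) ?g) * A j k + (b ?f (\<kappa> k) * a' (\<kappa> k) ?g) * A i k
        + (b ?f (\<kappa> k) * b' (\<kappa> k) ?g) * (A i k * A k j)
        + (if j = k then (a ?f ?g + b ?f ?g * A i j) * c' ?g ?g else 0)
        + (if i = k then c ?f ?f * (a' ?f ?g + b' ?f ?g * A i j) else 0)
        + (if i = k then (if i = j then c ?f ?f * c' ?f ?g else 0) else 0))"
      unfolding fmat_mult_def
      by (rule sum.cong) (use i j sym in \<open>auto simp: P Q algebra_simps\<close>)
    also have "\<dots> = (\<Sum>k\<in>X. a ?f (\<kappa> k) * a' (\<kappa> k) ?g)
        + (\<Sum>k\<in>X. (a ?f (\<kappa> k) * b' (\<kappa> k) ?g) * A j k) + (\<Sum>k\<in>X. (b ?f (\<kappa> k) * a' (\<kappa> k) ?g) * A i k)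
        + (\<Sum>k\<in>X. (b ?f (\<kappa> k) * b' (\<kappa> k) ?g) * (A i k * A k j))
        + (a ?f ?g + b ?f ?g * A i j) * c' ?g ?g + c ?f ?f * (a' ?f ?g + b' ?f ?g * A i j)
        + (if i = j then c ?f ?f * c' ?f ?g else 0)"
      using i j fin by (simp add: sum.distrib)
    also have "(\<Sum>k\<in>X. (a ?f (\<kappa> k) * b' (\<kappa> k) ?g) * A j k) = (\<Sum>h\<in>\<kappa> ` X. (a ?f h * b' h ?g) * R ?g h)"
      using sum_over_classes[OF fin, of "\<lambda>h. a ?f h * b' h ?g"] R[OF j] by simp
    also have "(\<Sum>k\<in>X. (b ?f (\<kappa> k) * a' (\<kappa> k) ?g) * A i k) = (\<Sum>h\<in>\<kappa> ` X. (b ?f h * a' h ?g) * R ?f h)"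
      using sum_over_classes[OF fin, of "\<lambda>h. b ?f h * a' h ?g"] R[OF i] by simp
    also have "(\<Sum>k\<in>X. (b ?f (\<kappa> k) * b' (\<kappa> k) ?g) * (A i k * A k j)) = W i j"
      unfolding W_def using sum_over_classes[OF fin, of "\<lambda>h. b ?f h * b' h ?g"] by simp
    finally show ?thesis by (simp add: T1_def T2_def T3_def algebra_simps)
  qed
  have "block_form X \<kappa> A (\<lambda>i j. (T1 (\<kappa> i) (\<kappa> j) + T2 (\<kappa> i) (\<kappa> j) * A i j
      + (if i = j then T3 (\<kappa> i) (\<kappa> j) else 0)) + W i j)"
  proof (rule block_form_add)
    show "block_form X \<kappa> A (\<lambda>i j. T1 (\<kappa> i) (\<kappa> j) + T2 (\<kappa> i) (\<kappa> j) * A i j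
      + (if i = j then T3 (\<kappa> i) (\<kappa> j) else 0))"
      by (rule block_formI) (rule refl)
    show "block_form X \<kappa> A W"
      unfolding W_def
    proof (rule block_form_sum)
      fix h assume "h \<in> \<kappa> ` X"
      from block_form_scale[OF walks[OF this], of "\<lambda>f g. b f h * b' h g"]
      show "block_form X \<kappa> A (\<lambda>i j. (b (\<kappa> i) h * b' h (\<kappa> j)) * (\<Sum>k\<in>{k\<in>X. \<kappa> k = h}. A i k * A k j))" .
    qed (use fin in simp)
  qed
  then show ?thesis by (rule block_form_cong[THEN iffD2, rotated]) (rule eq)
qed

lemma block_form_hadamard:
  assumes "block_form X \<kappa> A P" "block_form X \<kappa> A Q"
  shows "block_form X \<kappa> A (\<lambda>i j. P i j * Q i j)"
proof -
  obtain a b c where P: "\<forall>i\<in>X. \<forall>j\<in>X.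
     P i j = a (\<kappa> i) (\<kappa> j) + b (\<kappa> i) (\<kappa> j) * A i j + (if i = j then c (\<kappa> i) (\<kappa> j) else 0)"
    using assms(1) by (rule block_formE)
  note P = P[rule_format]
  obtain a' b' c' where Q: "\<forall>i\<in>X. \<forall>j\<in>X.
     Q i j = a' (\<kappa> i) (\<kappa> j) + b' (\<kappa> i) (\<kappa> j) * A i j + (if i = j then c' (\<kappa> i) (\<kappa> j) else 0)"
    using assms(2) by (rule block_formE)
  note Q = Q[rule_format]
  show ?thesis
  proof (rule block_formI[where a = "\<lambda>f g. a f g * a' f g"
        and b = "\<lambda>f g. a f g * b' f g + b f g * a' f g + b f g * b' f g"
        and c = "\<lambda>f g. a f g * c' f g + c f g * a' f g + c f g * c' f g"])
    fix i j assume ij: "i \<in> X" "j \<in> X"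
    show "P i j * Q i j = a (\<kappa> i) (\<kappa> j) * a' (\<kappa> i) (\<kappa> j)
       + (a (\<kappa> i) (\<kappa> j) * b' (\<kappa> i) (\<kappa> j) + b (\<kappa> i) (\<kappa> j) * a' (\<kappa> i) (\<kappa> j)
          + b (\<kappa> i) (\<kappa> j) * b' (\<kappa> i) (\<kappa> j)) * A i j
       + (if i = j then a (\<kappa> i) (\<kappa> j) * c' (\<kappa> i) (\<kappa> j) + c (\<kappa> i) (\<kappa> j) * a' (\<kappa> i) (\<kappa> j)
          + c (\<kappa> i) (\<kappa> j) * c' (\<kappa> i) (\<kappa> j) else 0)"
      using A01[OF ij] diag[OF ij(1)] by (auto simp: P[OF ij] Q[OF ij] algebra_simps)
  qed
qed

lemma block_form_transpose:
  assumes "block_form X \<kappa> A P"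
  shows "block_form X \<kappa> A (fmat_transpose P)"
proof -
  obtain a b c where P: "\<forall>i\<in>X. \<forall>j\<in>X.
     P i j = a (\<kappa> i) (\<kappa> j) + b (\<kappa> i) (\<kappa> j) * A i j + (if i = j then c (\<kappa> i) (\<kappa> j) else 0)"
    using assms(1) by (rule block_formE)
  note P = P[rule_format]
  show ?thesis
    by (rule block_formI[where a = "\<lambda>f g. a g f" and b = "\<lambda>f g. b g f" and c = "\<lambda>f g. c g f"])
      (use sym in \<open>simp add: P fmat_transpose_def\<close>)
qed

lemma coherent_algebra_block_form: "coherent_algebra X {P \<in> fmats X. block_form X \<kappa> A P}"
proof -
  have 1: "block_form X \<kappa> A (fmat_id X)"
    by (rule block_formI[where a = "\<lambda>_ _. 0" and b = "\<lambda>_ _. 0" and c = "\<lambda>_ _. 1"])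
      (simp add: fmat_id_def)
  have 2: "block_form X \<kappa> A (fmat_ones X)"
    by (rule block_formI[where a = "\<lambda>_ _. 1" and b = "\<lambda>_ _. 0" and c = "\<lambda>_ _. 0"])
      (simp add: fmat_ones_def)
  have 3: "block_form X \<kappa> A (\<lambda>i j. d * P i j)" if "block_form X \<kappa> A P" for d P
    using block_form_scale[OF that, of "\<lambda>_ _. d"] .
  have 4: "fmat_mult X P Q \<in> fmats X" if "P \<in> fmats X" "Q \<in> fmats X" for P Q :: "'a \<Rightarrow> 'a \<Rightarrow> complex"
    using that by (auto simp: fmats_def fmat_mult_def)
  show ?thesis
    unfolding coherent_algebra_def
    using fin 1 2 3 4 block_form_add[of X \<kappa> A] block_form_mult block_form_hadamard block_form_transpose
    by (auto simp: fmats_def fmat_id_def fmat_ones_def fmat_transpose_def)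
qed

end

lemma block_form_self: "block_form X \<kappa> A A"
  by (rule block_formI[where a = "\<lambda>_ _. 0" and b = "\<lambda>_ _. 1" and c = "\<lambda>_ _. 0"]) simp

section \<open>The square of the adjacency matrix\<close>

text \<open>
  Real vectors indexed by a finite set \<open>X\<close> are functions of which only the values on \<open>X\<close> matter.
  The first definition is the action of a matrix on a vector, the second the standard inner product.
\<close>

definition fmat_apply :: "'a set \<Rightarrow> ('a \<Rightarrow> 'a \<Rightarrow> real) \<Rightarrow> ('a \<Rightarrow> real) \<Rightarrow> 'a \<Rightarrow> real" where
  "fmat_apply X A v i = (\<Sum>j\<in>X. A i j * v j)"

definition fdot :: "'a set \<Rightarrow> ('a \<Rightarrow> real) \<Rightarrow> ('a \<Rightarrow> real) \<Rightarrow> real" where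
  "fdot X u v = (\<Sum>i\<in>X. u i * v i)"

lemma fdot_commute: "fdot X u v = fdot X v u"
  by (simp add: fdot_def mult.commute)

lemma fdot_cong: "(\<And>i. i \<in> X \<Longrightarrow> v i = w i) \<Longrightarrow> fdot X u v = fdot X u w"
  by (auto simp: fdot_def intro!: sum.cong)

lemma fdot_add: "fdot X u (\<lambda>i. v i + w i) = fdot X u v + fdot X u w"
  by (simp add: fdot_def sum.distrib algebra_simps)

lemma fdot_diff: "fdot X u (\<lambda>i. v i - w i) = fdot X u v - fdot X u w"
  by (simp add: fdot_def sum_subtractf algebra_simps)

lemma fdot_scale: "fdot X u (\<lambda>i. c * v i) = c * fdot X u v"
  by (simp add: fdot_def sum_distrib_left mult.left_commute)

lemma fdot_self_nonneg: "0 \<le> fdot X u u"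
  by (simp add: fdot_def sum_nonneg)

lemma fdot_self_zero: "finite X \<Longrightarrow> fdot X u u = 0 \<Longrightarrow> i \<in> X \<Longrightarrow> u i = 0"
  by (simp add: fdot_def sum_nonneg_eq_0_iff)

lemma fmat_apply_add: "fmat_apply X A (\<lambda>i. v i + w i) i = fmat_apply X A v i + fmat_apply X A w i"
  by (simp add: fmat_apply_def sum.distrib algebra_simps)

lemma fmat_apply_diff: "fmat_apply X A (\<lambda>i. v i - w i) i = fmat_apply X A v i - fmat_apply X A w i"
  by (simp add: fmat_apply_def sum_subtractf algebra_simps)

lemma fmat_apply_scale: "fmat_apply X A (\<lambda>i. c * v i) i = c * fmat_apply X A v i"
  by (simp add: fmat_apply_def sum_distrib_left mult.left_commute)

lemma nonneg_parabola_linear_zero: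
  fixes b c :: real
  assumes "\<And>e. 0 \<le> 2 * e * b + e\<^sup>2 * c" "0 \<le> c"
  shows "b = 0"
proof (rule ccontr)
  assume b: "b \<noteq> 0"
  \<comment> \<open>The minimum is at \<open>- b / c\<close>; adding \<open>1\<close> covers the case \<open>c = 0\<close>.\<close>
  have "2 * (- b / (c + 1)) * b + (- b / (c + 1))\<^sup>2 * c = - (b\<^sup>2 * (c + 2)) / (c + 1)\<^sup>2"
    using assms(2) by (simp add: divide_simps power2_eq_square) (simp add: algebra_simps)
  also have "\<dots> < 0" using b assms(2) by (simp add: divide_neg_pos)
  finally show False using assms(1)[of "- b / (c + 1)"] by simp
qed

text \<open>
  Vectors are normalised to vanish outside \<open>X\<close>, so that the bounded ones form a product of compact
  intervals and Tychonoff's theorem applies.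
\<close>

lemma compact_unit_sphere_orthogonal:
  assumes "finite X"
  shows "compact {v. (\<forall>i. v i \<in> (if i \<in> X then {-1..1} else {0})) \<and> fdot X v v = 1 \<and>
    (\<forall>u\<in>E. fdot X u v = 0)}"
proof -
  let ?C = "Pi\<^sub>E UNIV (\<lambda>i. if i \<in> X then {-1..1} else {0 :: real})"
  have "compactin (product_topology (\<lambda>_. euclidean) UNIV) ?C"
    unfolding compactin_PiE by auto
  then have C: "compact ?C" by (simp add: euclidean_product_topology)
  have co: "continuous_on UNIV (\<lambda>v. v i)" for i :: 'a by simp
  have 1: "closed {v. fdot X v v = 1}"
    unfolding fdot_def by (intro closed_Collect_eq continuous_intros co)
  have 2: "closed {v. fdot X u v = 0}" for u
    unfolding fdot_def by (intro closed_Collect_eq continuous_intros co)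
  have "{v. (\<forall>i. v i \<in> (if i \<in> X then {-1..1} else {0})) \<and> fdot X v v = 1 \<and> (\<forall>u\<in>E. fdot X u v = 0)}
     = ?C \<inter> ({v. fdot X v v = 1} \<inter> (\<Inter>u\<in>E. {v. fdot X u v = 0}))"
    by (auto simp: PiE_def Pi_def)
  also have "compact \<dots>"
    by (intro compact_Int_closed C closed_Int 1 closed_INT ballI 2)
  finally show ?thesis .
qed

context
  fixes X :: "'a set" and A :: "'a \<Rightarrow> 'a \<Rightarrow> real"
  assumes fin: "finite X" and sym: "\<And>i j. i \<in> X \<Longrightarrow> j \<in> X \<Longrightarrow> A i j = A j i"
begin

lemma fdot_apply_sym: "fdot X u (fmat_apply X A v) = fdot X (fmat_apply X A u) v"
proof -
  have "fdot X u (fmat_apply X A v) = (\<Sum>i\<in>X. \<Sum>j\<in>X. u i * (A i j * v j))"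
    by (simp add: fdot_def fmat_apply_def sum_distrib_left)
  also have "\<dots> = (\<Sum>j\<in>X. \<Sum>i\<in>X. u i * (A i j * v j))" by (rule sum.swap)
  also have "\<dots> = (\<Sum>j\<in>X. \<Sum>i\<in>X. A j i * u i * v j)"
    by (intro sum.cong refl) (use sym in \<open>simp add: ac_simps\<close>)
  also have "\<dots> = fdot X (fmat_apply X A u) v"
    by (simp add: fdot_def fmat_apply_def sum_distrib_right)
  finally show ?thesis .
qed

text \<open>
  On an invariant subspace, here the orthogonal complement of a set \<open>E\<close>, the quadratic form
  \<open>\<mu> \<langle>v, v\<rangle> - \<langle>v, A v\<rangle>\<close> is nonnegative if \<open>\<mu>\<close> bounds the Rayleigh quotient; a zero \<open>w\<close> of
  it is a minimum, and the derivative in the direction \<open>\<mu> w - A w\<close> shows \<open>A w = \<mu> w\<close>.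
\<close>

lemma rayleigh_maximizer_eigenvector:
  assumes inv: "\<And>v. (\<forall>u\<in>E. fdot X u v = 0) \<Longrightarrow> (\<forall>u\<in>E. fdot X u (fmat_apply X A v) = 0)"
    and w: "\<forall>u\<in>E. fdot X u w = 0"
    and bound: "\<And>v. (\<forall>u\<in>E. fdot X u v = 0) \<Longrightarrow> fdot X v (fmat_apply X A v) \<le> \<mu> * fdot X v v"
    and eq: "fdot X w (fmat_apply X A w) = \<mu> * fdot X w w"
    and i: "i \<in> X"
  shows "fmat_apply X A w i = \<mu> * w i"
proof -
  define z where "z i = \<mu> * w i - fmat_apply X A w i" for i
  have zU: "\<forall>u\<in>E. fdot X u z = 0"
    using w inv[OF w] by (simp add: z_def[abs_def] fdot_diff fdot_scale)
  define c where "c = \<mu> * fdot X z z - fdot X z (fmat_apply X A z)"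
  have "0 \<le> 2 * e * fdot X z z + e\<^sup>2 * c" for e
  proof -
    let ?v = "\<lambda>i. w i + e * z i"
    have "\<forall>u\<in>E. fdot X u ?v = 0" using w zU by (simp add: fdot_add fdot_scale)
    from bound[OF this] have "0 \<le> \<mu> * fdot X ?v ?v - fdot X ?v (fmat_apply X A ?v)" by simp
    also have "fdot X ?v ?v = fdot X w w + 2 * e * fdot X z w + e\<^sup>2 * fdot X z z"
      by (simp add: fdot_add fdot_scale fdot_commute[of X ?v] fdot_commute[of X w z]
          power2_eq_square algebra_simps)
    also have "fdot X ?v (fmat_apply X A ?v) = fdot X w (fmat_apply X A w)
        + 2 * e * fdot X z (fmat_apply X A w) + e\<^sup>2 * fdot X z (fmat_apply X A z)"
    proof -
      have "fdot X ?v (fmat_apply X A ?v) = fdot X ?v (\<lambda>i. fmat_apply X A w i + e * fmat_apply X A z i)"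
        by (rule fdot_cong) (simp add: fmat_apply_add fmat_apply_scale)
      also have "\<dots> = fdot X ?v (fmat_apply X A w) + e * fdot X ?v (fmat_apply X A z)"
        by (simp add: fdot_add fdot_scale)
      also have "fdot X ?v (fmat_apply X A w) = fdot X w (fmat_apply X A w) + e * fdot X z (fmat_apply X A w)"
        by (simp add: fdot_commute[of X ?v] fdot_add fdot_scale fdot_commute[of X "fmat_apply X A w"])
      also have "fdot X ?v (fmat_apply X A z) = fdot X w (fmat_apply X A z) + e * fdot X z (fmat_apply X A z)"
        by (simp add: fdot_commute[of X ?v] fdot_add fdot_scale fdot_commute[of X "fmat_apply X A z"])
      also have "fdot X w (fmat_apply X A z) = fdot X z (fmat_apply X A w)"
        by (simp add: fdot_apply_sym[of w z] fdot_commute[of X z])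
      finally show ?thesis by (simp add: power2_eq_square algebra_simps)
    qed
    also have "\<mu> * (fdot X w w + 2 * e * fdot X z w + e\<^sup>2 * fdot X z z) - (fdot X w (fmat_apply X A w)
        + 2 * e * fdot X z (fmat_apply X A w) + e\<^sup>2 * fdot X z (fmat_apply X A z))
        = 2 * e * (\<mu> * fdot X z w - fdot X z (fmat_apply X A w)) + e\<^sup>2 * c"
      by (simp add: eq c_def algebra_simps)
    also have "\<mu> * fdot X z w - fdot X z (fmat_apply X A w) = fdot X z z"
    proof -
      have "fdot X z z = fdot X z (\<lambda>i. \<mu> * w i - fmat_apply X A w i)"
        by (rule fdot_cong) (simp add: z_def)
      then show ?thesis by (simp add: fdot_diff fdot_scale)
    qed
    finally show ?thesis .
  qed
  moreover have "0 \<le> c" using bound[OF zU] by (simp add: c_def)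
  ultimately have "fdot X z z = 0" by (rule nonneg_parabola_linear_zero)
  from fdot_self_zero[OF fin this i] show ?thesis by (simp add: z_def)
qed

lemma rayleigh_maximum_attained:
  assumes v0: "\<forall>u\<in>E. fdot X u v0 = 0" "i0 \<in> X" "v0 i0 \<noteq> 0"
  shows "\<exists>\<mu> w. (\<forall>u\<in>E. fdot X u w = 0) \<and> (\<exists>i\<in>X. w i \<noteq> 0) \<and>
      fdot X w (fmat_apply X A w) = \<mu> * fdot X w w \<and>
      (\<forall>v. (\<forall>u\<in>E. fdot X u v = 0) \<longrightarrow> fdot X v (fmat_apply X A v) \<le> \<mu> * fdot X v v)"
proof -
  define K where "K = {v. (\<forall>i. v i \<in> (if i \<in> X then {-1..1} else {0})) \<and> fdot X v v = 1 \<and>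
    (\<forall>u\<in>E. fdot X u v = 0)}"
  define nrm where "nrm v i = (if i \<in> X then v i / sqrt (fdot X v v) else 0)" for v :: "'a \<Rightarrow> real" and i
  have pos: "fdot X v v > 0" if "i \<in> X" "v i \<noteq> 0" for v i
    using fdot_self_nonneg[of X v] fdot_self_zero[OF fin, of v i] that by fastforce
  have nrm_eq: "fdot X u (nrm v) = (1 / sqrt (fdot X v v)) * fdot X u v" for u v
    unfolding fdot_scale[symmetric] by (rule fdot_cong) (simp add: nrm_def)
  have nrm_K: "nrm v \<in> K" if v: "\<forall>u\<in>E. fdot X u v = 0" and p: "fdot X v v > 0" for v
  proof -
    have one: "fdot X (nrm v) (nrm v) = 1"
      using p by (simp add: nrm_eq fdot_commute[of X "nrm v"])
    have "nrm v i \<in> {-1..1}" if "i \<in> X" for i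
    proof -
      have "nrm v i * nrm v i \<le> fdot X (nrm v) (nrm v)"
        unfolding fdot_def by (rule member_le_sum) (use that fin in auto)
      then have "(nrm v i)\<^sup>2 \<le> 1\<^sup>2" using one by (simp add: power2_eq_square)
      then have "\<bar>nrm v i\<bar> \<le> 1" by (simp only: abs_le_square_iff[symmetric] abs_one)
      then show ?thesis by auto
    qed
    moreover have "nrm v i = 0" if "i \<notin> X" for i using that by (simp add: nrm_def)
    moreover have "\<forall>u\<in>E. fdot X u (nrm v) = 0" using v by (simp add: nrm_eq)
    ultimately show ?thesis using one by (simp add: K_def)
  qed
  have "compact K" unfolding K_def by (rule compact_unit_sphere_orthogonal[OF fin])
  moreover have "K \<noteq> {}" using nrm_K[OF v0(1) pos[of i0 v0, OF v0(2,3)]] by blast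
  moreover have "continuous_on K (\<lambda>v. fdot X v (fmat_apply X A v))"
  proof -
    have co: "continuous_on K (\<lambda>v. v i)" for i :: 'a
      by (rule continuous_on_subset[OF continuous_on_product_coordinates]) simp
    show ?thesis unfolding fdot_def fmat_apply_def by (intro continuous_intros co)
  qed
  ultimately have "\<exists>w\<in>K. \<forall>v\<in>K. fdot X v (fmat_apply X A v) \<le> fdot X w (fmat_apply X A w)"
    by (rule continuous_attains_sup)
  then obtain w where w: "w \<in> K"
    and max: "\<forall>v\<in>K. fdot X v (fmat_apply X A v) \<le> fdot X w (fmat_apply X A w)" ..
  define \<mu> where "\<mu> = fdot X w (fmat_apply X A w)"
  have bound: "fdot X v (fmat_apply X A v) \<le> \<mu> * fdot X v v" if v: "\<forall>u\<in>E. fdot X u v = 0" for v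
  proof (cases "fdot X v v > 0")
    case True
    have ap: "fmat_apply X A (nrm v) i = (1 / sqrt (fdot X v v)) * fmat_apply X A v i" for i
      unfolding fmat_apply_scale[symmetric] unfolding fmat_apply_def
      by (rule sum.cong) (auto simp: nrm_def)
    have "fdot X (nrm v) (fmat_apply X A (nrm v))
        = fdot X (nrm v) (\<lambda>i. (1 / sqrt (fdot X v v)) * fmat_apply X A v i)"
      by (rule fdot_cong) (rule ap)
    also have "\<dots> = (1 / sqrt (fdot X v v)) * fdot X (fmat_apply X A v) (nrm v)"
      by (simp only: fdot_scale fdot_commute)
    also have "\<dots> = fdot X v (fmat_apply X A v) / fdot X v v"
      using True by (simp add: nrm_eq fdot_commute[of X v "fmat_apply X A v"])
    finally have "fdot X v (fmat_apply X A v) / fdot X v v \<le> \<mu>"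
      using max[rule_format, OF nrm_K[OF v True]] by (simp add: \<mu>_def)
    then show ?thesis using True by (simp add: divide_le_eq)
  next
    case False
    then have "fdot X v v = 0" using fdot_self_nonneg[of X v] by simp
    then have "v i = 0" if "i \<in> X" for i using fdot_self_zero[OF fin] that by blast
    then have "fdot X v (fmat_apply X A v) = 0" by (simp add: fdot_def)
    then show ?thesis using \<open>fdot X v v = 0\<close> by simp
  qed
  have "fdot X w w = 1" and wU: "\<forall>u\<in>E. fdot X u w = 0" using w by (auto simp: K_def)
  have "\<exists>i\<in>X. w i \<noteq> 0"
  proof (rule ccontr)
    assume "\<not> ?thesis"
    then have "fdot X w w = 0" by (simp add: fdot_def)
    then show False using \<open>fdot X w w = 1\<close> by simp
  qed
  moreover have "fdot X w (fmat_apply X A w) = \<mu> * fdot X w w"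
    using \<open>fdot X w w = 1\<close> by (simp add: \<mu>_def)
  ultimately show ?thesis using wU bound by blast
qed

text \<open>
  Otherwise the Rayleigh quotient on the orthogonal complement of all eigenvectors would be maximal
  at an eigenvector orthogonal to itself.
\<close>

lemma orthogonal_to_eigenvectors_zero:
  assumes v: "\<And>u \<theta>. (\<forall>i\<in>X. fmat_apply X A u i = \<theta> * u i) \<Longrightarrow> fdot X u v = 0"
    and i: "i \<in> X"
  shows "v i = 0"
proof (rule ccontr)
  assume nz: "v i \<noteq> 0"
  define E where "E = {u. \<exists>\<theta>. \<forall>i\<in>X. fmat_apply X A u i = \<theta> * u i}"
  have vE: "\<forall>u\<in>E. fdot X u v = 0" using v by (auto simp: E_def)
  have inv: "\<forall>u\<in>E. fdot X u (fmat_apply X A v) = 0" if vE: "\<forall>u\<in>E. fdot X u v = 0" for v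
  proof
    fix u assume u: "u \<in> E"
    then obtain \<theta> where th: "\<forall>i\<in>X. fmat_apply X A u i = \<theta> * u i" by (auto simp: E_def)
    have "fdot X u (fmat_apply X A v) = fdot X v (fmat_apply X A u)"
      by (simp add: fdot_apply_sym[of u] fdot_commute[of X v])
    also have "\<dots> = fdot X v (\<lambda>i. \<theta> * u i)" by (rule fdot_cong) (use th in simp)
    also have "\<dots> = 0" using vE u by (simp add: fdot_scale fdot_commute[of X v])
    finally show "fdot X u (fmat_apply X A v) = 0" .
  qed
  from rayleigh_maximum_attained[OF vE i nz] obtain \<mu> w where
    w: "\<forall>u\<in>E. fdot X u w = 0" "\<exists>i\<in>X. w i \<noteq> 0" "fdot X w (fmat_apply X A w) = \<mu> * fdot X w w"
    and bd: "\<forall>v. (\<forall>u\<in>E. fdot X u v = 0) \<longrightarrow> fdot X v (fmat_apply X A v) \<le> \<mu> * fdot X v v"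
    by (elim exE conjE)
  have "\<forall>i\<in>X. fmat_apply X A w i = \<mu> * w i"
    by (intro ballI rayleigh_maximizer_eigenvector[where E = E]) (use inv w bd in blast)+
  then have "w \<in> E" by (auto simp: E_def)
  then have "fdot X w w = 0" using w(1) by blast
  then show False using fdot_self_zero[OF fin] w(2) by blast
qed

text \<open>
  A symmetric matrix is annihilated by the product of the \<open>A - \<theta>\<close> over its eigenvalues \<open>\<theta>\<close>, since
  the image of this product is orthogonal to all eigenvectors.
\<close>

lemma symmetric_annihilated:
  assumes ev: "\<And>u \<theta>. (\<forall>i\<in>X. fmat_apply X A u i = \<theta> * u i) \<Longrightarrow> (\<exists>i\<in>X. u i \<noteq> 0) \<Longrightarrow> \<theta> \<in> {t0, t1, t2}"
    and S: "S = (\<lambda>\<theta> v i. fmat_apply X A v i - \<theta> * v i)"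
    and i: "i \<in> X"
  shows "S t0 (S t1 (S t2 v)) i = 0"
proof (rule orthogonal_to_eigenvectors_zero[OF _ i])
  fix u \<theta> assume u: "\<forall>i\<in>X. fmat_apply X A u i = \<theta> * u i"
  have step: "fdot X u (S t v) = (\<theta> - t) * fdot X u v" for t v
  proof -
    have "fdot X u (S t v) = fdot X v (fmat_apply X A u) - t * fdot X u v"
      unfolding S by (simp add: fdot_diff fdot_scale fdot_apply_sym[of u] fdot_commute[of X v])
    also have "fdot X v (fmat_apply X A u) = fdot X v (\<lambda>i. \<theta> * u i)"
      by (rule fdot_cong) (use u in simp)
    finally show ?thesis by (simp add: fdot_scale fdot_commute[of X v] algebra_simps)
  qed
  show "fdot X u (S t0 (S t1 (S t2 v))) = 0"
  proof (cases "\<exists>i\<in>X. u i \<noteq> 0")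
    case True
    then have "\<theta> \<in> {t0, t1, t2}" using ev[OF u] by blast
    then show ?thesis by (auto simp: step)
  next
    case False
    then show ?thesis by (simp add: fdot_def)
  qed
qed

text \<open>
  The part of the Perron--Frobenius theorem that is needed: an eigenvector for the largest eigenvalue
  has no zero entry, and its entrywise absolute value is an eigenvector for the same eigenvalue.
  Passing to absolute values does not decrease \<open>\<langle>u, A u\<rangle>\<close>, so \<open>\<bar>u\<bar>\<close> again attains the maximal
  Rayleigh quotient. Its set of zeros is closed under adjacency.
\<close>

lemma top_eigenvector_abs:
  assumes nonneg: "\<And>i j. i \<in> X \<Longrightarrow> j \<in> X \<Longrightarrow> A i j \<ge> 0"
    and conn: "\<And>Z. Z \<subseteq> X \<Longrightarrow> Z \<noteq> {} \<Longrightarrow> (\<And>i j. i \<in> Z \<Longrightarrow> j \<in> X \<Longrightarrow> A i j \<noteq> 0 \<Longrightarrow> j \<in> Z) \<Longrightarrow> Z = X"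
    and top: "\<And>u \<theta>. (\<forall>i\<in>X. fmat_apply X A u i = \<theta> * u i) \<Longrightarrow> (\<exists>i\<in>X. u i \<noteq> 0) \<Longrightarrow> \<theta> \<le> t0"
    and u: "\<forall>i\<in>X. fmat_apply X A u i = t0 * u i" "\<exists>i\<in>X. u i \<noteq> 0"
  shows "(\<forall>i\<in>X. u i \<noteq> 0) \<and> (\<forall>i\<in>X. fmat_apply X A (\<lambda>i. \<bar>u i\<bar>) i = t0 * \<bar>u i\<bar>)"
proof -
  obtain i0 where i0: "i0 \<in> X" "u i0 \<noteq> 0" using u(2) by blast
  have "\<forall>v\<in>{}. fdot X v u = 0" by simp
  from rayleigh_maximum_attained[OF this i0] obtain \<mu> w where
    w: "\<exists>i\<in>X. w i \<noteq> 0" "fdot X w (fmat_apply X A w) = \<mu> * fdot X w w"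
    and bd: "\<And>v. fdot X v (fmat_apply X A v) \<le> \<mu> * fdot X v v"
    by auto
  have "\<forall>i\<in>X. fmat_apply X A w i = \<mu> * w i"
    by (intro ballI rayleigh_maximizer_eigenvector[where E = "{}"]) (use w bd in auto)
  then have "\<mu> \<le> t0" using top w(1) by blast
  have bound: "fdot X v (fmat_apply X A v) \<le> t0 * fdot X v v" for v
    using bd[of v] mult_right_mono[OF \<open>\<mu> \<le> t0\<close> fdot_self_nonneg[of X v]] by linarith
  let ?a = "\<lambda>i. \<bar>u i\<bar>"
  have aa: "fdot X ?a ?a = fdot X u u" by (simp add: fdot_def)
  have "t0 * fdot X u u = fdot X u (fmat_apply X A u)"
    unfolding fdot_scale[symmetric] by (rule fdot_cong) (use u in simp)
  also have "\<dots> \<le> fdot X ?a (fmat_apply X A ?a)"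
    unfolding fdot_def fmat_apply_def
  proof (rule sum_mono)
    fix i assume i: "i \<in> X"
    have "u i * (\<Sum>j\<in>X. A i j * u j) \<le> \<bar>u i\<bar> * \<bar>\<Sum>j\<in>X. A i j * u j\<bar>"
      unfolding abs_mult[symmetric] by (rule abs_ge_self)
    also have "\<bar>\<Sum>j\<in>X. A i j * u j\<bar> \<le> (\<Sum>j\<in>X. \<bar>A i j * u j\<bar>)" by (rule sum_abs)
    also have "(\<Sum>j\<in>X. \<bar>A i j * u j\<bar>) = (\<Sum>j\<in>X. A i j * \<bar>u j\<bar>)"
      by (rule sum.cong) (use i nonneg in \<open>auto simp: abs_mult\<close>)
    finally show "u i * (\<Sum>j\<in>X. A i j * u j) \<le> \<bar>u i\<bar> * (\<Sum>j\<in>X. A i j * \<bar>u j\<bar>)"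
      by (simp add: mult_left_mono)
  qed
  finally have "fdot X ?a (fmat_apply X A ?a) = t0 * fdot X ?a ?a"
    using bound[of ?a] unfolding aa by simp
  then have ev: "\<forall>i\<in>X. fmat_apply X A ?a i = t0 * ?a i"
    by (intro ballI rayleigh_maximizer_eigenvector[where E = "{}"]) (use bound in auto)
  let ?Z = "{i\<in>X. u i = 0}"
  have "j \<in> ?Z" if "i \<in> ?Z" "j \<in> X" "A i j \<noteq> 0" for i j
  proof -
    have "(\<Sum>j\<in>X. A i j * \<bar>u j\<bar>) = 0" using ev that(1) by (auto simp: fmat_apply_def)
    moreover have "\<And>j. j \<in> X \<Longrightarrow> 0 \<le> A i j * \<bar>u j\<bar>" using nonneg that(1) by simp
    ultimately have "A i j * \<bar>u j\<bar> = 0" using that(2) fin by (simp add: sum_nonneg_eq_0_iff)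
    then show ?thesis using that by simp
  qed
  then have "?Z = {} \<or> ?Z = X" using conn[of ?Z] by blast
  then have "\<forall>i\<in>X. u i \<noteq> 0" using i0 by blast
  with ev show ?thesis by blast
qed

text \<open>
  The columns of \<open>(A - t1)(A - t2)\<close> are eigenvectors for the simple eigenvalue \<open>t0\<close>, so this symmetric
  matrix is a multiple of \<open>\<beta> \<beta>\<^sup>T\<close> for the Perron vector \<open>\<beta>\<close>; evaluating it at \<open>\<beta>\<close> shows that the
  factor is positive.
\<close>

lemma three_eigenvalues_rank_one:
  assumes nonneg: "\<And>i j. i \<in> X \<Longrightarrow> j \<in> X \<Longrightarrow> A i j \<ge> 0"
    and conn: "\<And>Z. Z \<subseteq> X \<Longrightarrow> Z \<noteq> {} \<Longrightarrow> (\<And>i j. i \<in> Z \<Longrightarrow> j \<in> X \<Longrightarrow> A i j \<noteq> 0 \<Longrightarrow> j \<in> Z) \<Longrightarrow> Z = X"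
    and ev: "\<And>\<theta>. (\<exists>u. (\<exists>i\<in>X. u i \<noteq> 0) \<and> (\<forall>i\<in>X. fmat_apply X A u i = \<theta> * u i)) \<longleftrightarrow> \<theta> \<in> {t0, t1, t2}"
    and less: "t2 < t1" "t1 < t0"
  shows "\<exists>\<alpha>. (\<forall>i\<in>X. \<alpha> i > 0) \<and>
    (\<forall>i\<in>X. \<forall>j\<in>X. (\<Sum>k\<in>X. A i k * A k j) = (t1 + t2) * A i j - (if i = j then t1 * t2 else 0) + \<alpha> i * \<alpha> j)"
proof -
  have top: "\<theta> \<le> t0" if "\<forall>i\<in>X. fmat_apply X A u i = \<theta> * u i" "\<exists>i\<in>X. u i \<noteq> 0" for u \<theta>
  proof -
    have "\<theta> \<in> {t0, t1, t2}" using ev[of \<theta>] that by blast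
    then show ?thesis using less by auto
  qed
  have perron: "(\<forall>i\<in>X. u i \<noteq> 0) \<and> (\<forall>i\<in>X. fmat_apply X A (\<lambda>i. \<bar>u i\<bar>) i = t0 * \<bar>u i\<bar>)"
    if "\<forall>i\<in>X. fmat_apply X A u i = t0 * u i" "\<exists>i\<in>X. u i \<noteq> 0" for u
    by (rule top_eigenvector_abs) (fact nonneg conn top that)+
  obtain u0 where u0: "\<exists>i\<in>X. u0 i \<noteq> 0" "\<forall>i\<in>X. fmat_apply X A u0 i = t0 * u0 i"
    using ev[of t0] by auto
  define \<beta> where "\<beta> i = \<bar>u0 i\<bar>" for i
  have \<beta>: "\<forall>i\<in>X. \<beta> i > 0" "\<forall>i\<in>X. fmat_apply X A \<beta> i = t0 * \<beta> i"
    using perron[OF u0(2,1)] by (auto simp: \<beta>_def[abs_def])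
  obtain i0 where i0: "i0 \<in> X" using u0 by blast
  \<comment> \<open>A \<open>t0\<close>-eigenvector with a zero entry vanishes, so the eigenspace has dimension one.\<close>
  have unique: "v i = (v i0 / \<beta> i0) * \<beta> i"
    if v: "\<forall>i\<in>X. fmat_apply X A v i = t0 * v i" and i: "i \<in> X" for v i
  proof -
    define z where "z i = v i - (v i0 / \<beta> i0) * \<beta> i" for i
    have "\<forall>i\<in>X. fmat_apply X A z i = t0 * z i"
    proof
      fix i assume "i \<in> X"
      then show "fmat_apply X A z i = t0 * z i"
        unfolding z_def[abs_def] fmat_apply_diff fmat_apply_scale
        using v \<beta>(2) by (simp add: algebra_simps)
    qed
    moreover have "z i0 = 0" using \<beta> i0 by (auto simp: z_def)
    ultimately have "\<not> (\<exists>i\<in>X. z i \<noteq> 0)" using perron[of z] i0 by blast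
    then show ?thesis using i by (simp add: z_def)
  qed
  define S where "S = (\<lambda>\<theta> v i. fmat_apply X A v i - \<theta> * v i)"
  define e where "e j i = (if i = j then 1 else 0 :: real)" for j i :: 'a
  define M where "M i j = (\<Sum>k\<in>X. A i k * A k j) - (t1 + t2) * A i j + (if i = j then t1 * t2 else 0)" for i j
  have ape: "fmat_apply X A (e j) i = A i j" if "j \<in> X" for i j
    using that fin by (simp add: fmat_apply_def e_def if_distrib cong: if_cong)
  have SM: "S t1 (S t2 (e j)) i = M i j" if j: "j \<in> X" for i j
  proof -
    have "S t1 (S t2 (e j)) i = fmat_apply X A (\<lambda>i. fmat_apply X A (e j) i - t2 * e j i) i
        - t1 * (fmat_apply X A (e j) i - t2 * e j i)"
      by (simp add: S_def)
    also have "\<dots> = fmat_apply X A (\<lambda>i. A i j) i - t2 * A i j - t1 * (A i j - t2 * e j i)"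
      by (simp only: fmat_apply_diff fmat_apply_scale ape[OF j])
    also have "fmat_apply X A (\<lambda>i. A i j) i = (\<Sum>k\<in>X. A i k * A k j)"
      by (simp add: fmat_apply_def)
    finally have eq: "S t1 (S t2 (e j)) i = (\<Sum>k\<in>X. A i k * A k j) - t2 * A i j - t1 * (A i j - t2 * e j i)" .
    have "e j i = (if i = j then 1 else 0)" by (simp add: e_def)
    then show ?thesis unfolding eq by (auto simp: M_def algebra_simps)
  qed
  have Meig: "\<forall>i\<in>X. fmat_apply X A (\<lambda>i. M i j) i = t0 * M i j" if j: "j \<in> X" for j
  proof
    fix i assume i: "i \<in> X"
    have "S t0 (S t1 (S t2 (e j))) i = 0"
    proof (rule symmetric_annihilated[OF _ S_def i])
      fix u \<theta> assume "\<forall>i\<in>X. fmat_apply X A u i = \<theta> * u i" "\<exists>i\<in>X. u i \<noteq> 0"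
      then show "\<theta> \<in> {t0, t1, t2}" using ev[of \<theta>] by blast
    qed
    moreover have "S t1 (S t2 (e j)) = (\<lambda>i. M i j)" using SM[OF j] by blast
    ultimately have "S t0 (\<lambda>i. M i j) i = 0" by simp
    then show "fmat_apply X A (\<lambda>i. M i j) i = t0 * M i j" by (simp add: S_def)
  qed
  have Msym: "M i j = M j i" if "i \<in> X" "j \<in> X" for i j
  proof -
    have "(\<Sum>k\<in>X. A i k * A k j) = (\<Sum>k\<in>X. A j k * A k i)"
      by (rule sum.cong) (use that sym in \<open>auto simp: mult.commute\<close>)
    then show ?thesis using that sym by (simp add: M_def)
  qed
  define \<gamma> where "\<gamma> = M i0 i0 / (\<beta> i0)\<^sup>2"
  have M\<gamma>: "M i j = \<gamma> * \<beta> i * \<beta> j" if i: "i \<in> X" and j: "j \<in> X" for i j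
  proof -
    have "M i j = (M i0 j / \<beta> i0) * \<beta> i" by (rule unique[OF Meig[OF j] i])
    also have "M i0 j = M j i0" by (rule Msym[OF i0 j])
    also have "M j i0 = (M i0 i0 / \<beta> i0) * \<beta> j" by (rule unique[OF Meig[OF i0] j])
    finally show ?thesis by (simp add: \<gamma>_def power2_eq_square)
  qed
  have "\<gamma> > 0"
  proof -
    have "(\<Sum>j\<in>X. M i0 j * \<beta> j) = (\<Sum>j\<in>X. (\<Sum>k\<in>X. A i0 k * A k j) * \<beta> j)
        - (\<Sum>j\<in>X. (t1 + t2) * (A i0 j * \<beta> j)) + (\<Sum>j\<in>X. if i0 = j then t1 * t2 * \<beta> i0 else 0)"
      unfolding sum_subtractf[symmetric] sum.distrib[symmetric]
      by (rule sum.cong) (auto simp: M_def algebra_simps)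
    also have "(\<Sum>j\<in>X. (\<Sum>k\<in>X. A i0 k * A k j) * \<beta> j) = (\<Sum>j\<in>X. \<Sum>k\<in>X. A i0 k * (A k j * \<beta> j))"
      by (simp add: sum_distrib_right mult.assoc)
    also have "\<dots> = (\<Sum>k\<in>X. \<Sum>j\<in>X. A i0 k * (A k j * \<beta> j))" by (rule sum.swap)
    also have "\<dots> = (\<Sum>k\<in>X. A i0 k * (t0 * \<beta> k))"
      by (rule sum.cong) (use \<beta>(2) in \<open>auto simp: sum_distrib_left[symmetric] fmat_apply_def\<close>)
    also have "\<dots> = t0 * fmat_apply X A \<beta> i0"
      by (simp add: fmat_apply_def sum_distrib_left mult.left_commute)
    also have "(\<Sum>j\<in>X. (t1 + t2) * (A i0 j * \<beta> j)) = (t1 + t2) * fmat_apply X A \<beta> i0"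
      by (simp add: fmat_apply_def sum_distrib_left)
    also have "(\<Sum>j\<in>X. if i0 = j then t1 * t2 * \<beta> i0 else 0) = t1 * t2 * \<beta> i0"
      using i0 fin by simp
    also have "t0 * fmat_apply X A \<beta> i0 - (t1 + t2) * fmat_apply X A \<beta> i0 + t1 * t2 * \<beta> i0
        = (t0 - t1) * (t0 - t2) * \<beta> i0"
      using \<beta>(2) i0 by (simp add: algebra_simps)
    also have "\<dots> > 0" using less \<beta>(1) i0 by simp
    finally have "0 < (\<Sum>j\<in>X. M i0 j * \<beta> j)" .
    also have "(\<Sum>j\<in>X. M i0 j * \<beta> j) = \<gamma> * (\<beta> i0 * fdot X \<beta> \<beta>)"
      unfolding fdot_def sum_distrib_left by (rule sum.cong) (use M\<gamma> i0 in auto)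
    finally have "0 < \<gamma> * (\<beta> i0 * fdot X \<beta> \<beta>)" .
    moreover have "0 \<le> \<beta> i0 * fdot X \<beta> \<beta>" using \<beta>(1) i0 fdot_self_nonneg[of X \<beta>] by auto
    ultimately show ?thesis by (simp add: zero_less_mult_iff)
  qed
  define \<alpha> where "\<alpha> i = sqrt \<gamma> * \<beta> i" for i
  have "\<forall>i\<in>X. \<alpha> i > 0" using \<open>\<gamma> > 0\<close> \<beta>(1) by (simp add: \<alpha>_def)
  moreover have "\<forall>i\<in>X. \<forall>j\<in>X. (\<Sum>k\<in>X. A i k * A k j)
      = (t1 + t2) * A i j - (if i = j then t1 * t2 else 0) + \<alpha> i * \<alpha> j"
  proof (intro ballI)
    fix i j assume "i \<in> X" "j \<in> X"
    then have "M i j = \<alpha> i * \<alpha> j" using M\<gamma> \<open>\<gamma> > 0\<close> by (simp add: \<alpha>_def)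
    then show "(\<Sum>k\<in>X. A i k * A k j)
      = (t1 + t2) * A i j - (if i = j then t1 * t2 else 0) + \<alpha> i * \<alpha> j"
      by (simp add: M_def)
  qed
  ultimately show ?thesis by blast
qed

end

section \<open>Graphs with two fibres\<close>

lemma off_diagonal_const_sum:
  fixes A :: "'a \<Rightarrow> 'a \<Rightarrow> real"
  assumes "finite Y" "i \<in> Y" "A i i = 0" "\<And>k. k \<in> Y \<Longrightarrow> k \<noteq> i \<Longrightarrow> A i k = c"
  shows "(\<Sum>k\<in>Y. A i k * f k) = c * (\<Sum>k\<in>Y. f k) - c * f i"
proof -
  have "(\<Sum>k\<in>Y. A i k * f k) = (\<Sum>k\<in>Y. c * f k - (if k = i then c * f i else 0))"
    by (rule sum.cong) (use assms in auto)
  also have "\<dots> = c * (\<Sum>k\<in>Y. f k) - c * f i"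
    using assms by (simp add: sum_subtractf sum_distrib_left)
  finally show ?thesis .
qed

text \<open>
  The combinatorial situation to which the type reduces the theorem. The vertex set is
  \<open>X1 \<union> X2\<close>, the adjacency matrix \<open>A\<close> has the blocks \<open>\<epsilon> (J - I)\<close>, \<open>M\<close>, \<open>M\<^sup>T\<close>, \<open>N\<close>, and
  \<open>A\<^sup>2 = s A - p I + \<alpha> \<alpha>\<^sup>T\<close> where \<open>\<alpha>\<close> takes the values \<open>a1\<close> on \<open>X1\<close> and \<open>a2\<close> on \<open>X2\<close>. The rows and
  columns of \<open>M\<close> and the rows of \<open>N\<close> have constant sums \<open>k12\<close>, \<open>k21\<close> and \<open>k22\<close>. Any two points of
  \<open>X1\<close> have \<open>l\<close> common neighbours in \<open>X2\<close>; two vertices of \<open>X2\<close> have \<open>x\<close> or \<open>y\<close> common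
  neighbours in \<open>X1\<close>, according to whether they are adjacent. Neither \<open>M\<close> nor the off-diagonal part
  of \<open>N\<close> is constant.
\<close>

locale two_fibre_graph =
  fixes X1 X2 :: "'a set" and A :: "'a \<Rightarrow> 'a \<Rightarrow> real"
    and s p a1 a2 \<epsilon> k12 k21 k22 l x y :: real
  assumes fin: "finite X1" "finite X2" and disj: "X1 \<inter> X2 = {}"
    and A01: "\<And>i j. i \<in> X1 \<union> X2 \<Longrightarrow> j \<in> X1 \<union> X2 \<Longrightarrow> A i j = 0 \<or> A i j = 1"
    and sym: "\<And>i j. i \<in> X1 \<union> X2 \<Longrightarrow> j \<in> X1 \<union> X2 \<Longrightarrow> A i j = A j i"
    and diag: "\<And>i. i \<in> X1 \<union> X2 \<Longrightarrow> A i i = 0"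
    and square: "\<And>i j. i \<in> X1 \<union> X2 \<Longrightarrow> j \<in> X1 \<union> X2 \<Longrightarrow>
      (\<Sum>k\<in>X1. A i k * A k j) + (\<Sum>k\<in>X2. A i k * A k j) = s * A i j - (if i = j then p else 0)
        + (if i \<in> X1 then a1 else a2) * (if j \<in> X1 then a1 else a2)"
    and trivial_fibre: "\<And>i j. i \<in> X1 \<Longrightarrow> j \<in> X1 \<Longrightarrow> i \<noteq> j \<Longrightarrow> A i j = \<epsilon>"
    and rows: "\<And>i. i \<in> X1 \<Longrightarrow> (\<Sum>j\<in>X2. A i j) = k12"
    and columns: "\<And>j. j \<in> X2 \<Longrightarrow> (\<Sum>i\<in>X1. A i j) = k21"
    and degrees2: "\<And>j. j \<in> X2 \<Longrightarrow> (\<Sum>i\<in>X2. A i j) = k22"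
    and pairs1: "\<And>i j. i \<in> X1 \<Longrightarrow> j \<in> X1 \<Longrightarrow> i \<noteq> j \<Longrightarrow> (\<Sum>k\<in>X2. A i k * A k j) = l"
    and pairs2: "\<And>i j. i \<in> X2 \<Longrightarrow> j \<in> X2 \<Longrightarrow> i \<noteq> j \<Longrightarrow>
      (\<Sum>k\<in>X1. A i k * A k j) = (if A i j = 1 then x else y)"
    and two_points: "\<exists>i\<in>X1. \<exists>j\<in>X1. i \<noteq> j"
    and M_nontrivial: "\<exists>i\<in>X1. \<exists>j\<in>X2. A i j = 1" "\<exists>i\<in>X1. \<exists>j\<in>X2. A i j = 0"
    and N_nontrivial: "\<exists>i\<in>X2. \<exists>j\<in>X2. i \<noteq> j \<and> A i j = 1" "\<exists>i\<in>X2. \<exists>j\<in>X2. i \<noteq> j \<and> A i j = 0"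
begin

text \<open>The product \<open>M M\<^sup>T\<close>.\<close>

lemma points_product:
  assumes "i \<in> X1" "j \<in> X1"
  shows "(\<Sum>k\<in>X2. A i k * A k j) = (if i = j then k12 else l)"
proof (cases "i = j")
  case True
  have "(\<Sum>k\<in>X2. A i k * A k i) = (\<Sum>k\<in>X2. A i k)"
  proof (rule sum.cong[OF refl])
    fix k assume k: "k \<in> X2"
    show "A i k * A k i = A i k" using A01[of i k] sym[of k i] assms k by auto
  qed
  then show ?thesis using True rows[OF assms(1)] by simp
qed (use pairs1[OF assms] in simp)

text \<open>The product \<open>M\<^sup>T M\<close>.\<close>

lemma blocks_product:
  assumes "i \<in> X2" "j \<in> X2"
  shows "(\<Sum>k\<in>X1. A i k * A k j) = (if i = j then k21 - y else 0) + (x - y) * A i j + y"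
proof (cases "i = j")
  case True
  have "(\<Sum>k\<in>X1. A i k * A k i) = (\<Sum>k\<in>X1. A k i)"
  proof (rule sum.cong[OF refl])
    fix k assume k: "k \<in> X1"
    show "A i k * A k i = A k i" using A01[of k i] sym[of i k] assms k by auto
  qed
  then show ?thesis using True columns[OF assms(1)] diag[of i] assms by simp
next
  case False
  then show ?thesis using pairs2[OF assms] A01[of i j] assms by auto
qed

lemma first_fibre_sum:
  assumes i: "i \<in> X1"
  shows "(\<Sum>k\<in>X1. A i k * f k) = \<epsilon> * (\<Sum>k\<in>X1. f k) - \<epsilon> * f i"
  using off_diagonal_const_sum[where A = A and c = \<epsilon> and f = f, OF fin(1) i] diag trivial_fibre i
  by simp

text \<open>The product \<open>M N\<close>, read off from the block of \<open>A\<^sup>2\<close> between the fibres.\<close>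

lemma incidence_block_graph_product:
  assumes "i \<in> X1" "j \<in> X2"
  shows "(\<Sum>k\<in>X2. A i k * A k j) = (s + \<epsilon>) * A i j + (a1 * a2 - \<epsilon> * k21)"
proof -
  have "j \<notin> X1" "i \<noteq> j" using assms disj by auto
  then show ?thesis
    using square[of i j] first_fibre_sum[OF assms(1), of "\<lambda>k. A k j"] columns[OF assms(2)] assms
    by (simp add: algebra_simps)
qed

text \<open>The square of \<open>N\<close>, read off from the block of \<open>A\<^sup>2\<close> on the second fibre.\<close>

lemma block_graph_square:
  assumes "i \<in> X2" "j \<in> X2"
  shows "(\<Sum>k\<in>X2. A i k * A k j)
    = (s - (x - y)) * A i j - (if i = j then p + k21 - y else 0) + (a2\<^sup>2 - y)"
proof -
  have "i \<notin> X1" "j \<notin> X1" using assms disj by auto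
  then show ?thesis
    using square[of i j] blocks_product[OF assms] assms
    by (cases "i = j") (simp_all add: power2_eq_square algebra_simps)
qed

lemma lambda_minus_r: "l - k12 = p + \<epsilon> * s + \<epsilon>\<^sup>2"
proof -
  obtain i j where ij: "i \<in> X1" "j \<in> X1" "i \<noteq> j" using two_points by blast
  have "(\<Sum>k\<in>X1. A k i) = \<epsilon> * (real (card X1) - 1)" if "i \<in> X1" for i
  proof -
    have "(\<Sum>k\<in>X1. A k i) = (\<Sum>k\<in>X1. A i k * 1)"
      by (rule sum.cong) (use that sym in auto)
    then show ?thesis using first_fibre_sum[OF that, of "\<lambda>_. 1"] by (simp add: algebra_simps)
  qed
  then have "(\<Sum>k\<in>X1. A i k * A k i) - (\<Sum>k\<in>X1. A i k * A k j) = \<epsilon>\<^sup>2"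
    using ij first_fibre_sum[OF ij(1), of "\<lambda>k. A k i"] first_fibre_sum[OF ij(1), of "\<lambda>k. A k j"]
      diag[of i] trivial_fibre[OF ij] by (simp add: power2_eq_square)
  then show ?thesis
    using square[of i i] square[of i j] points_product[of i i] points_product[of i j] diag[of i] trivial_fibre[OF ij] ij
    by (simp add: algebra_simps)
qed

text \<open>
  The rows of \<open>M\<close> for two points differ in \<open>2 (k12 - l)\<close> positions. If \<open>l = k12\<close>, all rows agree,
  and since the columns have constant sum \<open>M\<close> would be constant.
\<close>

lemma lambda_less_r: "l < k12"
proof -
  have sq: "(\<Sum>k\<in>X2. (A i k - A j k)\<^sup>2) = 2 * (k12 - l)" if ij: "i \<in> X1" "j \<in> X1" "i \<noteq> j" for i j
  proof -
    have "(\<Sum>k\<in>X2. (A i k - A j k)\<^sup>2)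
        = (\<Sum>k\<in>X2. A i k * A k i + A j k * A k j - 2 * (A i k * A k j))"
      by (rule sum.cong) (use ij sym in \<open>auto simp: power2_eq_square algebra_simps\<close>)
    also have "\<dots> = k12 + k12 - 2 * l"
      using points_product[OF ij(1) ij(1)] points_product[OF ij(2) ij(2)] points_product[OF ij(1,2)] ij(3)
      by (simp add: sum.distrib sum_subtractf sum_distrib_left[symmetric])
    finally show ?thesis by simp
  qed
  obtain i j where ij: "i \<in> X1" "j \<in> X1" "i \<noteq> j" using two_points by blast
  have "0 \<le> (\<Sum>k\<in>X2. (A i k - A j k)\<^sup>2)" by (simp add: sum_nonneg)
  then have "l \<le> k12" using sq[OF ij] by simp
  moreover have "l \<noteq> k12"
  proof
    assume eq: "l = k12"
    have same: "A i k = A j k" if "i \<in> X1" "j \<in> X1" "k \<in> X2" for i j k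
    proof (cases "i = j")
      case False
      then have "(\<Sum>k\<in>X2. (A i k - A j k)\<^sup>2) = 0" using sq[OF that(1,2)] eq by simp
      then show ?thesis using fin that(3) by (simp add: sum_nonneg_eq_0_iff)
    qed simp
    have col: "real (card X1) * A i k = k21" if "i \<in> X1" "k \<in> X2" for i k
    proof -
      have "k21 = (\<Sum>j\<in>X1. A j k)" using columns[OF that(2)] by simp
      also have "\<dots> = (\<Sum>j\<in>X1. A i k)" by (rule sum.cong[OF refl], rule same) (use that in auto)
      finally show ?thesis by simp
    qed
    have "card X1 \<noteq> 0" using ij fin by auto
    moreover obtain i j where "i \<in> X1" "j \<in> X2" "A i j = 1" using M_nontrivial(1) by blast
    moreover obtain i' j' where "i' \<in> X1" "j' \<in> X2" "A i' j' = 0" using M_nontrivial(2) by blast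
    ultimately show False using col[of i j] col[of i' j'] by simp
  qed
  ultimately show ?thesis by simp
qed

text \<open>
  If \<open>x = y\<close>, then \<open>M\<^sup>T M\<close> is a combination of \<open>I\<close> and \<open>J\<close>. Either the coefficient \<open>k21 - y\<close> of \<open>I\<close> is
  zero and all columns of \<open>M\<close> agree, or evaluating \<open>M\<^sup>T M N\<close> in two ways expresses \<open>N\<close> by \<open>I\<close> and \<open>J\<close>.
\<close>

lemma intersection_numbers_distinct: "x \<noteq> y"
proof
  assume xy: "x = y"
  have blocks_product': "(\<Sum>k\<in>X1. A i k * A k j) = (if i = j then k21 - y else 0) + y"
    if "i \<in> X2" "j \<in> X2" for i j
    using blocks_product[OF that] xy by simp
  have "k21 \<noteq> y"
  proof
    assume eq: "k21 = y"
    have same: "A i j = A i k" if i: "i \<in> X1" and jk: "j \<in> X2" "k \<in> X2" for i j k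
    proof -
      have "(\<Sum>i\<in>X1. (A i j - A i k)\<^sup>2)
          = (\<Sum>i\<in>X1. A j i * A i j + A k i * A i k - 2 * (A j i * A i k))"
        by (rule sum.cong) (use jk sym in \<open>auto simp: power2_eq_square algebra_simps\<close>)
      also have "\<dots> = 0"
        using blocks_product'[OF jk] blocks_product'[of j j] blocks_product'[of k k] jk eq
        by (simp add: sum.distrib sum_subtractf sum_distrib_left[symmetric])
      finally show ?thesis using fin i by (simp add: sum_nonneg_eq_0_iff)
    qed
    have row: "real (card X2) * A i k = k12" if "i \<in> X1" "k \<in> X2" for i k
    proof -
      have "k12 = (\<Sum>j\<in>X2. A i j)" using rows[OF that(1)] by simp
      also have "\<dots> = (\<Sum>j\<in>X2. A i k)" by (rule sum.cong[OF refl], rule same) (use that in auto)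
      finally show ?thesis by simp
    qed
    have "card X2 \<noteq> 0" using M_nontrivial fin by auto
    moreover obtain i j where "i \<in> X1" "j \<in> X2" "A i j = 1" using M_nontrivial(1) by blast
    moreover obtain i' j' where "i' \<in> X1" "j' \<in> X2" "A i' j' = 0" using M_nontrivial(2) by blast
    ultimately show False using row[of i j] row[of i' j'] by simp
  qed
  have eq: "(k21 - y) * A i j + y * k22 = (s + \<epsilon>) * y + (a1 * a2 - \<epsilon> * k21) * k21"
    if ij: "i \<in> X2" "j \<in> X2" "i \<noteq> j" for i j
  proof -
    have "(\<Sum>k\<in>X1. A i k * (\<Sum>m\<in>X2. A k m * A m j)) = (\<Sum>k\<in>X1. \<Sum>m\<in>X2. A i k * A k m * A m j)"
      by (simp add: sum_distrib_left mult.assoc)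
    also have "\<dots> = (\<Sum>m\<in>X2. \<Sum>k\<in>X1. A i k * A k m * A m j)" by (rule sum.swap)
    also have "\<dots> = (\<Sum>m\<in>X2. (\<Sum>k\<in>X1. A i k * A k m) * A m j)" by (simp add: sum_distrib_right)
    also have "\<dots> = (\<Sum>m\<in>X2. (if i = m then (k21 - y) * A i j else 0) + y * A m j)"
      by (rule sum.cong[OF refl], subst blocks_product') (use ij in \<open>auto simp: algebra_simps\<close>)
    also have "\<dots> = (k21 - y) * A i j + y * k22"
      using ij fin degrees2 by (simp add: sum.distrib sum_distrib_left[symmetric])
    also have "(\<Sum>k\<in>X1. A i k * (\<Sum>m\<in>X2. A k m * A m j))
        = (\<Sum>k\<in>X1. (s + \<epsilon>) * (A i k * A k j) + (a1 * a2 - \<epsilon> * k21) * A k i)"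
      by (rule sum.cong[OF refl], subst incidence_block_graph_product) (use ij sym in \<open>auto simp: algebra_simps\<close>)
    also have "\<dots> = (s + \<epsilon>) * y + (a1 * a2 - \<epsilon> * k21) * k21"
      using blocks_product'[OF ij(1,2)] ij columns by (simp add: sum.distrib sum_distrib_left[symmetric])
    finally show ?thesis by simp
  qed
  obtain i j where "i \<in> X2" "j \<in> X2" "i \<noteq> j" "A i j = 1" using N_nontrivial(1) by blast
  moreover obtain i' j' where "i' \<in> X2" "j' \<in> X2" "i' \<noteq> j'" "A i' j' = 0" using N_nontrivial(2) by blast
  ultimately show False using eq[of i j] eq[of i' j'] \<open>k21 \<noteq> y\<close> by simp
qed

text \<open>The two evaluations of \<open>M M\<^sup>T M\<close>.\<close>

lemma triple_product:
  assumes ij: "i \<in> X1" "j \<in> X2"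
  shows "(x - y) * ((s + \<epsilon>) * A i j + (a1 * a2 - \<epsilon> * k21)) + (k21 - y) * A i j + y * k12
    = (k12 - l) * A i j + l * k21"
proof -
  have "(\<Sum>m\<in>X2. A i m * (\<Sum>k\<in>X1. A m k * A k j)) = (\<Sum>m\<in>X2. \<Sum>k\<in>X1. A i m * A m k * A k j)"
    by (simp add: sum_distrib_left mult.assoc)
  also have "\<dots> = (\<Sum>k\<in>X1. \<Sum>m\<in>X2. A i m * A m k * A k j)" by (rule sum.swap)
  also have "\<dots> = (\<Sum>k\<in>X1. (\<Sum>m\<in>X2. A i m * A m k) * A k j)" by (simp add: sum_distrib_right)
  also have "\<dots> = (\<Sum>k\<in>X1. (if i = k then (k12 - l) * A i j else 0) + l * A k j)"
    by (rule sum.cong[OF refl], subst points_product) (use ij in \<open>auto simp: algebra_simps\<close>)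
  also have "\<dots> = (k12 - l) * A i j + l * k21"
    using ij fin columns by (simp add: sum.distrib sum_distrib_left[symmetric])
  also have "(\<Sum>m\<in>X2. A i m * (\<Sum>k\<in>X1. A m k * A k j))
      = (\<Sum>m\<in>X2. (if j = m then (k21 - y) * A i j else 0) + (x - y) * (A i m * A m j) + y * A i m)"
    by (rule sum.cong[OF refl], subst blocks_product) (use ij in \<open>auto simp: algebra_simps\<close>)
  also have "\<dots> = (k21 - y) * A i j + (x - y) * (\<Sum>m\<in>X2. A i m * A m j) + y * k12"
    using ij fin rows by (simp add: sum.distrib sum_distrib_left[symmetric])
  finally show ?thesis using incidence_block_graph_product[OF ij] by simp
qed

lemma alpha_product: "(x - y) * (a1 * a2 - \<epsilon> * k21) = l * k21 - y * k12"
proof -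
  obtain i j where "i \<in> X1" "j \<in> X2" "A i j = 0" using M_nontrivial(2) by blast
  then show ?thesis using triple_product[of i j] by simp
qed

lemma eigenvalue_sum: "(x - y) * (s + \<epsilon>) = k12 - l + y - k21"
proof -
  obtain i j where "i \<in> X1" "j \<in> X2" "A i j = 1" using M_nontrivial(1) by blast
  then show ?thesis using triple_product[of i j] alpha_product by (simp add: algebra_simps)
qed

text \<open>
  For an eigenvector \<open>u\<close> of \<open>N\<close> orthogonal to \<open>1\<close>, the formula for \<open>N\<^sup>2\<close> gives a quadratic equation for
  the eigenvalue \<open>e\<close>. Applying \<open>M N\<close> to \<open>u\<close> gives \<open>e = s + \<epsilon>\<close> unless \<open>M u = 0\<close>; in the latter case
  \<open>M\<^sup>T M u = 0\<close> determines \<open>e\<close>, and \<open>e\<close> is a root of \<open>z\<^sup>2 - s z + p\<close>.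
\<close>

lemma restricted_eigenvalue:
  assumes u: "\<And>i. i \<in> X2 \<Longrightarrow> (\<Sum>j\<in>X2. A i j * u j) = e * u i"
    and nz: "\<exists>i\<in>X2. u i \<noteq> 0" and u1: "(\<Sum>i\<in>X2. u i) = 0"
  shows "e\<^sup>2 = (s - (x - y)) * e - (p + k21 - y)" (is ?quad)
    and "e = s + \<epsilon> \<or> (x - y) * e = y - k21 \<and> e\<^sup>2 = s * e - p" (is ?alt)
proof -
  obtain i0 where i0: "i0 \<in> X2" "u i0 \<noteq> 0" using nz by blast
  have "e * (e * u i0) = (\<Sum>k\<in>X2. A i0 k * (\<Sum>j\<in>X2. A k j * u j))"
    using i0 u by (simp add: mult.left_commute sum_distrib_left[symmetric])
  also have "\<dots> = (\<Sum>k\<in>X2. \<Sum>j\<in>X2. A i0 k * A k j * u j)"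
    by (simp add: sum_distrib_left mult.assoc)
  also have "\<dots> = (\<Sum>j\<in>X2. \<Sum>k\<in>X2. A i0 k * A k j * u j)" by (rule sum.swap)
  also have "\<dots> = (\<Sum>j\<in>X2. (\<Sum>k\<in>X2. A i0 k * A k j) * u j)" by (simp add: sum_distrib_right)
  also have "\<dots> = (\<Sum>j\<in>X2. (s - (x - y)) * (A i0 j * u j)
      - (if i0 = j then (p + k21 - y) * u i0 else 0) + (a2\<^sup>2 - y) * u j)"
    by (rule sum.cong[OF refl], subst block_graph_square) (use i0 in \<open>auto simp: algebra_simps\<close>)
  also have "\<dots> = (s - (x - y)) * (e * u i0) - (p + k21 - y) * u i0"
    using i0 fin u u1 by (simp add: sum.distrib sum_subtractf sum_distrib_left[symmetric])
  finally have "u i0 * e\<^sup>2 = u i0 * ((s - (x - y)) * e - (p + k21 - y))"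
    by (simp add: power2_eq_square algebra_simps)
  then show quad: ?quad using i0 by simp
  define m where "m i = (\<Sum>j\<in>X2. A i j * u j)" for i
  have "e * m i = (s + \<epsilon>) * m i" if i: "i \<in> X1" for i
  proof -
    have "e * m i = (\<Sum>k\<in>X2. A i k * (\<Sum>j\<in>X2. A k j * u j))"
      using i u by (simp add: m_def mult.left_commute sum_distrib_left)
    also have "\<dots> = (\<Sum>k\<in>X2. \<Sum>j\<in>X2. A i k * A k j * u j)"
      by (simp add: sum_distrib_left mult.assoc)
    also have "\<dots> = (\<Sum>j\<in>X2. \<Sum>k\<in>X2. A i k * A k j * u j)" by (rule sum.swap)
    also have "\<dots> = (\<Sum>j\<in>X2. (\<Sum>k\<in>X2. A i k * A k j) * u j)" by (simp add: sum_distrib_right)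
    also have "\<dots> = (\<Sum>j\<in>X2. (s + \<epsilon>) * (A i j * u j) + (a1 * a2 - \<epsilon> * k21) * u j)"
      by (rule sum.cong[OF refl], subst incidence_block_graph_product) (use i in \<open>auto simp: algebra_simps\<close>)
    also have "\<dots> = (s + \<epsilon>) * m i"
      using u1 by (simp add: m_def sum.distrib sum_distrib_left[symmetric])
    finally show ?thesis .
  qed
  then have "e = s + \<epsilon> \<or> (\<forall>i\<in>X1. m i = 0)" by auto
  moreover have "(x - y) * e = y - k21 \<and> e\<^sup>2 = s * e - p" if m0: "\<forall>i\<in>X1. m i = 0"
  proof -
    have "0 = (\<Sum>k\<in>X1. A i0 k * (\<Sum>j\<in>X2. A k j * u j))" using m0 by (simp add: m_def)
    also have "\<dots> = (\<Sum>k\<in>X1. \<Sum>j\<in>X2. A i0 k * A k j * u j)"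
      by (simp add: sum_distrib_left mult.assoc)
    also have "\<dots> = (\<Sum>j\<in>X2. \<Sum>k\<in>X1. A i0 k * A k j * u j)" by (rule sum.swap)
    also have "\<dots> = (\<Sum>j\<in>X2. (\<Sum>k\<in>X1. A i0 k * A k j) * u j)" by (simp add: sum_distrib_right)
    also have "\<dots> = (\<Sum>j\<in>X2. (if i0 = j then (k21 - y) * u i0 else 0) + (x - y) * (A i0 j * u j) + y * u j)"
      by (rule sum.cong[OF refl], subst blocks_product) (use i0 in \<open>auto simp: algebra_simps\<close>)
    also have "\<dots> = (k21 - y) * u i0 + (x - y) * (e * u i0)"
      using i0 fin u u1 by (simp add: sum.distrib sum_distrib_left[symmetric])
    finally have "u i0 * ((x - y) * e) = u i0 * (y - k21)" by (simp add: algebra_simps)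
    then have "(x - y) * e = y - k21" using i0 by simp
    then show ?thesis using quad by (simp add: algebra_simps)
  qed
  ultimately show ?alt by blast
qed

end

lemma two_roots:
  fixes b c e1 e2 :: real
  assumes "e1\<^sup>2 = b * e1 - c" "e2\<^sup>2 = b * e2 - c" "e1 \<noteq> e2"
  shows "e1 + e2 = b" "e1 * e2 = c"
proof -
  have "(e1 - e2) * (e1 + e2 - b) = 0"
    using assms(1,2) by (simp add: power2_eq_square algebra_simps)
  then show b: "e1 + e2 = b" using assms(3) by simp
  show "e1 * e2 = c" using assms(1) unfolding b[symmetric] by (simp add: power2_eq_square algebra_simps)
qed

text \<open>
  Of two distinct restricted eigenvalues one is \<open>(y - k21) / (x - y) \<in> {t1, t2}\<close> and the other is
  \<open>t1 + t2 + \<epsilon>\<close>. As \<open>(t1 + \<epsilon>)(t2 + \<epsilon>) = l - k12 < 0\<close>, the latter lies strictly between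
  \<open>t2\<close> and \<open>t1\<close>, which decides which of the two is the larger one.
\<close>

lemma (in two_fibre_graph) restricted_eigenvalues_pair:
  assumes s: "s = t1 + t2" and p: "p = t1 * t2" and t: "t2 < t1"
    and u: "\<And>i. i \<in> X2 \<Longrightarrow> (\<Sum>j\<in>X2. A i j * u j) = e1 * u i" "\<exists>i\<in>X2. u i \<noteq> 0" "(\<Sum>i\<in>X2. u i) = 0"
    and v: "\<And>i. i \<in> X2 \<Longrightarrow> (\<Sum>j\<in>X2. A i j * v j) = e2 * v i" "\<exists>i\<in>X2. v i \<noteq> 0" "(\<Sum>i\<in>X2. v i) = 0"
    and e: "e2 < e1" and \<epsilon>: "\<epsilon> = 0 \<or> \<epsilon> = 1"
  shows "(t1 = e1 \<and> e1 = (y - k21) / (x - y)) \<or> (t2 = e2 \<and> e2 = (y - k21) / (x - y))"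
    and "x = k21 + (t1 + 1) * (t2 + 1) - (e1 + 1) * (e2 + 1)"
    and "y = k21 + t1 * t2 - e1 * e2"
proof -
  note U = restricted_eigenvalue[OF u] and V = restricted_eigenvalue[OF v]
  have ne: "e1 \<noteq> e2" using e by simp
  note roots = two_roots[OF U(1) V(1) ne]
  show y: "y = k21 + t1 * t2 - e1 * e2" using roots(2) p by simp
  show "x = k21 + (t1 + 1) * (t2 + 1) - (e1 + 1) * (e2 + 1)"
    using roots(1) y s by (simp add: algebra_simps)
  have xy: "x - y \<noteq> 0" using intersection_numbers_distinct by simp
  have "(t1 + \<epsilon>) * (t2 + \<epsilon>) = l - k12"
    using lambda_minus_r by (simp add: s p power2_eq_square algebra_simps)
  then have "(t1 + \<epsilon>) * (t2 + \<epsilon>) < 0" using lambda_less_r by simp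
  then have sgn: "t1 + \<epsilon> > 0" "t2 + \<epsilon> < 0" using t by (auto simp: mult_less_0_iff)
  have theta: "z = t1 \<or> z = t2" if "z\<^sup>2 = s * z - p" for z
  proof -
    have "(z - t1) * (z - t2) = 0" using that by (simp add: s p power2_eq_square algebra_simps)
    then show ?thesis by simp
  qed
  have tau: "z = (y - k21) / (x - y)" if "(x - y) * z = y - k21" for z
    using that xy by (simp add: field_simps)
  consider "e1 = s + \<epsilon>" "(x - y) * e2 = y - k21" "e2\<^sup>2 = s * e2 - p"
    | "e2 = s + \<epsilon>" "(x - y) * e1 = y - k21" "e1\<^sup>2 = s * e1 - p"
  proof -
    have "\<not> ((x - y) * e1 = y - k21 \<and> (x - y) * e2 = y - k21)" using tau ne by blast
    then show thesis using U(2) V(2) ne that by blast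
  qed
  then show "(t1 = e1 \<and> e1 = (y - k21) / (x - y)) \<or> (t2 = e2 \<and> e2 = (y - k21) / (x - y))"
  proof cases
    case 1
    have "e2 \<noteq> t1" using 1(1) e sgn by (auto simp: s)
    then show ?thesis using theta[OF 1(3)] tau[OF 1(2)] by blast
  next
    case 2
    have "e1 \<noteq> t2" using 2(1) e sgn by (auto simp: s)
    then show ?thesis using theta[OF 2(3)] tau[OF 2(2)] by blast
  qed
qed

section \<open>From the type to the two fibres\<close>

text \<open>
  In the two degenerate cases (\<open>M = J\<close>, or \<open>N\<close> a multiple of \<open>J - I\<close>) the walks of length two have block
  form, so the adjacency matrix lies in a coherent algebra. In the first case its members are constant
  between the fibres, in the second case off the diagonal of the second fibre.
\<close>

lemma two_fibre_coherent_algebra: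
  fixes A :: "'a \<Rightarrow> 'a \<Rightarrow> real" and s p a1 a2 \<epsilon> k11 k12 k21 k22 :: real
  assumes fin: "finite X1" "finite X2" and disj: "X1 \<inter> X2 = {}"
    and A01: "\<And>i j. i \<in> X1 \<union> X2 \<Longrightarrow> j \<in> X1 \<union> X2 \<Longrightarrow> A i j = 0 \<or> A i j = 1"
    and sym: "\<And>i j. i \<in> X1 \<union> X2 \<Longrightarrow> j \<in> X1 \<union> X2 \<Longrightarrow> A i j = A j i"
    and diag: "\<And>i. i \<in> X1 \<union> X2 \<Longrightarrow> A i i = 0"
    and square: "\<And>i j. i \<in> X1 \<union> X2 \<Longrightarrow> j \<in> X1 \<union> X2 \<Longrightarrow>
      (\<Sum>k\<in>X1. A i k * A k j) + (\<Sum>k\<in>X2. A i k * A k j) = s * A i j - (if i = j then p else 0)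
        + (if i \<in> X1 then a1 else a2) * (if j \<in> X1 then a1 else a2)"
    and trivial_fibre: "\<And>i j. i \<in> X1 \<Longrightarrow> j \<in> X1 \<Longrightarrow> i \<noteq> j \<Longrightarrow> A i j = \<epsilon>"
    and k11: "\<And>i. i \<in> X1 \<Longrightarrow> (\<Sum>k\<in>X1. A i k) = k11"
    and k12: "\<And>i. i \<in> X1 \<Longrightarrow> (\<Sum>k\<in>X2. A i k) = k12"
    and k21: "\<And>i. i \<in> X2 \<Longrightarrow> (\<Sum>k\<in>X1. A i k) = k21"
    and k22: "\<And>i. i \<in> X2 \<Longrightarrow> (\<Sum>k\<in>X2. A i k) = k22"
    and triv: "(\<forall>i\<in>X1. \<forall>j\<in>X2. A i j = 1) \<or> (\<exists>c. \<forall>i\<in>X2. \<forall>j\<in>X2. i \<noteq> j \<longrightarrow> A i j = c)"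
  shows "coherent_algebra (X1 \<union> X2) {P \<in> fmats (X1 \<union> X2).
    block_form (X1 \<union> X2) (\<lambda>i. i \<in> X1) (\<lambda>i j. complex_of_real (A i j)) P}"
proof -
  let ?X = "X1 \<union> X2" and ?\<kappa> = "\<lambda>i. i \<in> X1" and ?A = "\<lambda>i j. complex_of_real (A i j)"
  have cl: "{k \<in> ?X. ?\<kappa> k = True} = X1" "{k \<in> ?X. ?\<kappa> k = False} = X2" using disj by auto
  define C1 where "C1 i j = (\<Sum>k\<in>X1. A i k * A k j)" for i j
  have colsum: "(\<Sum>k\<in>Y. A k j) = (\<Sum>k\<in>Y. A j k)" if "Y \<subseteq> ?X" "j \<in> ?X" for Y j
    by (rule sum.cong) (use that sym in blast)+
  have C1sym: "C1 i j = C1 j i" if "i \<in> ?X" "j \<in> ?X" for i j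
    unfolding C1_def
  proof (rule sum.cong[OF refl])
    fix k assume "k \<in> X1"
    then show "A i k * A k j = A j k * A k i" using sym[of i k] sym[of k j] that by simp
  qed
  have C1_1: "C1 i j = \<epsilon> * (\<Sum>k\<in>X1. A j k) - \<epsilon> * A i j" if "i \<in> X1" "j \<in> ?X" for i j
    using off_diagonal_const_sum[where A = A and c = \<epsilon> and f = "\<lambda>k. A k j", OF fin(1) that(1)] diag trivial_fibre that
      colsum[of X1 j] by (simp add: C1_def)
  obtain u b v where C1_22: "C1 i j = u + b * A i j + (if i = j then v else 0)"
    if "i \<in> X2" "j \<in> X2" for i j
  proof -
    have "\<exists>u b v. \<forall>i\<in>X2. \<forall>j\<in>X2. C1 i j = u + b * A i j + (if i = j then v else 0)"
      using triv
    proof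
      assume J: "\<forall>i\<in>X1. \<forall>j\<in>X2. A i j = 1"
      have "C1 i j = real (card X1) + 0 * A i j + (if i = j then 0 else 0)"
        if "i \<in> X2" "j \<in> X2" for i j
      proof -
        have "C1 i j = (\<Sum>k\<in>X1. 1)"
          unfolding C1_def
        proof (rule sum.cong[OF refl])
          fix k assume "k \<in> X1"
          then show "A i k * A k j = 1" using sym[of i k] that J by simp
        qed
        then show ?thesis by simp
      qed
      then show ?thesis by (intro exI ballI)
    next
      assume "\<exists>c. \<forall>i\<in>X2. \<forall>j\<in>X2. i \<noteq> j \<longrightarrow> A i j = c"
      then obtain c where c: "\<forall>i\<in>X2. \<forall>j\<in>X2. i \<noteq> j \<longrightarrow> A i j = c" ..
      have "C1 i j = (a2 * a2 - c * k22) + (s + c) * A i j + (if i = j then - p else 0)"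
        if ij: "i \<in> X2" "j \<in> X2" for i j
      proof -
        have "(\<Sum>k\<in>X2. A i k * A k j) = c * k22 - c * A i j"
          using off_diagonal_const_sum[where A = A and c = c and f = "\<lambda>k. A k j", OF fin(2) ij(1)] diag c ij
            colsum[of X2 j] k22[OF ij(2)] by simp
        moreover have "i \<notin> X1" "j \<notin> X1" using ij disj by auto
        ultimately show ?thesis using square[of i j] ij
          by (cases "i = j") (simp_all add: C1_def algebra_simps)
      qed
      then show ?thesis by (intro exI ballI)
    qed
    then obtain u b v where "\<forall>i\<in>X2. \<forall>j\<in>X2. C1 i j = u + b * A i j + (if i = j then v else 0)"
      by (elim exE)
    then show thesis using that[of u b v] by simp
  qed
  have bf1: "block_form ?X ?\<kappa> ?A (\<lambda>i j. complex_of_real (C1 i j))"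
  proof (rule block_formI[where a = "\<lambda>f g. complex_of_real (if f then \<epsilon> * (if g then k11 else k21)
        else if g then \<epsilon> * k21 else u)"
        and b = "\<lambda>f g. complex_of_real (if f \<or> g then - \<epsilon> else b)"
        and c = "\<lambda>f g. complex_of_real (if f then 0 else v)"])
    fix i j assume ij: "i \<in> ?X" "j \<in> ?X"
    have "C1 i j = (if ?\<kappa> i then \<epsilon> * (if ?\<kappa> j then k11 else k21) else if ?\<kappa> j then \<epsilon> * k21 else u)
      + (if ?\<kappa> i \<or> ?\<kappa> j then - \<epsilon> else b) * A i j + (if i = j then (if ?\<kappa> i then 0 else v) else 0)"
    proof (cases "i \<in> X1")
      case True
      then show ?thesis using C1_1[OF True ij(2)] k11[of j] k21[of j] ij by auto
    next
      case i: False
      then have i2: "i \<in> X2" using ij by simp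
      show ?thesis
      proof (cases "j \<in> X1")
        case True
        have "C1 i j = \<epsilon> * k21 - \<epsilon> * A i j"
          using C1_1[OF True ij(1)] C1sym[OF ij] k21[OF i2] sym[OF ij] by simp
        then show ?thesis using i True by auto
      next
        case False
        then have "j \<in> X2" using ij by simp
        then show ?thesis using C1_22[OF i2] i False by simp
      qed
    qed
    then show "complex_of_real (C1 i j) =
       complex_of_real (if ?\<kappa> i then \<epsilon> * (if ?\<kappa> j then k11 else k21) else if ?\<kappa> j then \<epsilon> * k21 else u)
      + complex_of_real (if ?\<kappa> i \<or> ?\<kappa> j then - \<epsilon> else b) * ?A i j
      + (if i = j then complex_of_real (if ?\<kappa> i then 0 else v) else 0)"
      unfolding of_real_mult[symmetric] of_real_add[symmetric] by (cases "i = j") simp_all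
  qed
  have bf2: "block_form ?X ?\<kappa> ?A (\<lambda>i j. complex_of_real (\<Sum>k\<in>X2. A i k * A k j))"
  proof -
    have "block_form ?X ?\<kappa> ?A (\<lambda>i j. complex_of_real
        (s * A i j - (if i = j then p else 0) + (if ?\<kappa> i then a1 else a2) * (if ?\<kappa> j then a1 else a2)))"
      by (rule block_formI[where a = "\<lambda>f g. complex_of_real ((if f then a1 else a2) * (if g then a1 else a2))"
            and b = "\<lambda>_ _. complex_of_real s" and c = "\<lambda>_ _. - complex_of_real p"]) simp
    from block_form_add[OF this block_form_scale[OF bf1, of "\<lambda>_ _. - 1"]]
    show ?thesis
    proof (rule block_form_cong[THEN iffD2, rotated])
      fix i j assume "i \<in> ?X" "j \<in> ?X"
      from square[OF this] have "(\<Sum>k\<in>X2. A i k * A k j) = (s * A i j - (if i = j then p else 0)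
        + (if i \<in> X1 then a1 else a2) * (if j \<in> X1 then a1 else a2)) - C1 i j"
        by (simp add: C1_def algebra_simps)
      then show "complex_of_real (\<Sum>k\<in>X2. A i k * A k j) = complex_of_real
        (s * A i j - (if i = j then p else 0) + (if ?\<kappa> i then a1 else a2) * (if ?\<kappa> j then a1 else a2))
        + - 1 * complex_of_real (C1 i j)"
        by simp
    qed
  qed
  show ?thesis
  proof (rule coherent_algebra_block_form)
    show "finite ?X" using fin by simp
    show "?A i j = 0 \<or> ?A i j = 1" if "i \<in> ?X" "j \<in> ?X" for i j using A01[OF that] by auto
    show "?A i j = ?A j i" if "i \<in> ?X" "j \<in> ?X" for i j using sym[OF that] by simp
    show "?A i i = 0" if "i \<in> ?X" for i using diag[OF that] by simp
  next
    fix h :: bool and i i' assume ii: "i \<in> ?X" "i' \<in> ?X" "?\<kappa> i = ?\<kappa> i'"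
    have "(\<Sum>k\<in>X1. A i k) = (\<Sum>k\<in>X1. A i' k)" "(\<Sum>k\<in>X2. A i k) = (\<Sum>k\<in>X2. A i' k)"
      using ii k11 k12 k21 k22 by (cases "i \<in> X1"; auto)+
    then have "(\<Sum>k\<in>{k \<in> ?X. ?\<kappa> k = h}. A i k) = (\<Sum>k\<in>{k \<in> ?X. ?\<kappa> k = h}. A i' k)"
      using cl by (cases h) simp_all
    then show "(\<Sum>k\<in>{k \<in> ?X. ?\<kappa> k = h}. ?A i k) = (\<Sum>k\<in>{k \<in> ?X. ?\<kappa> k = h}. ?A i' k)"
      by (simp only: of_real_sum[symmetric])
  next
    fix h :: bool
    show "block_form ?X ?\<kappa> ?A (\<lambda>i j. \<Sum>k\<in>{k \<in> ?X. ?\<kappa> k = h}. ?A i k * ?A k j)"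
    proof (cases h)
      case True
      then have "{k \<in> ?X. ?\<kappa> k = h} = X1" using cl by simp
      then show ?thesis using bf1 by (simp add: C1_def)
    next
      case False
      then have "{k \<in> ?X. ?\<kappa> k = h} = X2" using cl by simp
      then show ?thesis using bf2 by simp
    qed
  qed
qed

text \<open>The regular case, where \<open>I\<close>, \<open>A\<close> and \<open>J\<close> span a coherent algebra with a single fibre.\<close>

lemma regular_coherent_algebra:
  fixes A :: "'a \<Rightarrow> 'a \<Rightarrow> real" and s p a :: real
  assumes fin: "finite X"
    and A01: "\<And>i j. i \<in> X \<Longrightarrow> j \<in> X \<Longrightarrow> A i j = 0 \<or> A i j = 1"
    and sym: "\<And>i j. i \<in> X \<Longrightarrow> j \<in> X \<Longrightarrow> A i j = A j i"
    and diag: "\<And>i. i \<in> X \<Longrightarrow> A i i = 0"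
    and square: "\<And>i j. i \<in> X \<Longrightarrow> j \<in> X \<Longrightarrow>
      (\<Sum>k\<in>X. A i k * A k j) = s * A i j - (if i = j then p else 0) + a"
  shows "coherent_algebra X {P \<in> fmats X. block_form X (\<lambda>_. ()) (\<lambda>i j. complex_of_real (A i j)) P}"
proof (rule coherent_algebra_block_form)
  show "finite X" by fact
  show "complex_of_real (A i j) = 0 \<or> complex_of_real (A i j) = 1" if "i \<in> X" "j \<in> X" for i j
    using A01[OF that] by auto
  show "complex_of_real (A i j) = complex_of_real (A j i)" if "i \<in> X" "j \<in> X" for i j
    using sym[OF that] by simp
  show "complex_of_real (A i i) = 0" if "i \<in> X" for i using diag[OF that] by simp
next
  fix h :: unit and i i' assume ii: "i \<in> X" "i' \<in> X"
  have deg: "(\<Sum>k\<in>X. A i k) = a - p" if i: "i \<in> X" for i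
  proof -
    have "(\<Sum>k\<in>X. A i k) = (\<Sum>k\<in>X. A i k * A k i)"
    proof (rule sum.cong[OF refl])
      fix k assume "k \<in> X"
      then show "A i k = A i k * A k i" using A01[of i k] sym[of i k] i by auto
    qed
    then show ?thesis using square[OF i i] diag[OF i] by simp
  qed
  show "(\<Sum>k\<in>{k \<in> X. () = h}. complex_of_real (A i k)) = (\<Sum>k\<in>{k \<in> X. () = h}. complex_of_real (A i' k))"
    using deg[OF ii(1)] deg[OF ii(2)] by (simp only: of_real_sum[symmetric]) simp
next
  fix h :: unit
  show "block_form X (\<lambda>_. ()) (\<lambda>i j. complex_of_real (A i j))
    (\<lambda>i j. \<Sum>k\<in>{k \<in> X. () = h}. complex_of_real (A i k) * complex_of_real (A k j))"
  proof (rule block_formI[where a = "\<lambda>_ _. complex_of_real a"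
        and b = "\<lambda>_ _. complex_of_real s" and c = "\<lambda>_ _. - complex_of_real p"])
    fix i j assume ij: "i \<in> X" "j \<in> X"
    have "(\<Sum>k\<in>{k \<in> X. () = h}. complex_of_real (A i k) * complex_of_real (A k j))
      = complex_of_real (\<Sum>k\<in>X. A i k * A k j)" by simp
    also have "\<dots> = complex_of_real a + complex_of_real s * complex_of_real (A i j)
      + (if i = j then - complex_of_real p else 0)"
      unfolding square[OF ij] by simp
    finally show "(\<Sum>k\<in>{k \<in> X. () = h}. complex_of_real (A i k) * complex_of_real (A k j))
      = complex_of_real a + complex_of_real s * complex_of_real (A i j)
      + (if i = j then - complex_of_real p else 0)" .
  qed
qed

lemma sum_01_card:
  fixes f :: "'a \<Rightarrow> real"
  assumes "finite Y" "\<And>k. k \<in> Y \<Longrightarrow> f k = 0 \<or> f k = 1"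
  shows "(\<Sum>k\<in>Y. f k) = real (card {k \<in> Y. f k = 1})"
proof -
  have "(\<Sum>k\<in>Y. f k) = (\<Sum>k\<in>Y. if f k = 1 then 1 else 0)"
    by (rule sum.cong) (use assms(2) in fastforce)+
  then show ?thesis using assms(1) by (simp add: sum.If_cases Int_def)
qed

text \<open>
  All constants of the two-fibre situation exist because \<open>A\<close> and the matrices counting the walks of
  length two through one fibre belong to the coherent closure. What remains is to exclude the
  degenerate cases, in each of which the closure is contained in a coherent algebra that is too small.
\<close>

lemma two_fibre_structure:
  fixes A :: "'a \<Rightarrow> 'a \<Rightarrow> real" and \<alpha> :: "'a \<Rightarrow> real" and s p :: real
  assumes fin: "finite X" and supp: "\<And>i j. i \<notin> X \<or> j \<notin> X \<Longrightarrow> A i j = 0"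
    and A01: "\<And>i j. A i j = 0 \<or> A i j = 1" and sym: "\<And>i j. A i j = A j i" and diag: "\<And>i. A i i = 0"
    and pos: "\<And>i. i \<in> X \<Longrightarrow> \<alpha> i > 0"
    and square: "\<And>i j. i \<in> X \<Longrightarrow> j \<in> X \<Longrightarrow>
      (\<Sum>k\<in>X. A i k * A k j) = s * A i j - (if i = j then p else 0) + \<alpha> i * \<alpha> j"
    and ty: "has_type X (coherent_closure X (\<lambda>i j. complex_of_real (A i j))) [[2, 2], [2, 3]]"
  shows "\<exists>X1 X2 a1 a2 \<epsilon> (k11 :: nat) (k12 :: nat) (k21 :: nat) (k22 :: nat) (l :: nat) (x :: nat) (y :: nat).
    X = X1 \<union> X2 \<and> a1 > 0 \<and> a2 > 0 \<and> a1 \<noteq> a2 \<and> (\<epsilon> = 0 \<or> \<epsilon> = 1) \<and>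
    (\<forall>i\<in>X1. (\<Sum>j\<in>X1. A i j) = real k11) \<and>
    two_fibre_graph X1 X2 A s p a1 a2 \<epsilon> k12 k21 k22 l x y"
proof -
  let ?A = "\<lambda>i j. complex_of_real (A i j)"
  define W where "W = coherent_closure X ?A"
  have AX: "?A \<in> fmats X" using supp by (auto simp: fmats_def)
  have coh: "coherent_algebra X W" unfolding W_def by (rule coherent_algebra_closure[OF fin AX])
  have AW: "?A \<in> W" unfolding W_def by (rule coherent_closure_contains)
  obtain X1 X2 P S where X: "X = X1 \<union> X2" and disj: "X1 \<inter> X2 = {}" and ne: "X1 \<noteq> {}" "X2 \<noteq> {}"
    and idW: "fmat_id X1 \<in> W" "fmat_id X2 \<in> W" and PSW: "P \<in> W" "S \<in> W"
    and two: "\<exists>i\<in>X1. \<exists>j\<in>X1. i \<noteq> j"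
    and const1: "\<forall>Y\<in>W. \<exists>a b. \<forall>i\<in>X1. \<forall>j\<in>X1. Y i j = (if i = j then a else b)"
    and const2: "\<forall>Y\<in>W. \<exists>a b c. \<forall>i\<in>X2. \<forall>j\<in>X2. Y i j = (if i = j then a else if S i j = 1 then b else c)"
    and P: "\<exists>i\<in>X1. \<exists>j\<in>X2. P i j = 1" "\<exists>i\<in>X1. \<exists>j\<in>X2. P i j \<noteq> 1"
    and S: "\<exists>i\<in>X2. \<exists>j\<in>X2. i \<noteq> j \<and> S i j = 1" "\<exists>i\<in>X2. \<exists>j\<in>X2. i \<noteq> j \<and> S i j \<noteq> 1"
    by (rule type_2_2_3_blocks[OF coh ty[folded W_def]])
  have fin12: "finite X1" "finite X2" using fin X by auto
  have rconst1: "\<exists>a b. \<forall>i\<in>X1. \<forall>j\<in>X1. F i j = (if i = j then a else b)"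
    if "(\<lambda>i j. complex_of_real (F i j)) \<in> W" for F
  proof -
    from const1[rule_format, OF that] obtain a b where
      "\<forall>i\<in>X1. \<forall>j\<in>X1. complex_of_real (F i j) = (if i = j then a else b)" by (elim exE)
    then have "\<forall>i\<in>X1. \<forall>j\<in>X1. F i j = (if i = j then Re a else Re b)"
      by (metis Re_complex_of_real)
    then show ?thesis by (intro exI)
  qed
  have rconst2: "\<exists>a b c. \<forall>i\<in>X2. \<forall>j\<in>X2. F i j = (if i = j then a else if S i j = 1 then b else c)"
    if "(\<lambda>i j. complex_of_real (F i j)) \<in> W" for F
  proof -
    from const2[rule_format, OF that] obtain a b c where
      "\<forall>i\<in>X2. \<forall>j\<in>X2. complex_of_real (F i j) = (if i = j then a else if S i j = 1 then b else c)"
      by (elim exE)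
    then have "\<forall>i\<in>X2. \<forall>j\<in>X2. F i j = (if i = j then Re a else if S i j = 1 then Re b else Re c)"
      by (metis Re_complex_of_real)
    then show ?thesis by (intro exI)
  qed
  \<comment> \<open>The number of walks of length two from \<open>i\<close> to \<open>j\<close> with middle vertex in \<open>Y\<close>.\<close>
  define C where "C Y i j = (\<Sum>k\<in>Y. A i k * A k j)" for Y i j
  have CW: "(\<lambda>i j. complex_of_real (C Y i j)) \<in> W" if Y: "Y \<subseteq> X" "fmat_id Y \<in> W" for Y
  proof -
    have "fmat_mult X ?A (fmat_mult X (fmat_id Y) ?A) = (\<lambda>i j. complex_of_real (C Y i j))"
    proof (intro ext)
      fix i j
      have "fmat_mult X (fmat_id Y) ?A k j = (if k \<in> Y then ?A k j else 0)" for k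
      proof -
        have "fmat_mult X (fmat_id Y) ?A k j = (\<Sum>m\<in>X. if k = m then (if k \<in> Y then ?A k j else 0) else 0)"
          unfolding fmat_mult_def by (rule sum.cong) (auto simp: fmat_id_def)
        then show ?thesis using fin Y(1) by auto
      qed
      then have "fmat_mult X ?A (fmat_mult X (fmat_id Y) ?A) i j
          = (\<Sum>k\<in>X. if k \<in> Y then ?A i k * ?A k j else 0)"
        unfolding fmat_mult_def[of X ?A "fmat_mult X (fmat_id Y) ?A"] by (intro sum.cong) auto
      also have "\<dots> = (\<Sum>k\<in>Y. ?A i k * ?A k j)"
        using fin Y(1) by (simp add: sum.If_cases Int_absorb1)
      finally show "fmat_mult X ?A (fmat_mult X (fmat_id Y) ?A) i j = complex_of_real (C Y i j)"
        by (simp add: C_def)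
    qed
    then show ?thesis using coherent_algebraD(5)[OF coh AW coherent_algebraD(5)[OF coh Y(2) AW]] by simp
  qed
  have Cdiag: "C Y i i = (\<Sum>k\<in>Y. A i k)" for Y i
    unfolding C_def
  proof (rule sum.cong[OF refl])
    fix k show "A i k * A k i = A i k" using A01[of i k] sym[of k i] by auto
  qed
  have Cnat: "\<exists>m. C Y i j = real m" if "finite Y" for Y i j
  proof -
    have "A i k * A k j = 0 \<or> A i k * A k j = 1" for k using A01[of i k] A01[of k j] by auto
    then have "C Y i j = real (card {k \<in> Y. A i k * A k j = 1})"
      unfolding C_def using sum_01_card[OF that, of "\<lambda>k. A i k * A k j"] by simp
    then show ?thesis by (rule exI)
  qed
  have C1W: "(\<lambda>i j. complex_of_real (C X1 i j)) \<in> W" and C2W: "(\<lambda>i j. complex_of_real (C X2 i j)) \<in> W"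
    by (rule CW; use X idW in simp)+
  obtain e0 \<epsilon> where A1: "\<forall>i\<in>X1. \<forall>j\<in>X1. A i j = (if i = j then e0 else \<epsilon>)"
    using rconst1[OF AW] by (elim exE)
  obtain d11 l11 where C11: "\<forall>i\<in>X1. \<forall>j\<in>X1. C X1 i j = (if i = j then d11 else l11)"
    using rconst1[OF C1W] by (elim exE)
  obtain d12 l12 where C12: "\<forall>i\<in>X1. \<forall>j\<in>X1. C X2 i j = (if i = j then d12 else l12)"
    using rconst1[OF C2W] by (elim exE)
  obtain g0 g1 g2 where A2: "\<forall>i\<in>X2. \<forall>j\<in>X2. A i j = (if i = j then g0 else if S i j = 1 then g1 else g2)"
    using rconst2[OF AW] by (elim exE)
  obtain d21 x1 x2 where C21: "\<forall>i\<in>X2. \<forall>j\<in>X2. C X1 i j = (if i = j then d21 else if S i j = 1 then x1 else x2)"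
    using rconst2[OF C1W] by (elim exE)
  obtain d22 z1 z2 where C22: "\<forall>i\<in>X2. \<forall>j\<in>X2. C X2 i j = (if i = j then d22 else if S i j = 1 then z1 else z2)"
    using rconst2[OF C2W] by (elim exE)
  have sqX: "C X1 i j + C X2 i j = s * A i j - (if i = j then p else 0) + \<alpha> i * \<alpha> j"
    if "i \<in> X" "j \<in> X" for i j
    using square[OF that] unfolding C_def X by (simp add: sum.union_disjoint[OF fin12 disj])
  define a1 where "a1 = sqrt (d11 + d12 + p)"
  define a2 where "a2 = sqrt (d21 + d22 + p)"
  have al1: "\<alpha> i = a1" if "i \<in> X1" for i
  proof -
    have "\<alpha> i * \<alpha> i = d11 + d12 + p" using sqX[of i i] C11 C12 that diag[of i] X by simp
    then have "\<bar>\<alpha> i\<bar> = a1" unfolding a1_def by (metis real_sqrt_abs2)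
    then show ?thesis using pos[of i] that X by simp
  qed
  have al2: "\<alpha> i = a2" if "i \<in> X2" for i
  proof -
    have "\<alpha> i * \<alpha> i = d21 + d22 + p" using sqX[of i i] C21 C22 that diag[of i] X by simp
    then have "\<bar>\<alpha> i\<bar> = a2" unfolding a2_def by (metis real_sqrt_abs2)
    then show ?thesis using pos[of i] that X by simp
  qed
  have apos: "a1 > 0" "a2 > 0" using ne pos al1 al2 X by (metis UnI1 ex_in_conv, metis UnI2 ex_in_conv)
  have sq: "C X1 i j + C X2 i j = s * A i j - (if i = j then p else 0)
        + (if i \<in> X1 then a1 else a2) * (if j \<in> X1 then a1 else a2)"
    if "i \<in> X1 \<union> X2" "j \<in> X1 \<union> X2" for i j
  proof -
    have "\<alpha> i = (if i \<in> X1 then a1 else a2)" "\<alpha> j = (if j \<in> X1 then a1 else a2)"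
      using that al1 al2 by auto
    then show ?thesis using sqX[of i j] that X by simp
  qed
  obtain i1 where i1: "i1 \<in> X1" using ne by blast
  obtain i2 where i2: "i2 \<in> X2" using ne by blast
  have i12: "i1 \<notin> X2" "i2 \<notin> X1" using i1 i2 disj by auto
  have a_ne: "a1 \<noteq> a2"
  proof
    assume eq: "a1 = a2"
    have "coherent_algebra X {P \<in> fmats X. block_form X (\<lambda>_. ()) ?A P}"
    proof (rule regular_coherent_algebra)
      fix i j assume ij: "i \<in> X" "j \<in> X"
      then have "\<alpha> i = a1" "\<alpha> j = a1" using al1 al2 eq X by auto
      then show "(\<Sum>k\<in>X. A i k * A k j) = s * A i j - (if i = j then p else 0) + a1 * a1"
        using square[OF ij] by simp
    qed (use fin A01 sym diag in auto)
    from coherent_closure_least[OF this, of ?A] AX block_form_self[of X "\<lambda>_. ()" ?A]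
    have "W \<subseteq> {P \<in> fmats X. block_form X (\<lambda>_. ()) ?A P}" unfolding W_def by simp
    then have "block_form X (\<lambda>_. ()) ?A (fmat_id X1)" using idW by auto
    then obtain a b c where "\<forall>i\<in>X. \<forall>j\<in>X. fmat_id X1 i j
        = a () () + b () () * ?A i j + (if i = j then c () () else 0)"
      by (rule block_formE)
    from this[rule_format, of i1 i1] this[rule_format, of i2 i2] show False
      using i1 i2 i12 X diag by (simp add: fmat_id_def)
  qed
  have k11: "(\<Sum>k\<in>X1. A i k) = d11" and k12: "(\<Sum>k\<in>X2. A i k) = d12" if "i \<in> X1" for i
    using C11 C12 that by (simp_all add: Cdiag[symmetric])
  have k21: "(\<Sum>k\<in>X1. A i k) = d21" and k22: "(\<Sum>k\<in>X2. A i k) = d22" if "i \<in> X2" for i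
    using C21 C22 that by (simp_all add: Cdiag[symmetric])
  have eps: "A i j = \<epsilon>" if "i \<in> X1" "j \<in> X1" "i \<noteq> j" for i j using A1 that by simp
  have nontriv: "\<not> ((\<forall>i\<in>X1. \<forall>j\<in>X2. A i j = 1) \<or> (\<exists>c. \<forall>i\<in>X2. \<forall>j\<in>X2. i \<noteq> j \<longrightarrow> A i j = c))"
  proof
    assume triv: "(\<forall>i\<in>X1. \<forall>j\<in>X2. A i j = 1) \<or> (\<exists>c. \<forall>i\<in>X2. \<forall>j\<in>X2. i \<noteq> j \<longrightarrow> A i j = c)"
    let ?bf = "block_form X (\<lambda>i. i \<in> X1) ?A"
    have "coherent_algebra X {P \<in> fmats X. ?bf P}"
      unfolding X
      by (rule two_fibre_coherent_algebra[OF fin12 disj A01 sym diag sq[unfolded C_def] eps k11 k12 k21 k22 triv])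
    from coherent_closure_least[OF this, of ?A] AX block_form_self[of X "\<lambda>i. i \<in> X1" ?A]
    have sub: "W \<subseteq> {P \<in> fmats X. ?bf P}" unfolding W_def by simp
    show False
      using triv
    proof
      assume J: "\<forall>i\<in>X1. \<forall>j\<in>X2. A i j = 1"
      have "?bf P" using sub PSW by auto
      then obtain a b c where "\<forall>i\<in>X. \<forall>j\<in>X. P i j = a (i \<in> X1) (j \<in> X1) + b (i \<in> X1) (j \<in> X1) * ?A i j
          + (if i = j then c (i \<in> X1) (j \<in> X1) else 0)"
        by (rule block_formE)
      note f = this[rule_format]
      have "P i j = a True False + b True False" if "i \<in> X1" "j \<in> X2" for i j
      proof -
        have "j \<notin> X1" "i \<noteq> j" using that disj by auto
        then show ?thesis using f[of i j] that J X by simp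
      qed
      then show False using P by auto
    next
      assume "\<exists>c. \<forall>i\<in>X2. \<forall>j\<in>X2. i \<noteq> j \<longrightarrow> A i j = c"
      then obtain g where g: "\<forall>i\<in>X2. \<forall>j\<in>X2. i \<noteq> j \<longrightarrow> A i j = g" ..
      have "?bf S" using sub PSW by auto
      then obtain a b c where "\<forall>i\<in>X. \<forall>j\<in>X. S i j = a (i \<in> X1) (j \<in> X1) + b (i \<in> X1) (j \<in> X1) * ?A i j
          + (if i = j then c (i \<in> X1) (j \<in> X1) else 0)"
        by (rule block_formE)
      note f = this[rule_format]
      have "S i j = a False False + b False False * complex_of_real g"
        if "i \<in> X2" "j \<in> X2" "i \<noteq> j" for i j
      proof -
        have "i \<notin> X1" "j \<notin> X1" using that disj by auto
        then show ?thesis using f[of i j] that g X by simp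
      qed
      then show False using S by auto
    qed
  qed
  \<comment> \<open>If \<open>M = 0\<close>, the block of \<open>A\<^sup>2\<close> between the fibres vanishes, but it equals \<open>a1 a2 J\<close>.\<close>
  have M1: "\<exists>i\<in>X1. \<exists>j\<in>X2. A i j = 1"
  proof (rule ccontr)
    assume "\<not> ?thesis"
    then have z: "A i j = 0" if "i \<in> X1" "j \<in> X2" for i j using A01[of i j] that by blast
    have "C X1 i1 i2 = 0" "C X2 i1 i2 = 0" using z i1 i2 by (simp_all add: C_def)
    then have "a1 * a2 = 0" using sq[of i1 i2] i1 i2 i12 z[OF i1 i2] by auto
    then show False using apos by simp
  qed
  have M0: "\<exists>i\<in>X1. \<exists>j\<in>X2. A i j = 0" using nontriv A01 by blast
  have N1: "\<exists>i\<in>X2. \<exists>j\<in>X2. i \<noteq> j \<and> A i j = 1" and N0: "\<exists>i\<in>X2. \<exists>j\<in>X2. i \<noteq> j \<and> A i j = 0"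
    using nontriv A01 by meson+
  have g_ne: "g1 \<noteq> g2"
  proof
    assume "g1 = g2"
    then have "\<forall>i\<in>X2. \<forall>j\<in>X2. i \<noteq> j \<longrightarrow> A i j = g1" using A2 by simp
    then show False using nontriv by blast
  qed
  have g01: "g1 = 0 \<or> g1 = 1" "g2 = 0 \<or> g2 = 1" using S A2 A01 by metis+
  \<comment> \<open>\<open>N\<close> agrees off the diagonal with \<open>S\<close> or with its complement.\<close>
  define x where "x = (if g1 = 1 then x1 else x2)"
  define y where "y = (if g1 = 1 then x2 else x1)"
  have xy: "C X1 i j = (if A i j = 1 then x else y)" if "i \<in> X2" "j \<in> X2" "i \<noteq> j" for i j
    using C21 A2 that g_ne g01 by (auto simp: x_def y_def)
  obtain m11 where m11: "d11 = real m11" using Cnat[OF fin12(1), of i1 i1] C11 i1 by auto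
  obtain m12 where m12: "d12 = real m12" using Cnat[OF fin12(2), of i1 i1] C12 i1 by auto
  obtain m21 where m21: "d21 = real m21" using Cnat[OF fin12(1), of i2 i2] C21 i2 by auto
  obtain m22 where m22: "d22 = real m22" using Cnat[OF fin12(2), of i2 i2] C22 i2 by auto
  obtain l where l: "l12 = real l"
  proof -
    obtain i j where "i \<in> X1" "j \<in> X1" "i \<noteq> j" using two by blast
    then show thesis using Cnat[OF fin12(2), of i j] C12 that by auto
  qed
  obtain mx where mx: "x = real mx"
  proof -
    obtain i j where "i \<in> X2" "j \<in> X2" "i \<noteq> j" "A i j = 1" using N1 by blast
    then show thesis using Cnat[OF fin12(1), of i j] xy[of i j] that by auto
  qed
  obtain my where my: "y = real my"
  proof -
    obtain i j where "i \<in> X2" "j \<in> X2" "i \<noteq> j" "A i j = 0" using N0 by blast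
    then show thesis using Cnat[OF fin12(1), of i j] xy[of i j] that by auto
  qed
  have eps01: "\<epsilon> = 0 \<or> \<epsilon> = 1" using two eps A01 by metis
  have "two_fibre_graph X1 X2 A s p a1 a2 \<epsilon> m12 m21 m22 l mx my"
  proof
    show "(\<Sum>i\<in>X1. A i j) = real m21" if "j \<in> X2" for j
      using k21[OF that] m21 sym[of j] by simp
    show "(\<Sum>i\<in>X2. A i j) = real m22" if "j \<in> X2" for j
      using k22[OF that] m22 sym[of j] by simp
    show "(\<Sum>k\<in>X2. A i k * A k j) = real l" if "i \<in> X1" "j \<in> X1" "i \<noteq> j" for i j
      using C12 that l by (simp add: C_def)
    show "(\<Sum>k\<in>X1. A i k * A k j) = (if A i j = 1 then real mx else real my)"
      if "i \<in> X2" "j \<in> X2" "i \<noteq> j" for i j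
      using xy[OF that] mx my by (simp add: C_def)
  qed (use fin12 disj A01 sym diag sq[unfolded C_def] eps k12 m12 two M1 M0 N1 N0 in auto)
  moreover have "\<forall>i\<in>X1. (\<Sum>j\<in>X1. A i j) = real m11" using k11 m11 by simp
  ultimately show ?thesis using X apos a_ne eps01 by blast
qed

section \<open>The theorem\<close>

lemma adj_matrix_with_proj:
  assumes "pair_graph G"
  shows "adj_matrix (with_proj G) i j = (if (i, j) \<in> parcs G then 1 else 0)"
proof -
  interpret pair_graph G by fact
  show ?thesis using in_arcsD1 in_arcsD2 by (auto simp: adj_matrix_def)
qed

lemma out_degree_with_proj:
  assumes "pair_graph G"
  shows "real (out_degree (with_proj G) i) = (\<Sum>j\<in>pverts G. adj_matrix (with_proj G) i j)"
proof -
  interpret pair_graph G by fact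
  have "out_arcs (with_proj G) i = Pair i ` {j \<in> pverts G. (i, j) \<in> parcs G}"
    using in_arcsD2 by (auto simp: out_arcs_def)
  then have "out_degree (with_proj G) i = card {j \<in> pverts G. (i, j) \<in> parcs G}"
    by (simp add: out_degree_def card_image inj_on_def)
  then show ?thesis
    using pair_finite_verts by (simp add: adj_matrix_with_proj[OF assms] sum.If_cases Int_def)
qed

text \<open>Connectedness in the form used by the Perron--Frobenius argument.\<close>

lemma connected_closed_set:
  assumes G: "pair_graph G" and conn: "Digraph_Component.connected (with_proj G)"
    and Z: "Z \<subseteq> pverts G" "Z \<noteq> {}" "\<And>i j. i \<in> Z \<Longrightarrow> (i, j) \<in> parcs G \<Longrightarrow> j \<in> Z"
  shows "Z = pverts G"
proof -
  interpret pair_graph G by fact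
  have eq: "parcs (mk_symmetric (with_proj G)) = parcs G"
    using adj_mk_symmetric_eq[OF pair_sym_arcs] by simp
  obtain z where z: "z \<in> Z" using Z(2) by blast
  have "v \<in> Z" if v: "v \<in> pverts G" for v
  proof -
    have "z \<rightarrow>\<^sup>*\<^bsub>with_proj (mk_symmetric (with_proj G))\<^esub> v"
      using conn z v Z(1) unfolding Digraph_Component.connected_def strongly_connected_def by auto
    then have "(z, v) \<in> rtrancl_on (pverts G) (parcs G)" by (simp add: reachable_def eq)
    then show ?thesis by (induction rule: rtrancl_on_induct) (use z Z(3) in auto)
  qed
  then show ?thesis using Z(1) by blast
qed

theorem theorem5p7:
  fixes \<Gamma> :: "'a pair_pre_digraph" and \<theta>0 \<theta>1 \<theta>2 :: real
  assumes "\<Gamma> \<in> G3 \<theta>0 \<theta>1 \<theta>2"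
    and "has_type (pverts \<Gamma>)
           (coherent_closure (pverts \<Gamma>) (adj_matrix (with_proj \<Gamma>)))
           [[2, 2], [2, 3]]"
  shows "\<exists>(V1 :: 'a set) (V2 :: 'a set) (k1 :: nat) (k2 :: nat)
            (k11 :: nat) (k12 :: nat) (k21 :: nat) (k22 :: nat) (n1 :: nat) (n2 :: nat)
            (\<epsilon> :: real) (M :: 'a \<Rightarrow> 'a \<Rightarrow> real) (Q :: ('a, 'a) design)
            (l :: nat) (x :: nat) (y :: nat).
      biregular (with_proj \<Gamma>) \<and> k1 \<noteq> k2 \<and>
      V1 = degree_class (with_proj \<Gamma>) k1 \<and> V2 = degree_class (with_proj \<Gamma>) k2 \<and>
      valency_partition (with_proj \<Gamma>) = {V1, V2} \<and>
      equitable (with_proj \<Gamma>) [V1, V2] [[k11, k12], [k21, k22]] \<and>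
      card V1 = n1 \<and> card V2 = n2 \<and>
      \<epsilon> \<in> {0, 1} \<and>
      adj_matrix (with_proj \<Gamma>) =
        block_fmat V1 V2
          (\<lambda>i j. \<epsilon> * (fmat_ones V1 i j - fmat_id V1 i j)) M
          (fmat_transpose M) (adj_matrix (with_proj \<Gamma> \<restriction> V2)) \<and>
      points Q = V1 \<and> block_ids Q = V2 \<and> M = incidence_matrix Q \<and>
      QSD Q n1 k21 l n2 k12 x y \<and>
      with_proj \<Gamma> \<restriction> V2 = with_proj (block_graph x Q) \<and>
      (\<forall>e1 e2 :: real.
        e1 > e2 \<and> restricted_eigenvalues (with_proj (block_graph x Q)) = {e1, e2} \<longrightarrow>
          ((\<theta>1 = e1 \<and> e1 = (real y - real k21) / (real x - real y)) \<or>
           (\<theta>2 = e2 \<and> e2 = (real y - real k21) / (real x - real y))) \<and>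
          real x = real k21 + (\<theta>1 + 1) * (\<theta>2 + 1) - (e1 + 1) * (e2 + 1) \<and>
          real y = real k21 + \<theta>1 * \<theta>2 - e1 * e2 \<and>
          (empty_graph (with_proj \<Gamma> \<restriction> V1) \<longrightarrow>
             real l - real k12 = \<theta>1 * \<theta>2 \<and>
             (real k12 - real l + real y - real k21) / (real x - real y) = \<theta>1 + \<theta>2 \<and>
             sqrt ((real k1 + \<theta>1 * \<theta>2) * (real k2 + \<theta>1 * \<theta>2)) =
               (real l * real k21 - real y * real k12) / (real x - real y)) \<and>
          (complete_graph (with_proj \<Gamma> \<restriction> V1) \<longrightarrow>
             real l - real k12 = (\<theta>1 + 1) * (\<theta>2 + 1) \<and>
             (real k12 - real l + real y - real k21) / (real x - real y) = \<theta>1 + \<theta>2 + 1 \<and>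
             sqrt ((real k1 + \<theta>1 * \<theta>2) * (real k2 + \<theta>1 * \<theta>2)) =
               real k21 + (real l * real k21 - real y * real k12) / (real x - real y)))"
proof -
  let ?G = "with_proj \<Gamma>"
  define X where "X = pverts \<Gamma>"
  define A :: "'a \<Rightarrow> 'a \<Rightarrow> real" where "A = adj_matrix ?G"
  define s where "s = \<theta>1 + \<theta>2"
  define p where "p = \<theta>1 * \<theta>2"
  have pg: "pair_graph \<Gamma>" and conn: "Digraph_Component.connected ?G"
    and less: "\<theta>1 < \<theta>0" "\<theta>2 < \<theta>1" and ev: "graph_eigenvalues ?G = {\<theta>0, \<theta>1, \<theta>2}"
    using assms(1) by (auto simp: G3_def)
  interpret G: pair_graph \<Gamma> by (rule pg)
  have A_eq: "A i j = (if (i, j) \<in> parcs \<Gamma> then 1 else 0)" for i j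
    unfolding A_def by (rule adj_matrix_with_proj[OF pg])
  have sympar: "(i, j) \<in> parcs \<Gamma> \<longleftrightarrow> (j, i) \<in> parcs \<Gamma>" for i j
    using arcs_ends_symmetric[OF G.pair_sym_arcs] by auto
  have fin: "finite X" unfolding X_def by (rule G.pair_finite_verts)
  have supp: "A i j = 0" if "i \<notin> X \<or> j \<notin> X" for i j
    using that G.in_arcsD1 G.in_arcsD2 unfolding A_eq X_def by auto
  have A01: "A i j = 0 \<or> A i j = 1" for i j by (simp add: A_eq)
  have sym: "A i j = A j i" for i j using sympar[of i j] by (simp add: A_eq)
  have diag: "A i i = 0" for i using G.pair_no_loops[of "(i, i)"] by (auto simp: A_eq)
  have "\<exists>\<alpha>. (\<forall>i\<in>X. \<alpha> i > 0) \<and>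
    (\<forall>i\<in>X. \<forall>j\<in>X. (\<Sum>k\<in>X. A i k * A k j) = (\<theta>1 + \<theta>2) * A i j - (if i = j then \<theta>1 * \<theta>2 else 0) + \<alpha> i * \<alpha> j)"
  proof (rule three_eigenvalues_rank_one[OF fin sym _ _ _ less(2,1)])
    show "0 \<le> A i j" for i j using A01[of i j] by auto
    show "Z = X" if Z: "Z \<subseteq> X" "Z \<noteq> {}" "\<And>i j. i \<in> Z \<Longrightarrow> j \<in> X \<Longrightarrow> A i j \<noteq> 0 \<Longrightarrow> j \<in> Z" for Z
      unfolding X_def
    proof (rule connected_closed_set[OF pg conn])
      show "Z \<subseteq> pverts \<Gamma>" "Z \<noteq> {}" using Z by (simp_all add: X_def)
      fix i j assume ij: "i \<in> Z" "(i, j) \<in> parcs \<Gamma>"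
      then show "j \<in> Z" using Z(3)[of i j] G.in_arcsD2[OF ij(2)] by (simp add: A_eq X_def)
    qed
    fix \<theta>
    have "\<theta> \<in> {\<theta>0, \<theta>1, \<theta>2} \<longleftrightarrow> \<theta> \<in> graph_eigenvalues ?G" using ev by simp
    then show "(\<exists>u. (\<exists>i\<in>X. u i \<noteq> 0) \<and> (\<forall>i\<in>X. fmat_apply X A u i = \<theta> * u i)) \<longleftrightarrow> \<theta> \<in> {\<theta>0, \<theta>1, \<theta>2}"
      by (simp add: graph_eigenvalues_def graph_eigenvector_def fmat_apply_def X_def A_def)
  qed
  then obtain \<alpha> where pos: "\<forall>i\<in>X. \<alpha> i > 0"
    and square: "\<forall>i\<in>X. \<forall>j\<in>X. (\<Sum>k\<in>X. A i k * A k j) = s * A i j - (if i = j then p else 0) + \<alpha> i * \<alpha> j"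
    unfolding s_def p_def by (elim exE conjE)
  have "(adj_matrix ?G :: 'a \<Rightarrow> 'a \<Rightarrow> complex) = (\<lambda>i j. complex_of_real (A i j))"
    by (intro ext) (simp add: A_eq adj_matrix_with_proj[OF pg])
  then have ty: "has_type X (coherent_closure X (\<lambda>i j. complex_of_real (A i j))) [[2, 2], [2, 3]]"
    using assms(2) by (simp add: X_def)
  have "\<exists>X1 X2 a1 a2 \<epsilon> (k11 :: nat) (k12 :: nat) (k21 :: nat) (k22 :: nat) (l :: nat) (x :: nat) (y :: nat).
    X = X1 \<union> X2 \<and> a1 > 0 \<and> a2 > 0 \<and> a1 \<noteq> a2 \<and> (\<epsilon> = 0 \<or> \<epsilon> = 1) \<and>
    (\<forall>i\<in>X1. (\<Sum>j\<in>X1. A i j) = real k11) \<and>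
    two_fibre_graph X1 X2 A s p a1 a2 \<epsilon> k12 k21 k22 l x y"
    by (rule two_fibre_structure[OF fin supp A01 sym diag _ _ ty]) (use pos square in auto)
  then obtain X1 X2 a1 a2 \<epsilon> and k11 k12 k21 k22 l x y :: nat
    where X: "X = X1 \<union> X2" and apos: "a1 > 0" "a2 > 0" and a_ne: "a1 \<noteq> a2"
      and eps: "\<epsilon> = 0 \<or> \<epsilon> = 1" and k11: "\<forall>i\<in>X1. (\<Sum>j\<in>X1. A i j) = real k11"
      and tf: "two_fibre_graph X1 X2 A s p a1 a2 \<epsilon> k12 k21 k22 l x y"
    by (elim exE conjE)
  interpret F: two_fibre_graph X1 X2 A s p a1 a2 \<epsilon> k12 k21 k22 l x y by (rule tf)
  note disj = F.disj
  have ne: "X1 \<noteq> {}" "X2 \<noteq> {}" using F.M_nontrivial by auto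
  have xy: "x \<noteq> y" using F.intersection_numbers_distinct by simp
  define k1 where "k1 = k11 + k12"
  define k2 where "k2 = k21 + k22"
  have rowcount: "real (card {w \<in> Y. (v, w) \<in> parcs \<Gamma>}) = (\<Sum>w\<in>Y. A v w)" if "finite Y" for v Y
    using that by (simp add: A_eq sum.If_cases Int_def)
  have c11: "card {w \<in> X1. (v, w) \<in> parcs \<Gamma>} = k11" and c12: "card {w \<in> X2. (v, w) \<in> parcs \<Gamma>} = k12"
    if "v \<in> X1" for v
    using rowcount[OF F.fin(1), of v] rowcount[OF F.fin(2), of v] k11 F.rows that by simp_all
  have c21: "card {w \<in> X1. (v, w) \<in> parcs \<Gamma>} = k21" and c22: "card {w \<in> X2. (v, w) \<in> parcs \<Gamma>} = k22"
    if "v \<in> X2" for v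
    using rowcount[OF F.fin(1), of v] rowcount[OF F.fin(2), of v] F.columns[OF that] F.degrees2[OF that]
      sym[of v] by simp_all
  have degX: "real (out_degree ?G i) = (\<Sum>j\<in>X1. A i j) + (\<Sum>j\<in>X2. A i j)" for i
    unfolding out_degree_with_proj[OF pg] A_def[symmetric] X_def[symmetric] X
    by (rule sum.union_disjoint[OF F.fin disj])
  have deg1: "out_degree ?G i = k1" if "i \<in> X1" for i
    using degX[of i] k11 F.rows that by (simp add: k1_def)
  have deg2: "out_degree ?G i = k2" if "i \<in> X2" for i
    using degX[of i] F.columns[OF that] F.degrees2[OF that] sym[of i] by (simp add: k2_def)
  have Cdiag: "(\<Sum>k\<in>Y. A i k * A k i) = (\<Sum>k\<in>Y. A i k)" for Y i
  proof (rule sum.cong[OF refl])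
    fix k show "A i k * A k i = A i k" using A01[of i k] sym[of k i] by auto
  qed
  have a1: "a1\<^sup>2 = real k1 + p"
  proof -
    obtain i where i: "i \<in> X1" using ne by blast
    then show ?thesis using F.square[of i i] degX[of i] deg1[OF i] diag[of i]
      by (simp add: Cdiag power2_eq_square)
  qed
  have a2: "a2\<^sup>2 = real k2 + p"
  proof -
    obtain i where i: "i \<in> X2" using ne by blast
    then have "i \<notin> X1" using disj by auto
    then show ?thesis using F.square[of i i] degX[of i] deg2[OF i] diag[of i] i
      by (simp add: Cdiag power2_eq_square)
  qed
  have k_ne: "k1 \<noteq> k2"
  proof
    assume "k1 = k2"
    then have "a1\<^sup>2 = a2\<^sup>2" using a1 a2 by simp
    then show False using apos a_ne by (simp add: power2_eq_iff)
  qed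
  have V1: "X1 = degree_class ?G k1" and V2: "X2 = degree_class ?G k2"
    using deg1 deg2 k_ne disj X by (auto simp: degree_class_def X_def[symmetric])
  have degs: "out_degree ?G ` verts ?G = {k1, k2}"
    using deg1 deg2 ne X by (force simp: X_def[symmetric])
  have bireg: "biregular ?G" unfolding biregular_def degs using k_ne by simp
  have val: "valency_partition ?G = {X1, X2}" unfolding valency_partition_def degs using V1 V2 by simp
  have equi: "equitable ?G [X1, X2] [[k11, k12], [k21, k22]]"
    unfolding equitable_def
  proof (intro conjI allI impI ballI)
    show "distinct [X1, X2]" using disj ne by auto
    show "partition_on (verts ?G) (set [X1, X2])"
      using disj ne X by (auto simp: partition_on_def disjoint_def X_def[symmetric])
    fix i j v assume "i < length [X1, X2]" "j < length [X1, X2]" "v \<in> [X1, X2] ! i"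
    then show "card {w \<in> [X1, X2] ! j. v \<rightarrow>\<^bsub>?G\<^esub> w} = [[k11, k12], [k21, k22]] ! i ! j"
      using c11[of v] c12[of v] c21[of v] c22[of v] by (auto simp: less_Suc_eq)
  qed
  \<comment> \<open>The block of a vertex of the second fibre is its neighbourhood in the first fibre.\<close>
  define Q :: "('a, 'a) design"
    where "Q = \<lparr> points = X1, block_ids = X2, block = (\<lambda>j. {i \<in> X1. (i, j) \<in> parcs \<Gamma>}) \<rparr>"
  have Q: "points Q = X1" "block_ids Q = X2" "block Q = (\<lambda>j. {i \<in> X1. (i, j) \<in> parcs \<Gamma>})"
    by (simp_all add: Q_def)
  have adjV2: "adj_matrix (?G \<restriction> X2) i j = A i j" if "i \<in> X2" "j \<in> X2" for i j
    using that by (auto simp: adj_matrix_def A_eq arcs_ends_conv image_iff)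
  have blocks: "adj_matrix ?G = block_fmat X1 X2
      (\<lambda>i j. \<epsilon> * (fmat_ones X1 i j - fmat_id X1 i j)) (incidence_matrix Q)
      (fmat_transpose (incidence_matrix Q)) (adj_matrix (?G \<restriction> X2))"
  proof (intro ext)
    fix i j
    have "A i j = block_fmat X1 X2
      (\<lambda>i j. \<epsilon> * (fmat_ones X1 i j - fmat_id X1 i j)) (incidence_matrix Q)
      (fmat_transpose (incidence_matrix Q)) (adj_matrix (?G \<restriction> X2)) i j"
    proof (cases "i \<in> X \<and> j \<in> X")
      case False
      then show ?thesis using supp X by (auto simp: block_fmat_def)
    next
      case True
      have inc: "incidence_matrix Q i j = A i j" if "i \<in> X1" "j \<in> X2" for i j
        using that by (simp add: incidence_matrix_def Q A_eq)
      have "\<epsilon> * (fmat_ones X1 i j - fmat_id X1 i j) = A i j" if "i \<in> X1" "j \<in> X1"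
        using that F.trivial_fibre[of i j] diag by (simp add: fmat_ones_def fmat_id_def)
      then show ?thesis
        using True X disj inc[of i j] inc[of j i] adjV2[of i j] sym[of i j]
        by (auto simp: block_fmat_def fmat_transpose_def)
    qed
    then show "adj_matrix ?G i j = block_fmat X1 X2
      (\<lambda>i j. \<epsilon> * (fmat_ones X1 i j - fmat_id X1 i j)) (incidence_matrix Q)
      (fmat_transpose (incidence_matrix Q)) (adj_matrix (?G \<restriction> X2)) i j"
      by (simp add: A_def)
  qed
  have inter: "card (block Q i \<inter> block Q j) = (if (i, j) \<in> parcs \<Gamma> then x else y)"
    if ij: "i \<in> X2" "j \<in> X2" "i \<noteq> j" for i j
  proof -
    have "real (card (block Q i \<inter> block Q j)) = (\<Sum>k\<in>X1. if (k, i) \<in> parcs \<Gamma> \<and> (k, j) \<in> parcs \<Gamma> then 1 else 0)"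
      using F.fin by (simp add: sum.If_cases Int_def Q) (rule arg_cong[where f = card], auto)
    also have "\<dots> = (\<Sum>k\<in>X1. A i k * A k j)"
      by (rule sum.cong) (use sympar in \<open>auto simp: A_eq\<close>)
    also have "\<dots> = real (if (i, j) \<in> parcs \<Gamma> then x else y)"
      using F.pairs2[OF ij] by (simp add: A_eq)
    finally show ?thesis by (simp only: of_nat_eq_iff)
  qed
  have qsd: "QSD Q (card X1) k21 l (card X2) k12 x y"
    unfolding QSD_def two_design_def quasi_symmetric_def
  proof (intro conjI ballI impI)
    show "finite (points Q)" "finite (block_ids Q)" "card (points Q) = card X1"
      "card (block_ids Q) = card X2" "x \<noteq> y"
      using F.fin xy by (simp_all add: Q)
    show "block Q j \<subseteq> points Q" for j by (auto simp: Q)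
    show "card (block Q j) = k21" if "j \<in> block_ids Q" for j
      using c21[of j] that sympar by (simp add: Q)
    show "card {j \<in> block_ids Q. q \<in> block Q j} = k12" if "q \<in> points Q" for q
      using c12[of q] that by (simp add: Q)
    show "card {j \<in> block_ids Q. q \<in> block Q j \<and> r \<in> block Q j} = l"
      if qr: "q \<in> points Q" "r \<in> points Q" "q \<noteq> r" for q r
    proof -
      have m: "q \<in> X1" "r \<in> X1" using qr by (simp_all add: Q)
      have "real (card {j \<in> block_ids Q. q \<in> block Q j \<and> r \<in> block Q j})
          = (\<Sum>k\<in>X2. if (q, k) \<in> parcs \<Gamma> \<and> (r, k) \<in> parcs \<Gamma> then 1 else 0)"
        using F.fin m by (simp add: sum.If_cases Int_def Q)
      also have "\<dots> = (\<Sum>k\<in>X2. A q k * A k r)"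
        by (rule sum.cong) (use sympar in \<open>auto simp: A_eq\<close>)
      also have "\<dots> = real l" using F.pairs1 m qr(3) by simp
      finally show ?thesis by simp
    qed
    show "{card (block Q i \<inter> block Q j) |i j. i \<in> block_ids Q \<and> j \<in> block_ids Q \<and> i \<noteq> j} = {x, y}"
    proof
      show "{card (block Q i \<inter> block Q j) |i j. i \<in> block_ids Q \<and> j \<in> block_ids Q \<and> i \<noteq> j} \<subseteq> {x, y}"
        using inter by (auto simp: Q(2))
      obtain i j where 1: "i \<in> X2" "j \<in> X2" "i \<noteq> j" "A i j = 1" using F.N_nontrivial(1) by blast
      then have "card (block Q i \<inter> block Q j) = x" using inter by (simp add: A_eq split: if_splits)
      moreover obtain i' j' where 2: "i' \<in> X2" "j' \<in> X2" "i' \<noteq> j'" "A i' j' = 0"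
        using F.N_nontrivial(2) by blast
      then have "card (block Q i' \<inter> block Q j') = y" using inter by (simp add: A_eq split: if_splits)
      ultimately show "{x, y} \<subseteq> {card (block Q i \<inter> block Q j) |i j. i \<in> block_ids Q \<and> j \<in> block_ids Q \<and> i \<noteq> j}"
        using 1 2 by (auto simp: Q(2))
    qed
  qed
  have ind: "?G \<restriction> X2 = with_proj (block_graph x Q)"
  proof -
    have nl: "(i, i) \<notin> parcs \<Gamma>" for i using G.pair_no_loops[of "(i, i)"] by auto
    have "(i, j) \<in> parcs \<Gamma> \<and> i \<in> X2 \<and> j \<in> X2
      \<longleftrightarrow> i \<in> X2 \<and> j \<in> X2 \<and> i \<noteq> j \<and> card (block Q i \<inter> block Q j) = x" for i j
    proof (cases "i \<in> X2 \<and> j \<in> X2 \<and> i \<noteq> j")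
      case True
      then show ?thesis using inter[of i j] xy by (cases "(i, j) \<in> parcs \<Gamma>") simp_all
    next
      case False
      then show ?thesis using nl by metis
    qed
    then have "{e \<in> parcs \<Gamma>. fst e \<in> X2 \<and> snd e \<in> X2}
      = {(i, j). i \<in> X2 \<and> j \<in> X2 \<and> i \<noteq> j \<and> card (block Q i \<inter> block Q j) = x}"
      by (simp add: set_eq_iff split_paired_all)
    then show ?thesis
      by (simp add: induce_subgraph_def with_proj_def block_graph_def Q(2))
  qed
  have sub: "(i, j) \<in> arcs_ends (?G \<restriction> X1) \<longleftrightarrow> A i j = 1" if "i \<in> X1" "j \<in> X1" for i j
    using that by (auto simp: A_eq arcs_ends_conv image_iff)
  \<comment> \<open>The first fibre has two points, so it is not both empty and complete and determines \<open>\<epsilon>\<close>.\<close>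
  have empty: "\<epsilon> = 0" if e: "empty_graph (?G \<restriction> X1)"
  proof -
    obtain i j where ij: "i \<in> X1" "j \<in> X1" "i \<noteq> j" using F.two_points by blast
    then have "A i j \<noteq> 1" using e sub by (simp add: empty_graph_def)
    then show ?thesis using F.trivial_fibre[OF ij] eps by auto
  qed
  have complete: "\<epsilon> = 1" if e: "complete_graph (?G \<restriction> X1)"
  proof -
    obtain i j where ij: "i \<in> X1" "j \<in> X1" "i \<noteq> j" using F.two_points by blast
    then have "A i j = 1" using e sub by (simp add: complete_graph_def)
    then show ?thesis using F.trivial_fibre[OF ij] by simp
  qed
  have xy_real: "real x - real y \<noteq> 0" using xy by simp
  have r1: "real l - real k12 = p + \<epsilon> * s + \<epsilon>\<^sup>2" by (rule F.lambda_minus_r)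
  have r2: "(real k12 - real l + real y - real k21) / (real x - real y) = s + \<epsilon>"
    using F.eigenvalue_sum xy_real by (simp add: divide_eq_eq mult.commute)
  have "sqrt ((real k1 + p) * (real k2 + p)) = a1 * a2"
    unfolding a1[symmetric] a2[symmetric] using apos by (simp add: real_sqrt_mult)
  moreover have "a1 * a2 - \<epsilon> * real k21 = (real l * real k21 - real y * real k12) / (real x - real y)"
    using F.alpha_product xy_real by (simp add: eq_divide_eq mult.commute)
  ultimately have r3: "sqrt ((real k1 + p) * (real k2 + p))
      = \<epsilon> * real k21 + (real l * real k21 - real y * real k12) / (real x - real y)"
    by simp
  have restr: "\<exists>u. (\<forall>i\<in>X2. (\<Sum>j\<in>X2. A i j * u j) = e * u i) \<and> (\<exists>i\<in>X2. u i \<noteq> 0) \<and> (\<Sum>i\<in>X2. u i) = 0"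
    if e: "e \<in> restricted_eigenvalues (with_proj (block_graph x Q))" for e
  proof -
    obtain u where u: "graph_eigenvector (?G \<restriction> X2) e u" "(\<Sum>i\<in>X2. u i) = 0"
      using e unfolding ind[symmetric] restricted_eigenvalues_def by auto
    have "(\<Sum>j\<in>X2. A i j * u j) = e * u i" if "i \<in> X2" for i
    proof -
      have "(\<Sum>j\<in>X2. A i j * u j) = (\<Sum>j\<in>X2. adj_matrix (?G \<restriction> X2) i j * u j)"
        by (rule sum.cong) (use that adjV2 in auto)
      then show ?thesis using u(1) that by (simp add: graph_eigenvector_def)
    qed
    then show ?thesis using u by (intro exI[of _ u]) (auto simp: graph_eigenvector_def)
  qed
  have final: "((\<theta>1 = e1 \<and> e1 = (real y - real k21) / (real x - real y)) \<or>
       (\<theta>2 = e2 \<and> e2 = (real y - real k21) / (real x - real y))) \<and>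
      real x = real k21 + (\<theta>1 + 1) * (\<theta>2 + 1) - (e1 + 1) * (e2 + 1) \<and>
      real y = real k21 + \<theta>1 * \<theta>2 - e1 * e2"
    if e: "e1 > e2" "restricted_eigenvalues (with_proj (block_graph x Q)) = {e1, e2}" for e1 e2
  proof -
    obtain u where u: "\<forall>i\<in>X2. (\<Sum>j\<in>X2. A i j * u j) = e1 * u i" "\<exists>i\<in>X2. u i \<noteq> 0" "(\<Sum>i\<in>X2. u i) = 0"
      using restr[of e1] e(2) by auto
    obtain v where v: "\<forall>i\<in>X2. (\<Sum>j\<in>X2. A i j * v j) = e2 * v i" "\<exists>i\<in>X2. v i \<noteq> 0" "(\<Sum>i\<in>X2. v i) = 0"
      using restr[of e2] e(2) by auto
    note pair = F.restricted_eigenvalues_pair[OF s_def p_def less(2) u(1)[rule_format] u(2,3)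
        v(1)[rule_format] v(2,3) e(1) eps]
    show ?thesis using pair by blast
  qed
  show ?thesis
  proof (intro exI conjI)
    show "biregular ?G" by (rule bireg)
    show "k1 \<noteq> k2" by (rule k_ne)
    show "X1 = degree_class ?G k1" "X2 = degree_class ?G k2" by (rule V1, rule V2)
    show "valency_partition ?G = {X1, X2}" by (rule val)
    show "equitable ?G [X1, X2] [[k11, k12], [k21, k22]]" by (rule equi)
    show "card X1 = card X1" "card X2 = card X2" by (rule refl)+
    show "\<epsilon> \<in> {0, 1}" using eps by simp
    show "adj_matrix ?G = block_fmat X1 X2
      (\<lambda>i j. \<epsilon> * (fmat_ones X1 i j - fmat_id X1 i j)) (incidence_matrix Q)
      (fmat_transpose (incidence_matrix Q)) (adj_matrix (?G \<restriction> X2))" by (rule blocks)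
    show "points Q = X1" "block_ids Q = X2" by (simp_all add: Q)
    show "incidence_matrix Q = incidence_matrix Q" by (rule refl)
    show "QSD Q (card X1) k21 l (card X2) k12 x y" by (rule qsd)
    show "?G \<restriction> X2 = with_proj (block_graph x Q)" by (rule ind)
    show "\<forall>e1 e2 :: real.
        e1 > e2 \<and> restricted_eigenvalues (with_proj (block_graph x Q)) = {e1, e2} \<longrightarrow>
          ((\<theta>1 = e1 \<and> e1 = (real y - real k21) / (real x - real y)) \<or>
           (\<theta>2 = e2 \<and> e2 = (real y - real k21) / (real x - real y))) \<and>
          real x = real k21 + (\<theta>1 + 1) * (\<theta>2 + 1) - (e1 + 1) * (e2 + 1) \<and>
          real y = real k21 + \<theta>1 * \<theta>2 - e1 * e2 \<and>
          (empty_graph (?G \<restriction> X1) \<longrightarrow>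
             real l - real k12 = \<theta>1 * \<theta>2 \<and>
             (real k12 - real l + real y - real k21) / (real x - real y) = \<theta>1 + \<theta>2 \<and>
             sqrt ((real k1 + \<theta>1 * \<theta>2) * (real k2 + \<theta>1 * \<theta>2)) =
               (real l * real k21 - real y * real k12) / (real x - real y)) \<and>
          (complete_graph (?G \<restriction> X1) \<longrightarrow>
             real l - real k12 = (\<theta>1 + 1) * (\<theta>2 + 1) \<and>
             (real k12 - real l + real y - real k21) / (real x - real y) = \<theta>1 + \<theta>2 + 1 \<and>
             sqrt ((real k1 + \<theta>1 * \<theta>2) * (real k2 + \<theta>1 * \<theta>2)) =
               real k21 + (real l * real k21 - real y * real k12) / (real x - real y))"
    proof (intro allI impI)
      fix e1 e2 assume e: "e1 > e2 \<and> restricted_eigenvalues (with_proj (block_graph x Q)) = {e1, e2}"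
      note fin3 = final[OF conjunct1[OF e] conjunct2[OF e]]
      show "((\<theta>1 = e1 \<and> e1 = (real y - real k21) / (real x - real y)) \<or>
           (\<theta>2 = e2 \<and> e2 = (real y - real k21) / (real x - real y))) \<and>
          real x = real k21 + (\<theta>1 + 1) * (\<theta>2 + 1) - (e1 + 1) * (e2 + 1) \<and>
          real y = real k21 + \<theta>1 * \<theta>2 - e1 * e2 \<and>
          (empty_graph (?G \<restriction> X1) \<longrightarrow>
             real l - real k12 = \<theta>1 * \<theta>2 \<and>
             (real k12 - real l + real y - real k21) / (real x - real y) = \<theta>1 + \<theta>2 \<and>
             sqrt ((real k1 + \<theta>1 * \<theta>2) * (real k2 + \<theta>1 * \<theta>2)) =
               (real l * real k21 - real y * real k12) / (real x - real y)) \<and>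
          (complete_graph (?G \<restriction> X1) \<longrightarrow>
             real l - real k12 = (\<theta>1 + 1) * (\<theta>2 + 1) \<and>
             (real k12 - real l + real y - real k21) / (real x - real y) = \<theta>1 + \<theta>2 + 1 \<and>
             sqrt ((real k1 + \<theta>1 * \<theta>2) * (real k2 + \<theta>1 * \<theta>2)) =
               real k21 + (real l * real k21 - real y * real k12) / (real x - real y))"
      proof (intro conjI impI)
        assume "empty_graph (?G \<restriction> X1)"
        then have 0: "\<epsilon> = 0" by (rule empty)
        show "real l - real k12 = \<theta>1 * \<theta>2" using r1 0 by (simp add: p_def)
        show "(real k12 - real l + real y - real k21) / (real x - real y) = \<theta>1 + \<theta>2"
          using r2 0 by (simp add: s_def)
        show "sqrt ((real k1 + \<theta>1 * \<theta>2) * (real k2 + \<theta>1 * \<theta>2)) =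
               (real l * real k21 - real y * real k12) / (real x - real y)"
          using r3 0 by (simp add: p_def)
      next
        assume "complete_graph (?G \<restriction> X1)"
        then have 1: "\<epsilon> = 1" by (rule complete)
        show "real l - real k12 = (\<theta>1 + 1) * (\<theta>2 + 1)"
          using r1 1 by (simp add: p_def s_def algebra_simps)
        show "(real k12 - real l + real y - real k21) / (real x - real y) = \<theta>1 + \<theta>2 + 1"
          using r2 1 by (simp add: s_def)
        show "sqrt ((real k1 + \<theta>1 * \<theta>2) * (real k2 + \<theta>1 * \<theta>2)) =
               real k21 + (real l * real k21 - real y * real k12) / (real x - real y)"
          using r3 1 by (simp add: p_def)
      qed (use fin3 in blast)+
    qed
  qed
qed

end
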